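(* Let $Z^*=(X^*,W^* )$ be a bivariate stationary Gaussian random field on $\mathbb R$ with matrix covariance function $K=(K_{k\ell})$, where each $K_{k\ell}$, $k,\ell\in\{1,2\}$, satisfies condition $\mathrm A(L,c_{k\ell},\alpha_{k\ell})$ (defined in the context) for some $L>0$. Let $\mathrm{Var}(X^*(s))=\mathrm{Var}(W^*(s))=1$, and let $\sigma_X\in(0,\infty)$ and $\sigma_W\in(0,\infty)$ be positive processes on $\mathbb R$, independent of $Z^*$ and not depending on $\beta$, with almost surely piecewise analytic paths. Let $X(s)=\sigma_X(s)X^*(s)$, $W(s)=\sigma_W(s)W^*(s)$, $Y(s)=X(s)\beta+W(s)$. Then: (a) Consistency: If $\alpha_{11}<\min\{\alpha_{12},\alpha_{22}+1,2\}$, the OLS estimator based on first differences of $X$ and $Y$ on the regular grid $jh$, $j=0,\dots,n$, $h=L/n$, in $[0,L]$ is consistent for $\beta$. (b) Equivalence: If $\alpha_{11}>\alpha_{22}+1$, and $X^*$ and $W^*$ have spectral densities that satisfy the regularity conditions of the context with high frequency decay $\asymp|\omega|^{-(\alpha_{11}+1)}$ and $\asymp|\omega|^{-(\alpha_{22}+1)}$ respectively, then $\beta$ is not consistently estimable on the paths of $(X,Y)$.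
   Context: Condition $\mathrm A(L,c,\alpha)$: $K(t)=A(t)+B(t)$, where $A$ is even and analytic and $B$ is even and continuous on $[-L,L]$; the $k$-th derivative $B^{(k)}$ on $(0,L]$ ($k\ge0$, $B^{(0)}=B$) satisfies, as $t\downarrow0$, $B^{(k)}(t)=(\alpha)_k\,c\,t^{\alpha-k}+o(t^{\alpha-k})$, where $c$ is a constant (non-zero for covariance functions, possibly zero for cross-covariances), $\alpha>0$ is not an even integer, $(\alpha)_k=\Gamma(\alpha+1)/\Gamma(\alpha+1-k)$. Index $1$ refers to $X^*$, $2$ to $W^*$. Piecewise analytic on $[0,L]$: there exist $0=\tau_0<\dots<\tau_m=L$ such that each restriction to $[\tau_{r-1},\tau_r]$ extends to an analytic function on an open neighborhood of $[\tau_{r-1},\tau_r]$ (in particular the function is continuous). First-difference OLS estimator: $\sum_{j=1}^n\{X(jh)-X((j-1)h)\}\{Y(jh)-Y((j-1)h)\}\big/\sum_{j=1}^n\{X(jh)-X((j-1)h)\}^2$; consistent means convergence to $\beta$ in probability as $n\to\infty$. Regularity conditions on spectral densities $f_1,f_2$ of $X^*,W^*$: each is positive, continuous, bounded away from $0$ and $\infty$ as $\omega\to0$, and there are constants $c_1,c_2>0$ and positive real functions $\phi_1,\phi_2$, each the Fourier transform of a square-integrable function vanishing outside some bounded set containing $[0,L]$, with $c_1\phi_i^2\le f_i\le c_2\phi_i^2$ on $\mathbb R$. The model consists of all $\beta\in\mathbb R$ and all laws of $(X^*,W^* )$ and $(\sigma_X,\sigma_W)$ satisfying the hypotheses with the given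 exponents (the case of $X^*$ and $W^*$ independent included). "Not consistently estimable" means there is no sequence of measurable functions of $\{(X(s),Y(s)):s\in[0,L]\}$ converging in probability to $\beta$ under every member of the model. *)

theory Defs
  imports "HOL-Probability.Probability" "HOL-Library.Landau_Symbols"
begin

subsection \<open>Real analytic functions\<close>

definition real_analytic_on :: "(real \<Rightarrow> real) \<Rightarrow> real set \<Rightarrow> bool" where
  "real_analytic_on f U \<longleftrightarrow>
     (\<forall>x\<in>U. \<exists>a r. r > 0 \<and> (\<forall>y. \<bar>y - x\<bar> < r \<longrightarrow> (\<lambda>n. a n * (y - x) ^ n) sums f y))"

text \<open>Analyticity on a closed interval \<open>S\<close> is understood, as usual, as the existence of an
  analytic extension to an open neighbourhood of \<open>S\<close>; values of \<open>f\<close> outside \<open>S\<close> do not matter.\<close>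

definition extends_analytically :: "(real \<Rightarrow> real) \<Rightarrow> real set \<Rightarrow> bool" where
  "extends_analytically f S \<longleftrightarrow>
     (\<exists>U g. open U \<and> S \<subseteq> U \<and> real_analytic_on g U \<and> (\<forall>x\<in>S. g x = f x))"

definition piecewise_analytic :: "real \<Rightarrow> (real \<Rightarrow> real) \<Rightarrow> bool" where
  "piecewise_analytic L f \<longleftrightarrow>
     (\<exists>(m::nat) \<tau>. \<tau> 0 = 0 \<and> \<tau> m = L \<and> (\<forall>r<m. \<tau> r < \<tau> (Suc r)) \<and>
        (\<forall>r<m. extends_analytically f {\<tau> r..\<tau> (Suc r)}))"

subsection \<open>The covariance condition \<open>A(L, c, \<alpha>)\<close>\<close>

definition even_on :: "real \<Rightarrow> (real \<Rightarrow> real) \<Rightarrow> bool" where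
  "even_on L f \<longleftrightarrow> (\<forall>t\<in>{-L..L}. f (- t) = f t)"

text \<open>When \<open>\<alpha> + 1 - k\<close> is a nonpositive integer, \<open>1 / \<Gamma>\<close> vanishes there; the conventions
  \<open>Gamma x = 0\<close> at poles and \<open>y / 0 = 0\<close> give this value \<open>0\<close>.\<close>

definition gamma_falling :: "real \<Rightarrow> nat \<Rightarrow> real" where
  "gamma_falling \<alpha> k = Gamma (\<alpha> + 1) / Gamma (\<alpha> + 1 - real k)"

text \<open>\<open>D k\<close> is the \<open>k\<close>-th derivative of \<open>B\<close> on \<open>(0, L]\<close>, one-sided at \<open>L\<close>.\<close>

definition condition_A :: "real \<Rightarrow> real \<Rightarrow> real \<Rightarrow> (real \<Rightarrow> real) \<Rightarrow> bool" where
  "condition_A L c \<alpha> K \<longleftrightarrow>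
     \<alpha> > 0 \<and> (\<forall>m::nat. \<alpha> \<noteq> 2 * real m) \<and>
     (\<exists>A B D. (\<forall>t\<in>{-L..L}. K t = A t + B t) \<and>
        even_on L A \<and> extends_analytically A {-L..L} \<and>
        even_on L B \<and> continuous_on {-L..L} B \<and>
        (\<forall>t\<in>{0<..L}. D 0 t = B t) \<and>
        (\<forall>k. \<forall>t\<in>{0<..L}. (D k has_real_derivative D (Suc k) t) (at t within {0<..L})) \<and>
        (\<forall>k. (\<lambda>t. D k t - gamma_falling \<alpha> k * c * t powr (\<alpha> - real k))
                \<in> o[at_right 0](\<lambda>t. t powr (\<alpha> - real k))))"

subsection \<open>Bivariate stationary Gaussian fields\<close>

text \<open>Degenerate normal laws are allowed.\<close>

definition normal_rv :: "'a measure \<Rightarrow> ('a \<Rightarrow> real) \<Rightarrow> bool" where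
  "normal_rv M V \<longleftrightarrow> V \<in> borel_measurable M \<and>
     (\<exists>\<mu>. (\<exists>s>0. distributed M lborel V (normal_density \<mu> s)) \<or> (AE w in M. V w = \<mu>))"

definition covariance :: "'a measure \<Rightarrow> ('a \<Rightarrow> real) \<Rightarrow> ('a \<Rightarrow> real) \<Rightarrow> real" where
  "covariance M U V =
     (LINT w|M. (U w - (LINT v|M. U v)) * (V w - (LINT v|M. V v)))"

text \<open>\<open>Z 1\<close> is \<open>X*\<close> and \<open>Z 2\<close> is \<open>W*\<close>; index values other than 1 and 2 are irrelevant.
  The constant mean of each component is unrestricted.\<close>

definition stationary_gaussian_field ::
  "'a measure \<Rightarrow> (nat \<Rightarrow> real \<Rightarrow> 'a \<Rightarrow> real) \<Rightarrow> (nat \<Rightarrow> nat \<Rightarrow> real \<Rightarrow> real) \<Rightarrow> bool" where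
  "stationary_gaussian_field M Z K \<longleftrightarrow>
     prob_space M \<and>
     (\<forall>k\<in>{1, 2}. \<forall>s. Z k s \<in> borel_measurable M) \<and>
     (\<forall>S a b. finite S \<longrightarrow> normal_rv M (\<lambda>w. \<Sum>s\<in>S. a s * Z 1 s w + b s * Z 2 s w)) \<and>
     (\<forall>k\<in>{1, 2}. \<exists>\<mu>. \<forall>s. (LINT w|M. Z k s w) = \<mu>) \<and>
     (\<forall>k\<in>{1, 2}. \<forall>l\<in>{1, 2}. \<forall>s t. covariance M (Z k (s + t)) (Z l s) = K k l t)"

text \<open>The pair \<open>(\<sigma>\<^sub>X, \<sigma>\<^sub>W)\<close> may have dependent components; as a process it is independent of
  \<open>Z\<close>, both processes carrying the \<open>\<sigma>\<close>-algebra generated by their coordinates.\<close>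

definition scale_processes ::
  "real \<Rightarrow> 'a measure \<Rightarrow> (nat \<Rightarrow> real \<Rightarrow> 'a \<Rightarrow> real) \<Rightarrow> (real \<Rightarrow> 'a \<Rightarrow> real) \<Rightarrow> (real \<Rightarrow> 'a \<Rightarrow> real) \<Rightarrow> bool"
  where
  "scale_processes L M Z \<sigma>X \<sigma>W \<longleftrightarrow>
     (\<forall>s. \<sigma>X s \<in> borel_measurable M \<and> \<sigma>W s \<in> borel_measurable M) \<and>
     (\<forall>w\<in>space M. \<forall>s. \<sigma>X s w > 0 \<and> \<sigma>W s w > 0) \<and>
     prob_space.indep_var M
       (\<Pi>\<^sub>M s\<in>UNIV. (borel :: (real \<times> real) measure)) (\<lambda>w s. (Z 1 s w, Z 2 s w))
       (\<Pi>\<^sub>M s\<in>UNIV. (borel :: (real \<times> real) measure)) (\<lambda>w s. (\<sigma>X s w, \<sigma>W s w)) \<and>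
     (AE w in M. piecewise_analytic L (\<lambda>s. \<sigma>X s w) \<and> piecewise_analytic L (\<lambda>s. \<sigma>W s w))"

definition confounding_setting ::
  "real \<Rightarrow> (nat \<Rightarrow> nat \<Rightarrow> real) \<Rightarrow> (nat \<Rightarrow> nat \<Rightarrow> real) \<Rightarrow> (nat \<Rightarrow> nat \<Rightarrow> real \<Rightarrow> real) \<Rightarrow>
   'a measure \<Rightarrow> (nat \<Rightarrow> real \<Rightarrow> 'a \<Rightarrow> real) \<Rightarrow> (real \<Rightarrow> 'a \<Rightarrow> real) \<Rightarrow> (real \<Rightarrow> 'a \<Rightarrow> real) \<Rightarrow> bool"
  where
  "confounding_setting L \<alpha> c K M Z \<sigma>X \<sigma>W \<longleftrightarrow>
     stationary_gaussian_field M Z K \<and>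
     (\<forall>k\<in>{1, 2}. \<forall>l\<in>{1, 2}. condition_A L (c k l) (\<alpha> k l) (K k l)) \<and>
     c 1 1 \<noteq> 0 \<and> c 2 2 \<noteq> 0 \<and>
     (\<forall>k\<in>{1, 2}. \<forall>s. covariance M (Z k s) (Z k s) = 1) \<and>
     scale_processes L M Z \<sigma>X \<sigma>W"

definition scaled :: "(real \<Rightarrow> 'a \<Rightarrow> real) \<Rightarrow> (real \<Rightarrow> 'a \<Rightarrow> real) \<Rightarrow> real \<Rightarrow> 'a \<Rightarrow> real" where
  "scaled \<sigma> V s w = \<sigma> s w * V s w"

definition response ::
  "real \<Rightarrow> (real \<Rightarrow> 'a \<Rightarrow> real) \<Rightarrow> (real \<Rightarrow> 'a \<Rightarrow> real) \<Rightarrow> real \<Rightarrow> 'a \<Rightarrow> real" where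
  "response \<beta> X W s w = X s w * \<beta> + W s w"

subsection \<open>Estimation\<close>

definition converges_in_prob :: "'a measure \<Rightarrow> (nat \<Rightarrow> 'a \<Rightarrow> real) \<Rightarrow> real \<Rightarrow> bool" where
  "converges_in_prob M T b \<longleftrightarrow>
     (\<forall>\<epsilon>>0. (\<lambda>n. measure M {w \<in> space M. \<bar>T n w - b\<bar> > \<epsilon>}) \<longlonglongrightarrow> 0)"

definition first_difference_ols ::
  "real \<Rightarrow> (real \<Rightarrow> 'a \<Rightarrow> real) \<Rightarrow> (real \<Rightarrow> 'a \<Rightarrow> real) \<Rightarrow> nat \<Rightarrow> 'a \<Rightarrow> real" where
  "first_difference_ols L X Y n w =
     (let h = L / real n in
       (\<Sum>j=1..n. (X (real j * h) w - X ((real j - 1) * h) w) *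
                  (Y (real j * h) w - Y ((real j - 1) * h) w)) /
       (\<Sum>j=1..n. (X (real j * h) w - X ((real j - 1) * h) w)\<^sup>2))"

subsection \<open>Spectral conditions\<close>

definition spectral_density :: "(real \<Rightarrow> real) \<Rightarrow> (real \<Rightarrow> real) \<Rightarrow> bool" where
  "spectral_density K f \<longleftrightarrow>
     (\<forall>\<omega>. f \<omega> \<ge> 0) \<and> integrable lborel f \<and>
     (\<forall>t. complex_of_real (K t) = (CLINT \<omega>|lborel. iexp (\<omega> * t) * complex_of_real (f \<omega>)))"

text \<open>A square-integrable \<open>g\<close> with bounded support is integrable, so its Fourier transform is
  given by the ordinary Fourier integral.\<close>

definition compactly_supported_transform :: "real \<Rightarrow> (real \<Rightarrow> real) \<Rightarrow> bool" where
  "compactly_supported_transform L \<phi> \<longleftrightarrow>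
     (\<exists>(g :: real \<Rightarrow> complex) S.
        g \<in> borel_measurable lborel \<and> integrable lborel (\<lambda>x. (cmod (g x))\<^sup>2) \<and>
        bounded S \<and> {0..L} \<subseteq> S \<and> (\<forall>x. x \<notin> S \<longrightarrow> g x = 0) \<and>
        (\<forall>\<omega>. complex_of_real (\<phi> \<omega>) = (CLINT x|lborel. iexp (- (\<omega> * x)) * g x)))"

definition regular_density :: "real \<Rightarrow> real \<Rightarrow> real \<Rightarrow> (real \<Rightarrow> real) \<Rightarrow> bool" where
  "regular_density L c\<^sub>1 c\<^sub>2 f \<longleftrightarrow>
     (\<forall>\<omega>. f \<omega> > 0) \<and> continuous_on UNIV f \<and>
     (\<exists>a b. a > 0 \<and> (\<forall>\<^sub>F \<omega> in at 0. a \<le> f \<omega> \<and> f \<omega> \<le> b)) \<and>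
     (\<exists>\<phi>. (\<forall>\<omega>. \<phi> \<omega> > 0) \<and> compactly_supported_transform L \<phi> \<and>
        (\<forall>\<omega>. c\<^sub>1 * (\<phi> \<omega>)\<^sup>2 \<le> f \<omega> \<and> f \<omega> \<le> c\<^sub>2 * (\<phi> \<omega>)\<^sup>2))"

definition spectral_conditions ::
  "real \<Rightarrow> (nat \<Rightarrow> nat \<Rightarrow> real) \<Rightarrow> (nat \<Rightarrow> nat \<Rightarrow> real \<Rightarrow> real) \<Rightarrow> bool" where
  "spectral_conditions L \<alpha> K \<longleftrightarrow>
     (\<exists>f c\<^sub>1 c\<^sub>2. c\<^sub>1 > 0 \<and> c\<^sub>2 > 0 \<and>
        (\<forall>i\<in>{1::nat, 2}. spectral_density (K i i) (f i) \<and> regular_density L c\<^sub>1 c\<^sub>2 (f i) \<and>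
            f i \<in> \<Theta>[at_infinity](\<lambda>\<omega>. \<bar>\<omega>\<bar> powr (- (\<alpha> i i + 1)))))"

subsection \<open>The model and consistent estimability\<close>

text \<open>Members of the model live on probability spaces, with arbitrary \<open>\<sigma>\<close>-algebra, whose points
  are paths of four real processes. This loses no law of \<open>(Z, \<sigma>\<^sub>X, \<sigma>\<^sub>W)\<close>: complete any given
  probability space and push it forward along its path map, taking as measurable the sets with
  measurable preimage. The plain product \<open>\<sigma>\<close>-algebra on paths would not do, because a set it
  contains constrains only countably many coordinates, so almost sure piecewise analyticity could
  never hold for coordinate processes. The constants \<open>c\<close>, the covariance \<open>K\<close> and the spectral
  densities vary over the model; only \<open>L\<close> and the exponents \<open>\<alpha>\<close> are fixed.\<close>

type_synonym sample_path = "real \<Rightarrow> (real \<times> real) \<times> (real \<times> real)"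

definition in_model ::
  "real \<Rightarrow> (nat \<Rightarrow> nat \<Rightarrow> real) \<Rightarrow> sample_path measure \<Rightarrow> (nat \<Rightarrow> real \<Rightarrow> sample_path \<Rightarrow> real) \<Rightarrow>
   (real \<Rightarrow> sample_path \<Rightarrow> real) \<Rightarrow> (real \<Rightarrow> sample_path \<Rightarrow> real) \<Rightarrow> bool" where
  "in_model L \<alpha> M Z \<sigma>X \<sigma>W \<longleftrightarrow>
     (\<exists>c K. confounding_setting L \<alpha> c K M Z \<sigma>X \<sigma>W \<and> spectral_conditions L \<alpha> K)"

text \<open>An estimator is a measurable function on the path space of \<open>(X, Y)\<close> over \<open>[0, L]\<close> with the
  \<open>\<sigma>\<close>-algebra generated by the coordinates.\<close>

definition consistently_estimable :: "real \<Rightarrow> (nat \<Rightarrow> nat \<Rightarrow> real) \<Rightarrow> bool" where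
  "consistently_estimable L \<alpha> \<longleftrightarrow>
     (\<exists>T :: nat \<Rightarrow> (real \<Rightarrow> real \<times> real) \<Rightarrow> real.
        (\<forall>n. T n \<in> borel_measurable (\<Pi>\<^sub>M s\<in>{0..L}. borel)) \<and>
        (\<forall>\<beta> M Z \<sigma>X \<sigma>W. in_model L \<alpha> M Z \<sigma>X \<sigma>W \<longrightarrow>
           (let X = scaled \<sigma>X (Z 1); W = scaled \<sigma>W (Z 2); Y = response \<beta> X W in
            converges_in_prob M (\<lambda>n w. T n (\<lambda>s\<in>{0..L}. (X s w, Y s w))) \<beta>)))"

end

(*
  (a) With N = sum dX_j dW_j and D = sum (dX_j)^2 the estimation error is N / D. For fixed scale
  paths, Isserlis' formula bounds E N^2 and Var D by double sums of products of two increment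
  covariances, and condition A together with the Lipschitz scales bounds a covariance of increments
  at lag |j - k| by a multiple of h^2 ((|j - k| + 1) h)^(g - 2). For each product the sum of the two
  exponents g can be lowered to a number strictly between 2 alpha_11 - 1 and 3; below 3 the double
  sum is of order n, and above 2 alpha_11 - 1 it is negligible against (E D)^2. Chebyshev's
  inequality gives the claim; random scales follow by conditioning on them and dominated convergence.

  (b) Take X and W independent with unit scales. On a finite grid, adding beta x to a Gaussian vector
  with covariance matrix Q changes its law by at most |beta| times the reproducing kernel norm of x
  in total variation: split off one standard normal coordinate. The mean of the squared norm of X is
  the trace of Q_2^(-1) Q_1. This is bounded uniformly in the grid because f_1 / f_2 decays like
  |omega|^(alpha_22 - alpha_11), which is integrable, and because evaluation at a frequency is
  controlled by the f_2-norm on functions with spectrum in [0, L]. Cylinder sets approximate every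
  event, so the laws of the paths for slope 0 and for a small slope beta are uniformly close in total
  variation, and no sequence of estimators can converge to both values.
*)
theory Submission
  imports Defs
begin

subsection \<open>Moments of Gaussian variables\<close>

text \<open>The means of the field are unrestricted, so (a) works with raw second moments: these are
  covariances plus constants, and the constants join the analytic part in condition A. In (b) a mean
  costs one more bound, on the kernel norm of the constant function. Lowering an exponent is
  possible because lags are bounded by L, and it lets two different covariance bounds multiply to
  one prescribed power. The trace of Q_2^(-1) Q_1 is handled without inverting a matrix: a family
  orthonormal for Q_2 stands in for the inverse. The control of a frequency value by the f_2-norm
  needs a kernel that reproduces every exponential with point in [0, L] and decays faster than 1/f_2
  grows; Levy's inversion formula for an iterated convolution of uniform laws supplies it. The
  splitting of a Gaussian vector is justified by characteristic functions, and multivariate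
  uniqueness is reduced to one dimension by nonnegative trigonometric weights. Non-estimability
  needs an independent member of the model: X* and W* taken from two independent copies of the given
  member keep their spectral densities and all marginal conditions.\<close>

lemma normal_rv_cases:
  assumes "normal_rv M V"
  obtains (dens) \<mu> s where "s > 0" "distributed M lborel V (normal_density \<mu> s)"
  | (const) \<mu> where "AE w in M. V w = \<mu>"
  using assms unfolding normal_rv_def by blast

lemma normal_density_moments:
  assumes s: "s > 0"
  shows "has_bochner_integral lborel (\<lambda>x. normal_density \<mu> s x * x\<^sup>2) (\<mu>\<^sup>2 + s\<^sup>2)"
    and "has_bochner_integral lborel (\<lambda>x. normal_density \<mu> s x * x ^ 4)
           (\<mu> ^ 4 + 6 * \<mu>\<^sup>2 * s\<^sup>2 + 3 * s ^ 4)"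
proof -
  let ?p = "normal_density \<mu> s"
  have e0: "has_bochner_integral lborel (\<lambda>x. ?p x * (x - \<mu>) ^ 0) 1"
    and e2: "has_bochner_integral lborel (\<lambda>x. ?p x * (x - \<mu>) ^ 2) (s\<^sup>2)"
    and e4: "has_bochner_integral lborel (\<lambda>x. ?p x * (x - \<mu>) ^ 4) (3 * s ^ 4)"
    using normal_moment_even[OF s, of \<mu> 0] normal_moment_even[OF s, of \<mu> 1]
      normal_moment_even[OF s, of \<mu> 2] s
    by (simp_all add: fact_numeral power2_eq_square power4_eq_xxxx field_simps)
  have e1: "has_bochner_integral lborel (\<lambda>x. ?p x * (x - \<mu>) ^ 1) 0"
    and e3: "has_bochner_integral lborel (\<lambda>x. ?p x * (x - \<mu>) ^ 3) 0"
    using normal_moment_odd[OF s, of \<mu> 0] normal_moment_odd[OF s, of \<mu> 1]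
    by (simp_all add: eval_nat_numeral)
  have "has_bochner_integral lborel
     (\<lambda>x. ?p x * (x - \<mu>) ^ 2 + (?p x * (x - \<mu>) ^ 1 * (2 * \<mu>) + ?p x * (x - \<mu>) ^ 0 * \<mu>\<^sup>2))
     (s\<^sup>2 + (0 * (2 * \<mu>) + 1 * \<mu>\<^sup>2))"
    by (intro has_bochner_integral_add has_bochner_integral_mult_left e0 e1 e2)
  then show "has_bochner_integral lborel (\<lambda>x. ?p x * x\<^sup>2) (\<mu>\<^sup>2 + s\<^sup>2)"
    by (rule has_bochner_integral_cong[THEN iffD1, rotated -1])
      (simp_all add: algebra_simps power2_eq_square)
  have "has_bochner_integral lborel
     (\<lambda>x. ?p x * (x - \<mu>) ^ 4 + (?p x * (x - \<mu>) ^ 3 * (4 * \<mu>) + (?p x * (x - \<mu>) ^ 2 * (6 * \<mu>\<^sup>2)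
        + (?p x * (x - \<mu>) ^ 1 * (4 * \<mu> ^ 3) + ?p x * (x - \<mu>) ^ 0 * \<mu> ^ 4))))
     (3 * s ^ 4 + (0 * (4 * \<mu>) + (s\<^sup>2 * (6 * \<mu>\<^sup>2) + (0 * (4 * \<mu> ^ 3) + 1 * \<mu> ^ 4))))"
    by (intro has_bochner_integral_add has_bochner_integral_mult_left e0 e1 e2 e3 e4)
  then show "has_bochner_integral lborel (\<lambda>x. ?p x * x ^ 4)
           (\<mu> ^ 4 + 6 * \<mu>\<^sup>2 * s\<^sup>2 + 3 * s ^ 4)"
    by (rule has_bochner_integral_cong[THEN iffD1, rotated -1])
      (simp_all add: algebra_simps eval_nat_numeral)
qed

context prob_space
begin

text \<open>The fourth moment is written in raw lower moments because this form suits linear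
  combinations and covers degenerate laws: with mean m and variance v, m^4 + 6 m^2 v + 3 v^2 = 3
  (m^2 + v)^2 - 2 m^4.\<close>

lemma normal_rv_moments:
  assumes V: "normal_rv M V"
  shows "integrable M V" "integrable M (\<lambda>w. (V w)\<^sup>2)" "integrable M (\<lambda>w. V w ^ 4)"
    and "expectation (\<lambda>w. V w ^ 4) = 3 * (expectation (\<lambda>w. (V w)\<^sup>2))\<^sup>2 - 2 * (expectation V) ^ 4"
proof -
  have mV[measurable]: "V \<in> borel_measurable M" using V by (simp add: normal_rv_def)
  have "integrable M V \<and> integrable M (\<lambda>w. (V w)\<^sup>2) \<and> integrable M (\<lambda>w. V w ^ 4) \<and>
      expectation (\<lambda>w. V w ^ 4) = 3 * (expectation (\<lambda>w. (V w)\<^sup>2))\<^sup>2 - 2 * (expectation V) ^ 4"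
    using V
  proof (cases rule: normal_rv_cases)
    case (dens \<mu> s)
    note D = dens(2)
    have 1: "has_bochner_integral lborel (\<lambda>x. normal_density \<mu> s x * x) \<mu>"
      by (rule normal_moment_nz_1[OF dens(1)])
    note m = 1 normal_density_moments[OF dens(1), of \<mu>]
    have i: "integrable M V" "integrable M (\<lambda>w. (V w)\<^sup>2)" "integrable M (\<lambda>w. V w ^ 4)"
      using distributed_integrable[OF D, of "\<lambda>x. x"] distributed_integrable[OF D, of "\<lambda>x. x\<^sup>2"]
        distributed_integrable[OF D, of "\<lambda>x. x ^ 4"] m[THEN integrable.intros]
      by simp_all
    have e: "expectation V = \<mu>" "expectation (\<lambda>w. (V w)\<^sup>2) = \<mu>\<^sup>2 + s\<^sup>2"
        "expectation (\<lambda>w. V w ^ 4) = \<mu> ^ 4 + 6 * \<mu>\<^sup>2 * s\<^sup>2 + 3 * s ^ 4"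
      using distributed_integral[OF D, of "\<lambda>x. x"] distributed_integral[OF D, of "\<lambda>x. x\<^sup>2"]
        distributed_integral[OF D, of "\<lambda>x. x ^ 4"] m[THEN has_bochner_integral_integral_eq]
      by simp_all
    show ?thesis using i unfolding e by (simp add: algebra_simps eval_nat_numeral)
  next
    case (const \<mu>)
    have c: "integrable M (\<lambda>w. V w ^ k) \<and> expectation (\<lambda>w. V w ^ k) = \<mu> ^ k" for k
    proof -
      have a: "AE w in M. V w ^ k = \<mu> ^ k" using const by eventually_elim simp
      have "integrable M (\<lambda>w. V w ^ k) \<longleftrightarrow> integrable M (\<lambda>w. \<mu> ^ k)"
        by (intro integrable_cong_AE a) auto
      moreover have "expectation (\<lambda>w. V w ^ k) = expectation (\<lambda>w. \<mu> ^ k)"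
        by (intro integral_cong_AE a) auto
      ultimately show ?thesis by (simp add: prob_space)
    qed
    show ?thesis using c[of 1] c[of 2] c[of 4] by (simp add: algebra_simps)
  qed
  then show "integrable M V" "integrable M (\<lambda>w. (V w)\<^sup>2)" "integrable M (\<lambda>w. V w ^ 4)"
    and "expectation (\<lambda>w. V w ^ 4) = 3 * (expectation (\<lambda>w. (V w)\<^sup>2))\<^sup>2 - 2 * (expectation V) ^ 4"
    by blast+
qed

lemma normal_rv_mult_integrable:
  assumes "normal_rv M U" "normal_rv M V" 
  shows "integrable M (\<lambda>w. U w * V w)"
proof (rule Bochner_Integration.integrable_bound[where f = "\<lambda>w. (U w)\<^sup>2 + (V w)\<^sup>2"])
  show "integrable M (\<lambda>w. (U w)\<^sup>2 + (V w)\<^sup>2)"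
    using normal_rv_moments(2)[OF assms(1)] normal_rv_moments(2)[OF assms(2)] by simp
  show "(\<lambda>w. U w * V w) \<in> borel_measurable M"
    using assms unfolding normal_rv_def by (intro borel_measurable_times) auto
  have "\<bar>a * b\<bar> \<le> a\<^sup>2 + b\<^sup>2" for a b :: real
    using sum_squares_bound[of "\<bar>a\<bar>" "\<bar>b\<bar>"] abs_ge_zero[of "a * b"]
    unfolding abs_mult power2_abs by linarith
  then show "AE w in M. norm (U w * V w) \<le> norm ((U w)\<^sup>2 + (V w)\<^sup>2)" by auto
qed

text \<open>Polarization: a product of four numbers is a signed sum of fourth powers of their signed
  sums, and the fourth moment of each such Gaussian sum is known. In raw second moments, non-zero
  means leave a single correction, minus twice the product of the means.\<close>

lemma isserlis:
  fixes V :: "nat \<Rightarrow> 'a \<Rightarrow> real"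
  assumes lin: "\<And>a. normal_rv M (\<lambda>w. \<Sum>i<4. a i * V i w)"
  defines "m i \<equiv> expectation (V i)" and "q i j \<equiv> expectation (\<lambda>w. V i w * V j w)"
  shows "integrable M (\<lambda>w. V 0 w * V 1 w * (V 2 w * V 3 w))"
    and "expectation (\<lambda>w. V 0 w * V 1 w * (V 2 w * V 3 w)) =
      q 0 1 * q 2 3 + q 0 2 * q 1 3 + q 0 3 * q 1 2 - 2 * (m 0 * m 1 * m 2 * m 3)"
proof -
  define G where "G a b c w = V 0 w + a * V 1 w + b * V 2 w + c * V 3 w" for a b c :: real and w
  have G: "normal_rv M (G a b c)" for a b c
  proof -
    have "G a b c = (\<lambda>w. \<Sum>i<4. (case i of 0 \<Rightarrow> 1 | Suc 0 \<Rightarrow> a | Suc (Suc 0) \<Rightarrow> b | _ \<Rightarrow> c) * V i w)"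
      by (simp add: G_def fun_eq_iff eval_nat_numeral)
    then show ?thesis using lin by metis
  qed
  have single: "normal_rv M (V i)" if "i < 4" for i
  proof -
    have "V i = (\<lambda>w. \<Sum>j<4. (if j = i then 1 else 0) * V j w)"
      using that by (simp add: fun_eq_iff if_distrib[of "\<lambda>x. x * _"] cong: if_cong)
    then show ?thesis using lin[of "\<lambda>j. if j = i then 1 else 0"] by simp
  qed
  have iV[simp]: "integrable M (V i)" if "i < 4" for i
    using normal_rv_moments(1)[OF single[OF that]] .
  have iq[simp]: "integrable M (\<lambda>w. V i w * V j w)" if "i < 4" "j < 4" for i j
    using normal_rv_mult_integrable single that by blast
  have EG: "expectation (G a b c) = m 0 + a * m 1 + b * m 2 + c * m 3" for a b c
    unfolding G_def m_def by simp
  have EG2: "expectation (\<lambda>w. (G a b c w)\<^sup>2) =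
      q 0 0 + a\<^sup>2 * q 1 1 + b\<^sup>2 * q 2 2 + c\<^sup>2 * q 3 3 + 2 * a * q 0 1 + 2 * b * q 0 2 + 2 * c * q 0 3
      + 2 * a * b * q 1 2 + 2 * a * c * q 1 3 + 2 * b * c * q 2 3" for a b c
  proof -
    have "(G a b c w)\<^sup>2 = V 0 w * V 0 w + a\<^sup>2 * (V 1 w * V 1 w) + b\<^sup>2 * (V 2 w * V 2 w)
       + c\<^sup>2 * (V 3 w * V 3 w) + (2 * a) * (V 0 w * V 1 w) + (2 * b) * (V 0 w * V 2 w)
       + (2 * c) * (V 0 w * V 3 w) + (2 * a * b) * (V 1 w * V 2 w) + (2 * a * c) * (V 1 w * V 3 w)
       + (2 * b * c) * (V 2 w * V 3 w)" for w
      unfolding G_def by (simp add: power2_eq_square algebra_simps)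
    then show ?thesis unfolding q_def by simp
  qed
  \<comment> \<open>Eight of the sixteen sign patterns suffice, since a fourth power ignores a
    global sign; the factor 192 is 8 * 4!.\<close>
  let ?P = "\<lambda>w. G 1 1 1 w ^ 4 - G (-1) 1 1 w ^ 4 - G 1 (-1) 1 w ^ 4 - G 1 1 (-1) w ^ 4
     + G (-1) (-1) 1 w ^ 4 + G (-1) 1 (-1) w ^ 4 + G 1 (-1) (-1) w ^ 4 - G (-1) (-1) (-1) w ^ 4"
  have pol: "V 0 w * V 1 w * (V 2 w * V 3 w) = ?P w / 192" for w
    unfolding G_def by (simp add: power4_eq_xxxx algebra_simps)
  note i4[simp] = normal_rv_moments(3)[OF G]
  show "integrable M (\<lambda>w. V 0 w * V 1 w * (V 2 w * V 3 w))"
    unfolding pol by simp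
  have "expectation (\<lambda>w. V 0 w * V 1 w * (V 2 w * V 3 w)) = expectation ?P / 192"
    unfolding pol by simp
  also have "expectation ?P = 
     expectation (\<lambda>w. G 1 1 1 w ^ 4) - expectation (\<lambda>w. G (-1) 1 1 w ^ 4)
      - expectation (\<lambda>w. G 1 (-1) 1 w ^ 4) - expectation (\<lambda>w. G 1 1 (-1) w ^ 4)
     + expectation (\<lambda>w. G (-1) (-1) 1 w ^ 4) + expectation (\<lambda>w. G (-1) 1 (-1) w ^ 4)
      + expectation (\<lambda>w. G 1 (-1) (-1) w ^ 4) - expectation (\<lambda>w. G (-1) (-1) (-1) w ^ 4)"
    by simp
  also have "\<dots> / 192 = q 0 1 * q 2 3 + q 0 2 * q 1 3 + q 0 3 * q 1 2 - 2 * (m 0 * m 1 * m 2 * m 3)"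
  proof -
    \<comment> \<open>The same signed sum is taken of the two parts of the fourth moment:
      \<open>P4\<close> treats the fourth powers of means, \<open>P2\<close> the squares of second
      moments. The constants match because 3 * 16 * 2 * 2 = 192.\<close>
    have P4: "(a + b + c + d) ^ 4 - (a - b + c + d) ^ 4 - (a + b - c + d) ^ 4 - (a + b + c - d) ^ 4
       + (a - b - c + d) ^ 4 + (a - b + c - d) ^ 4 + (a + b - c - d) ^ 4 - (a - b - c - d) ^ 4
       = 192 * (a * b * c * d)" for a b c d :: real
      by algebra
    have P2: "(s + a + b + c + d + e + f)\<^sup>2 - (s - a + b + c - d - e + f)\<^sup>2
       - (s + a - b + c - d + e - f)\<^sup>2 - (s + a + b - c + d - e - f)\<^sup>2
       + (s - a - b + c + d - e - f)\<^sup>2 + (s - a + b - c - d + e - f)\<^sup>2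
       + (s + a - b - c - d - e + f)\<^sup>2 - (s - a - b - c + d + e + f)\<^sup>2
       = 16 * (a * f + b * e + c * d)" for s a b c d e f :: real
      by algebra
    show ?thesis
      unfolding normal_rv_moments(4)[OF G] EG EG2
      using P4[of "m 0" "m 1" "m 2" "m 3"]
        P2[of "q 0 0 + q 1 1 + q 2 2 + q 3 3" "2 * q 0 1" "2 * q 0 2" "2 * q 0 3"
             "2 * q 1 2" "2 * q 1 3" "2 * q 2 3"]
      by simp
  qed
  finally show "expectation (\<lambda>w. V 0 w * V 1 w * (V 2 w * V 3 w)) =
      q 0 1 * q 2 3 + q 0 2 * q 1 3 + q 0 3 * q 1 2 - 2 * (m 0 * m 1 * m 2 * m 3)" .
qed

end

subsection \<open>Covariances of increments under condition A\<close>

text \<open>The series differentiated term by term converges on the same disc and sums to the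
  derivative at every point of it, so \<open>deriv g\<close> is again locally a power
  series.\<close>

lemma real_analytic_on_deriv:
  assumes "real_analytic_on g U"
  obtains g' where "real_analytic_on g' U" "\<And>x. x \<in> U \<Longrightarrow> (g has_real_derivative g' x) (at x)"
proof
  have *: "\<exists>a r. r > 0 \<and> (\<forall>y. \<bar>y - x\<bar> < r \<longrightarrow> (\<lambda>n. diffs a n * (y - x) ^ n) sums deriv g y \<and>
      (g has_real_derivative deriv g y) (at y))" if "x \<in> U" for x
  proof -
    from assms that obtain a r where r: "r > 0"
      and a: "\<And>y. \<bar>y - x\<bar> < r \<Longrightarrow> (\<lambda>n. a n * (y - x) ^ n) sums g y"
      unfolding real_analytic_on_def by blast
    have sm: "summable (\<lambda>n. a n * z ^ n)" if "norm z < r" for z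
      using a[of "x + z"] that by (auto dest: sums_summable)
    have "(\<lambda>n. diffs a n * (y - x) ^ n) sums deriv g y \<and> (g has_real_derivative deriv g y) (at y)"
      if y: "\<bar>y - x\<bar> < r" for y
    proof -
      have "((\<lambda>z. \<Sum>n. a n * z ^ n) has_real_derivative (\<Sum>n. diffs a n * (y - x) ^ n)) (at (y - x))"
        by (rule termdiffs_strong'[where K = r]) (use sm y in auto)
      then have "((\<lambda>y. \<Sum>n. a n * (y - x) ^ n) has_real_derivative (\<Sum>n. diffs a n * (y - x) ^ n)) (at y)"
        using DERIV_shift[of "\<lambda>z. \<Sum>n. a n * z ^ n" _ y "- x"] by simp
      moreover have "open {z. \<bar>z - x\<bar> < r}"
        using open_ball[of x r] by (simp add: ball_def dist_real_def abs_minus_commute)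
      ultimately have d: "(g has_real_derivative (\<Sum>n. diffs a n * (y - x) ^ n)) (at y)"
        by (rule has_field_derivative_transform_within_open) (use y a in \<open>auto simp: sums_iff\<close>)
      moreover have "summable (\<lambda>n. diffs a n * (y - x) ^ n)"
        by (rule termdiff_converges[where K = r]) (use sm y in auto)
      ultimately show ?thesis
        by (simp add: DERIV_imp_deriv summable_sums)
    qed
    with r show ?thesis by blast
  qed
  then show "real_analytic_on (deriv g) U" unfolding real_analytic_on_def by meson
  show "(g has_real_derivative deriv g x) (at x)" if "x \<in> U" for x
    using *[OF that] by force
qed

lemma extends_analytically_derivs:
  assumes "extends_analytically f {a..b}"
  obtains g g' g'' and C :: real where "C > 0" "\<And>x. x \<in> {a..b} \<Longrightarrow> g x = f x"
    "\<And>x. x \<in> {a..b} \<Longrightarrow> (g has_real_derivative g' x) (at x)"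
    "\<And>x. x \<in> {a..b} \<Longrightarrow> (g' has_real_derivative g'' x) (at x)"
    "\<And>x. x \<in> {a..b} \<Longrightarrow> \<bar>f x\<bar> \<le> C \<and> \<bar>g' x\<bar> \<le> C \<and> \<bar>g'' x\<bar> \<le> C"
proof -
  from assms obtain U g where U: "{a..b} \<subseteq> U" "real_analytic_on g U" "\<And>x. x \<in> {a..b} \<Longrightarrow> g x = f x"
    unfolding extends_analytically_def by blast
  obtain g' where g': "real_analytic_on g' U" "\<And>x. x \<in> U \<Longrightarrow> (g has_real_derivative g' x) (at x)"
    using real_analytic_on_deriv[OF U(2)] by blast
  obtain g'' where g'': "real_analytic_on g'' U" "\<And>x. x \<in> U \<Longrightarrow> (g' has_real_derivative g'' x) (at x)"
    using real_analytic_on_deriv[OF g'(1)] by blast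
  \<comment> \<open>One derivative more makes \<open>g''\<close> continuous, hence bounded on the
    compact interval.\<close>
  obtain g3 where g3: "\<And>x. x \<in> U \<Longrightarrow> (g'' has_real_derivative g3 x) (at x)"
    using real_analytic_on_deriv[OF g''(1)] by blast
  have bd: "\<exists>C. \<forall>x\<in>{a..b}. \<bar>u x\<bar> \<le> C" if "\<And>x. x \<in> U \<Longrightarrow> (u has_real_derivative v x) (at x)" for u v :: "real \<Rightarrow> real"
  proof -
    have "continuous_on {a..b} u"
      by (rule DERIV_continuous_on[where D = v]) (use that U(1) in \<open>blast intro: has_field_derivative_at_within\<close>)
    then have "bounded (u ` {a..b})" by (intro compact_imp_bounded compact_continuous_image) auto
    then show ?thesis by (auto simp: bounded_iff)
  qed
  obtain C0 C1 C2 where "\<forall>x\<in>{a..b}. \<bar>g x\<bar> \<le> C0" "\<forall>x\<in>{a..b}. \<bar>g' x\<bar> \<le> C1" "\<forall>x\<in>{a..b}. \<bar>g'' x\<bar> \<le> C2"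
    using bd[OF g'(2)] bd[OF g''(2)] bd[OF g3] by metis
  then have "x \<in> {a..b} \<Longrightarrow> \<bar>f x\<bar> \<le> max 1 (max C0 (max C1 C2)) \<and> \<bar>g' x\<bar> \<le> max 1 (max C0 (max C1 C2))
     \<and> \<bar>g'' x\<bar> \<le> max 1 (max C0 (max C1 C2))" for x
    using U(3)[of x, symmetric] by (auto simp: le_max_iff_disj)
  moreover have "max 1 (max C0 (max C1 C2)) > 0" by simp
  ultimately show thesis
    using that[of "max 1 (max C0 (max C1 C2))" g g' g''] U g' g'' by blast
qed

text \<open>A second difference is a difference of two first differences; the mean value theorem
  turns each into h times a value of \<open>f'\<close>, and the two intermediate points are at most
  2 h apart.\<close>

lemma second_difference_le:
  fixes f :: "real \<Rightarrow> real"
  assumes h: "h > 0" and S: "S = {t - h..t + h}"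
    and f': "\<And>x. x \<in> S \<Longrightarrow> (f has_real_derivative f' x) (at x within S)"
    and f'': "\<And>x. x \<in> S \<Longrightarrow> (f' has_real_derivative f'' x) (at x within S)"
    and C: "\<And>x. x \<in> S \<Longrightarrow> \<bar>f'' x\<bar> \<le> C"
  shows "\<bar>2 * f t - f (t + h) - f (t - h)\<bar> \<le> 2 * C * h\<^sup>2"
proof -
  have mvt: "\<exists>x\<in>{a<..<b}. f b - f a = (b - a) * f' x" if "a < b" "{a..b} \<subseteq> S" for a b
  proof -
    have "(f has_derivative (\<lambda>u. f' x * u)) (at x within {a..b})" if "x \<in> {a..b}" for x
      using DERIV_subset[OF f' \<open>{a..b} \<subseteq> S\<close>, of x] that \<open>{a..b} \<subseteq> S\<close>
      unfolding has_field_derivative_def by auto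
    from mvt_simple[OF \<open>a < b\<close>, of f "\<lambda>x u. f' x * u", OF this]
    show ?thesis by (auto simp: mult.commute)
  qed
  obtain x where x: "x \<in> {t<..<t + h}" "f (t + h) - f t = h * f' x"
    using mvt[of t "t + h"] h S by auto
  obtain y where y: "y \<in> {t - h<..<t}" "f t - f (t - h) = h * f' y"
    using mvt[of "t - h" t] h S by auto
  have "norm (f' x - f' y) \<le> C * norm (x - y)"
    by (rule field_differentiable_bound[of S _ f'']) (use f'' C x y S h in auto)
  also have "\<dots> \<le> C * (2 * h)"
  proof (rule mult_left_mono)
    show "norm (x - y) \<le> 2 * h" using x y by auto
    show "C \<ge> 0" using C[of t] h S by fastforce
  qed
  finally have "h * \<bar>f' x - f' y\<bar> \<le> h * (C * (2 * h))" using h by simp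
  moreover have "2 * f t - f (t + h) - f (t - h) = - (h * (f' x - f' y))"
    using x y by (simp add: algebra_simps)
  ultimately show ?thesis using h by (simp add: abs_mult power2_eq_square)
qed

lemma first_difference_le:
  fixes f :: "real \<Rightarrow> real"
  assumes "a \<le> b" "\<And>x. x \<in> {a..b} \<Longrightarrow> (f has_real_derivative f' x) (at x within {a..b})"
    and "\<And>x. x \<in> {a..b} \<Longrightarrow> \<bar>f' x\<bar> \<le> C"
  shows "\<bar>f b - f a\<bar> \<le> C * (b - a)"
  using field_differentiable_bound[of "{a..b}" f f' C b a] assms by auto

text \<open>For a function satisfying the condition, \<open>B 0 = 0\<close>: the asymptotics of order \<open>k = 0\<close> force
  \<open>B t \<rightarrow> 0\<close>.\<close>

lemma condition_A_cases:
  assumes L: "L > 0" and K: "condition_A L c \<alpha> K"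
  obtains A B D C where
    "\<alpha> > 0" "C > 0" "\<And>t. t \<in> {-L..L} \<Longrightarrow> K t = A t + B t" "\<And>t. t \<in> {-L..L} \<Longrightarrow> K (- t) = K t"
    "even_on L A" "extends_analytically A {-L..L}" "B 0 = 0" "\<And>t. t \<in> {0<..L} \<Longrightarrow> D (0::nat) t = B t"
    "\<And>k t. t \<in> {0<..L} \<Longrightarrow> (D k has_real_derivative D (Suc k) t) (at t within {0<..L})"
    "\<And>k t. k \<le> 2 \<Longrightarrow> t \<in> {0<..L} \<Longrightarrow> \<bar>D k t\<bar> \<le> C * t powr (\<alpha> - real k)"
    "((\<lambda>t. B t / t powr \<alpha>) \<longlongrightarrow> c) (at_right 0)"
proof -
  from K obtain A B D where \<alpha>: "\<alpha> > 0" and AB: "\<And>t. t \<in> {-L..L} \<Longrightarrow> K t = A t + B t"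
    and A: "even_on L A" "extends_analytically A {-L..L}"
    and B: "even_on L B" "continuous_on {-L..L} B"
    and D0: "\<And>t. t \<in> {0<..L} \<Longrightarrow> D 0 t = B t"
    and D': "\<And>k t. t \<in> {0<..L} \<Longrightarrow> (D k has_real_derivative D (Suc k) t) (at t within {0<..L})"
    and o: "\<And>k. (\<lambda>t. D k t - gamma_falling \<alpha> k * c * t powr (\<alpha> - real k))
                \<in> o[at_right 0](\<lambda>t. t powr (\<alpha> - real k))"
    unfolding condition_A_def by blast
  \<comment> \<open>Near 0 the asymptotic relation bounds \<open>D k\<close> by a multiple of the
    power; on the remaining compact interval the quotient is continuous and therefore
    bounded.\<close>
  have bd: "\<exists>C. \<forall>t\<in>{0<..L}. \<bar>D k t\<bar> \<le> C * t powr (\<alpha> - real k)" for k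
  proof -
    define p where "p t = t powr (\<alpha> - real k)" for t
    have "\<forall>\<^sub>F t in at_right 0. \<bar>D k t - gamma_falling \<alpha> k * c * p t\<bar> \<le> 1 * \<bar>p t\<bar>"
      using landau_o.smallD[OF o[of k], of 1] by (simp add: p_def)
    then obtain \<delta> where \<delta>: "\<delta> > 0"
      and d: "\<And>t. 0 < t \<Longrightarrow> t < \<delta> \<Longrightarrow> \<bar>D k t - gamma_falling \<alpha> k * c * p t\<bar> \<le> \<bar>p t\<bar>"
      unfolding eventually_at_right_field by auto
    have "continuous_on {0<..L} (D k)"
      using D' by (intro DERIV_continuous_on) auto
    then have "continuous_on {\<delta>..L} (\<lambda>t. D k t / p t)" unfolding p_def
      by (intro continuous_intros) (use \<delta> in \<open>auto intro: continuous_on_subset\<close>)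
    then have "bounded ((\<lambda>t. D k t / p t) ` {\<delta>..L})"
      by (intro compact_imp_bounded compact_continuous_image) auto
    then obtain M where M: "\<And>t. t \<in> {\<delta>..L} \<Longrightarrow> \<bar>D k t / p t\<bar> \<le> M" unfolding bounded_iff real_norm_def by blast
    have "\<bar>D k t\<bar> \<le> max M (\<bar>gamma_falling \<alpha> k * c\<bar> + 1) * p t" if t: "t \<in> {0<..L}" for t
    proof (cases "t < \<delta>")
      case True
      have "\<bar>D k t\<bar> \<le> \<bar>gamma_falling \<alpha> k * c * p t\<bar> + \<bar>p t\<bar>" using d[of t] True t by auto
      also have "\<dots> = (\<bar>gamma_falling \<alpha> k * c\<bar> + 1) * p t"
        by (simp add: abs_mult p_def algebra_simps)
      also have "\<dots> \<le> max M (\<bar>gamma_falling \<alpha> k * c\<bar> + 1) * p t"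
        by (intro mult_right_mono) (auto simp: p_def)
      finally show ?thesis .
    next
      case False
      have p: "p t > 0" using t by (simp add: p_def)
      then have "\<bar>D k t\<bar> \<le> M * p t" using M[of t] False t by (simp add: abs_divide field_simps)
      also have "\<dots> \<le> max M (\<bar>gamma_falling \<alpha> k * c\<bar> + 1) * p t"
        by (intro mult_right_mono) (use p in auto)
      finally show ?thesis .
    qed
    then show ?thesis unfolding p_def by blast
  qed
  obtain C where C: "\<And>k t. t \<in> {0<..L} \<Longrightarrow> \<bar>D k t\<bar> \<le> C k * t powr (\<alpha> - real k)"
    using bd by metis
  define C' where "C' = max 1 (max (C 0) (max (C 1) (C 2)))"
  have C': "\<bar>D k t\<bar> \<le> C' * t powr (\<alpha> - real k)" if "k \<le> 2" "t \<in> {0<..L}" for k t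
  proof -
    have "k = 0 \<or> k = 1 \<or> k = 2" using that by auto
    then have "C k \<le> C'" unfolding C'_def by (auto simp: le_max_iff_disj)
    then have "C k * t powr (\<alpha> - real k) \<le> C' * t powr (\<alpha> - real k)" by (intro mult_right_mono) auto
    then show ?thesis using C[OF that(2), of k] by linarith
  qed
  have "C' > 0" unfolding C'_def by auto
  have evL: "\<forall>\<^sub>F t in at_right 0. t \<in> {0<..L}"
    using L eventually_at_right_real by (auto simp: eventually_at_right_field intro!: exI[of _ L])
  have "Gamma (\<alpha> + 1) > 0" using \<alpha> by (intro Gamma_real_pos) auto
  then have gf: "gamma_falling \<alpha> 0 = 1"
    by (simp add: gamma_falling_def)
  have "((\<lambda>t. (D 0 t - gamma_falling \<alpha> 0 * c * t powr (\<alpha> - real 0)) / t powr (\<alpha> - real 0)) \<longlongrightarrow> 0) (at_right 0)"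
    by (rule smalloD_tendsto[OF o])
  then have "((\<lambda>t. (D 0 t - c * t powr \<alpha>) / t powr \<alpha> + c) \<longlongrightarrow> 0 + c) (at_right 0)"
    by (intro tendsto_add tendsto_const) (simp add: gf)
  then have lim: "((\<lambda>t. B t / t powr \<alpha>) \<longlongrightarrow> c) (at_right 0)"
    by (rule Lim_transform_eventually[THEN tendsto_eq_rhs])
      (use evL in \<open>auto elim!: eventually_mono simp: D0 field_simps\<close>)
  have "((\<lambda>t. B t / t powr \<alpha> * t powr \<alpha>) \<longlongrightarrow> c * 0) (at_right 0)"
  proof (intro tendsto_mult lim)
    show "((\<lambda>t. t powr \<alpha>) \<longlongrightarrow> 0) (at_right 0)"
      using \<alpha> by (intro tendsto_zero_powrI[OF tendsto_ident_at tendsto_const])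
        (auto simp: eventually_at_right_field intro: exI[of _ 1])
  qed
  moreover have "\<forall>\<^sub>F t in at_right 0. B t / t powr \<alpha> * t powr \<alpha> = B t"
    using evL by eventually_elim simp
  ultimately have B0: "(B \<longlongrightarrow> 0) (at_right 0)"
    by (rule Lim_transform_eventually[THEN tendsto_eq_rhs]) simp
  have "(B \<longlongrightarrow> B 0) (at 0 within {-L..L})" using B(2) L by (auto simp: continuous_on)
  then have "(B \<longlongrightarrow> B 0) (at 0 within {0..L})" by (rule tendsto_within_subset) auto
  then have "(B \<longlongrightarrow> B 0) (at_right 0)" using L by (simp add: at_within_Icc_at_right)
  from tendsto_unique[OF _ this B0] have "B 0 = 0" by simp
  moreover have "K (- t) = K t" if "t \<in> {-L..L}" for t
    using AB[of t] AB[of "-t"] A(1) B(1) that unfolding even_on_def by auto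
  ultimately show thesis
    using that[of C' A B D] \<alpha> \<open>C' > 0\<close> AB A D0 D' C' lim by blast
qed

text \<open>The factor t^(\<alpha> - \<gamma>) is bounded on (0, L], so a smaller exponent costs
  only a constant. The summand \<open>d\<close> makes the same fact available for derivatives of
  order k, with d = -k.\<close>

lemma powr_le_powr_lower_exponent:
  assumes "0 < t" "t \<le> L" "\<gamma> \<le> \<alpha>"
  shows "t powr (\<alpha> + d) \<le> L powr (\<alpha> - \<gamma>) * t powr (\<gamma> + d :: real)"
proof -
  have "t powr (\<alpha> + d) = t powr (\<alpha> - \<gamma>) * t powr (\<gamma> + d)"
    by (simp add: powr_add[symmetric])
  also have "\<dots> \<le> L powr (\<alpha> - \<gamma>) * t powr (\<gamma> + d)"
    using assms by (intro mult_right_mono powr_mono2) auto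
  finally show ?thesis .
qed

text \<open>In the covariance of two scaled increments, values of \<open>K\<close> meet two scale
  increments, first differences meet one and second differences none. A scale increment is of order
  h, so the three bounds are made for a common total h^2 ((i + 1) h)^(\<gamma> - 2). Measuring the
  lag by i + 1 keeps the base positive at lag 0.\<close>

lemma condition_A_lag_bounds:
  assumes L: "L > 0" and K: "condition_A L c \<alpha> K" and \<gamma>: "\<gamma> \<le> \<alpha>" "\<gamma> \<le> 2"
  obtains C where "C > 0"
    "\<And>h i. h > 0 \<Longrightarrow> (real i + 1) * h \<le> L \<Longrightarrow>
      \<bar>K (real i * h)\<bar> \<le> C * ((real i + 1) * h) powr (\<gamma> - 2) \<and>
      \<bar>K ((real i + 1) * h) - K (real i * h)\<bar> \<le> C * (h * ((real i + 1) * h) powr (\<gamma> - 2)) \<and>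
      \<bar>2 * K (real i * h) - K ((real i + 1) * h) - K ((real i - 1) * h)\<bar>
         \<le> C * (h\<^sup>2 * ((real i + 1) * h) powr (\<gamma> - 2))"
proof -
  obtain A B D C where \<alpha>: "\<alpha> > 0" and C: "C > 0"
    and AB: "\<And>t. t \<in> {-L..L} \<Longrightarrow> K t = A t + B t" and ev: "\<And>t. t \<in> {-L..L} \<Longrightarrow> K (- t) = K t"
    and A: "even_on L A" "extends_analytically A {-L..L}" and B0: "B 0 = 0"
    and D0: "\<And>t. t \<in> {0<..L} \<Longrightarrow> D (0::nat) t = B t"
    and D': "\<And>k t. t \<in> {0<..L} \<Longrightarrow> (D k has_real_derivative D (Suc k) t) (at t within {0<..L})"
    and D: "\<And>k t. k \<le> 2 \<Longrightarrow> t \<in> {0<..L} \<Longrightarrow> \<bar>D k t\<bar> \<le> C * t powr (\<alpha> - real k)"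
    by (rule condition_A_cases[OF L K]; rule that; assumption)
  obtain g g' g'' C' where C': "C' > 0" and g: "\<And>x. x \<in> {-L..L} \<Longrightarrow> g x = A x"
    "\<And>x. x \<in> {-L..L} \<Longrightarrow> (g has_real_derivative g' x) (at x)"
    "\<And>x. x \<in> {-L..L} \<Longrightarrow> (g' has_real_derivative g'' x) (at x)"
    "\<And>x. x \<in> {-L..L} \<Longrightarrow> \<bar>A x\<bar> \<le> C' \<and> \<bar>g' x\<bar> \<le> C' \<and> \<bar>g'' x\<bar> \<le> C'"
    by (rule extends_analytically_derivs[OF A(2)]; rule that; assumption)
  define E where "E = C * L powr (\<alpha> - \<gamma>)"
  \<comment> \<open>One constant for all later estimates of \<open>B\<close>: 3^(2 - \<gamma>) pays
    for moving the weight from a point of [T / 3, T] to T, and the square of \<open>max 1 L\<close>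
    for up to two spare factors bounded by \<open>L\<close>.\<close>
  define F where "F = E * 3 powr (2 - \<gamma>) * max 1 L ^ 2"
  define R where "R = L powr (2 - \<gamma>)"
  have E: "E > 0" and R: "R > 0" using C L by (auto simp: E_def R_def)
  have F: "F > 0" "E \<le> F" "E * 3 powr (2 - \<gamma>) \<le> F" "E * L \<le> F" "E * L^2 \<le> F" 
    "E * 3 powr (2 - \<gamma>) * L \<le> F"
  proof -
    have m: "1 \<le> max 1 L ^ 2" "L \<le> max 1 L ^ 2" "L ^ 2 \<le> max 1 L ^ 2"
      using L mult_mono[of 1 L 1 L] mult_mono[of L 1 L 1] by (auto simp: max_def power2_eq_square)
    have t: "1 \<le> (3::real) powr (2 - \<gamma>)" using \<gamma> by (intro ge_one_powr_ge_zero) auto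
    show "F > 0" unfolding F_def using E m by (intro mult_pos_pos) auto
    have "E * 3 powr (2 - \<gamma>) * x \<le> F" if "x \<le> max 1 L ^ 2" for x
      unfolding F_def using E that by (intro mult_left_mono) auto
    from this[of 1] this[of L] show "E * 3 powr (2 - \<gamma>) \<le> F" "E * 3 powr (2 - \<gamma>) * L \<le> F"
      using m by auto
    have "E * x \<le> F" if "x \<le> max 1 L ^ 2" "0 \<le> x" for x
      using mult_mono[of "E * 1" "E * 3 powr (2 - \<gamma>)" x "max 1 L ^ 2"] E t that
      by (simp add: F_def)
    from this[of 1] this[of L] this[of "L^2"] show "E \<le> F" "E * L \<le> F" "E * L^2 \<le> F" using m L by auto
  qed
  \<comment> \<open>Since \<gamma> \<le> 2, the weight is bounded below on (0, L]; bounds for the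
    analytic part carry no weight and are absorbed in this way.\<close>
  have w: "1 \<le> R * t powr (\<gamma> - 2)" if "0 < t" "t \<le> L" for t
  proof -
    have "t powr (2 - \<gamma>) \<le> R" unfolding R_def using that \<gamma> by (intro powr_mono2) auto
    moreover have "t powr (2 - \<gamma>) * t powr (\<gamma> - 2) = 1" using that by (simp add: powr_add[symmetric])
    ultimately show ?thesis using that by (metis mult_right_mono powr_ge_zero)
  qed
  have DE: "\<bar>D k t\<bar> \<le> E * t powr (\<gamma> - real k)" if "k \<le> 2" "0 < t" "t \<le> L" for k t
  proof -
    have "C * t powr (\<alpha> - real k) \<le> C * (L powr (\<alpha> - \<gamma>) * t powr (\<gamma> - real k))"
      using powr_le_powr_lower_exponent[OF that(2,3) \<gamma>(1), of "- real k"] C by simp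
    then show ?thesis using D[of k t] that unfolding E_def by (simp add: mult.assoc)
  qed
  have main: "\<bar>K (real i * h)\<bar> \<le> (4 * C' * R + 6 * F) * ((real i + 1) * h) powr (\<gamma> - 2) \<and>
      \<bar>K ((real i + 1) * h) - K (real i * h)\<bar> \<le> (4 * C' * R + 6 * F) * (h * ((real i + 1) * h) powr (\<gamma> - 2)) \<and>
      \<bar>2 * K (real i * h) - K ((real i + 1) * h) - K ((real i - 1) * h)\<bar>
         \<le> (4 * C' * R + 6 * F) * (h\<^sup>2 * ((real i + 1) * h) powr (\<gamma> - 2))"
    if h: "h > 0" and ih: "(real i + 1) * h \<le> L" for h i
  proof -
    define T where "T = (real i + 1) * h"
    define W where "W = T powr (\<gamma> - 2)"
    have T: "0 < T" "T \<le> L" using h ih by (auto simp: T_def)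
    have W: "W > 0" using T by (simp add: W_def)
    have T': "real i * h = T - h" "(real i - 1) * h = T - 2 * h" by (auto simp: T_def algebra_simps)
    have hT: "h \<le> T" using h by (simp add: T_def)
    have inL: "T \<in> {-L..L}" "T - h \<in> {-L..L}" "T - 2 * h \<in> {-L..L}"
      using T hT h by auto
    have Ab: "\<bar>A (T - h)\<bar> \<le> C'" "\<bar>A T - A (T - h)\<bar> \<le> C' * h"
      "\<bar>2 * A (T - h) - A T - A (T - 2 * h)\<bar> \<le> 2 * C' * h\<^sup>2"
    proof -
      show "\<bar>A (T - h)\<bar> \<le> C'" using g(4)[OF inL(2)] by blast
      have gd: "(g has_real_derivative g' x) (at x within S)" "(g' has_real_derivative g'' x) (at x within S)"
        if "x \<in> {-L..L}" for x S using g that by (auto intro: has_field_derivative_at_within)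
      have "\<bar>g T - g (T - h)\<bar> \<le> C' * (T - (T - h))"
        by (rule first_difference_le[where f' = g']) (use gd g inL h in auto)
      then show "\<bar>A T - A (T - h)\<bar> \<le> C' * h" using g inL by simp
      have "\<bar>2 * g (T - h) - g (T - h + h) - g (T - h - h)\<bar> \<le> 2 * C' * h\<^sup>2"
        by (rule second_difference_le[OF h refl, where f' = g' and f'' = g''])
          (use gd g inL h in auto)
      then show "\<bar>2 * A (T - h) - A T - A (T - 2 * h)\<bar> \<le> 2 * C' * h\<^sup>2"
        using g inL by (simp add: algebra_simps)
    qed
    have AR: "C' * x \<le> C' * R * (x * W)" if "x \<ge> 0" for x
    proof -
      have "C' * x * 1 \<le> C' * x * (R * W)"
        using w[OF T] C' that by (intro mult_left_mono) (auto simp: W_def)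
      then show ?thesis by (simp add: mult_ac)
    qed
    have B_abs: "\<bar>B t\<bar> \<le> E * t powr \<gamma>" if "0 < t" "t \<le> L" for t
      using DE[of 0 t] D0[of t] that by simp
    have pw: "t powr \<gamma> = t\<^sup>2 * t powr (\<gamma> - 2)" if "t > 0" for t
      using that by (simp add: powr_diff power2_eq_square powr_numeral)
    have mono3: "E * t powr (\<gamma> - 2) \<le> E * 3 powr (2 - \<gamma>) * W" if "T \<le> 3 * t" "t > 0" for t
    proof -
      have "t powr (\<gamma> - 2) \<le> (T / 3) powr (\<gamma> - 2)" using that T \<gamma> by (intro powr_mono2') auto
      also have "\<dots> = 3 powr (2 - \<gamma>) * W"
        using T by (simp add: W_def powr_divide powr_minus_divide powr_diff)
      finally show ?thesis using E by simp
    qed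
    \<comment> \<open>At lag 0 one end is 0, where derivatives may blow up, so the size of B h
      itself is used. From lag 1 on the mean value theorem applies on [T - h, T], which keeps
      distance at least T / 2 from 0.\<close>
    have Bb: "\<bar>B (T - h)\<bar> \<le> F * W \<and> \<bar>B T - B (T - h)\<bar> \<le> F * (h * W)" 
    proof (cases "i = 0")
      case True
      then have Th: "T = h" by (simp add: T_def)
      have "\<bar>B h\<bar> \<le> E * (h * (h * W))"
        using B_abs[of h] pw[of h] T by (simp add: Th W_def power2_eq_square mult_ac)
      also have "\<dots> = (E * h) * (h * W)" by simp
      also have "\<dots> \<le> (E * L) * (h * W)" using T Th E W h by (intro mult_right_mono mult_left_mono) auto
      also have "\<dots> \<le> F * (h * W)" using F W h by (intro mult_right_mono) auto
      finally show ?thesis using B0 F W by (simp add: Th)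
    next
      case False
      then have t: "0 < T - h" "T \<le> 2 * (T - h)" using h by (auto simp: T_def algebra_simps)
      have "\<bar>B (T - h)\<bar> \<le> (T - h)\<^sup>2 * (E * (T - h) powr (\<gamma> - 2))"
        using B_abs[of "T - h"] pw[OF t(1)] t T h by (simp add: mult_ac)
      also have "\<dots> \<le> L\<^sup>2 * (E * 3 powr (2 - \<gamma>) * W)"
        by (intro mult_mono mono3 power_mono) (use t T h E in auto)
      also have "\<dots> = E * 3 powr (2 - \<gamma>) * L ^ 2 * W" by simp
      also have "\<dots> \<le> F * W"
        unfolding F_def using W E L by (intro mult_right_mono mult_left_mono power_mono) auto
      finally have 1: "\<bar>B (T - h)\<bar> \<le> F * W" .
      have sub: "{T - h..T} \<subseteq> {0<..L}" using t T by auto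
      have "\<bar>D 0 T - D 0 (T - h)\<bar> \<le> (E * 3 powr (2 - \<gamma>) * L * W) * (T - (T - h))"
      proof (rule first_difference_le[where f' = "D 1"])
        fix x assume x: "x \<in> {T - h..T}"
        show "(D 0 has_real_derivative D 1 x) (at x within {T - h..T})"
          using DERIV_subset[OF D' sub, of x 0] x sub by auto
        have "\<bar>D 1 x\<bar> \<le> E * x powr (\<gamma> - 1)" using DE[of 1 x] x sub by auto
        also have "x powr (\<gamma> - 1) = x * x powr (\<gamma> - 2)"
          using x sub powr_add[of x 1 "\<gamma> - 2"] by auto
        also have "E * (x * x powr (\<gamma> - 2)) = x * (E * x powr (\<gamma> - 2))" by simp
        also have "\<dots> \<le> L * (E * 3 powr (2 - \<gamma>) * W)"
          by (intro mult_mono mono3) (use x sub t E T in auto)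
        finally show "\<bar>D 1 x\<bar> \<le> E * 3 powr (2 - \<gamma>) * L * W" by (simp add: mult_ac)
      qed (use h in auto)
      also have "\<dots> \<le> F * W * h"
        using F W h by (simp add: mult_right_mono)
      finally have "\<bar>B T - B (T - h)\<bar> \<le> F * (h * W)" using D0 t T h by (simp add: mult_ac)
      with 1 show ?thesis by simp
    qed
    have S: "\<bar>2 * K (T - h) - K T - K (T - 2 * h)\<bar> \<le> (4 * C' * R + 6 * F) * (h\<^sup>2 * W)"
    \<comment> \<open>From lag 2 on all three points lie in [T / 3, T], where two derivatives are
      controlled. At lags 0 and 1 one of the points is 0 and the others are at most 2 h away, so the
      size bound on \<open>B\<close> alone has the required order.\<close>
    proof (cases "i \<ge> 2")
      case True
      then have t: "0 < T - 2 * h" "T \<le> 3 * (T - 2 * h)" using h by (auto simp: T_def algebra_simps)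
      have sub: "{T - h - h..T - h + h} \<subseteq> {0<..L}" using t T by auto
      have "\<bar>2 * D 0 (T - h) - D 0 (T - h + h) - D 0 (T - h - h)\<bar> \<le> 2 * (E * 3 powr (2 - \<gamma>) * W) * h\<^sup>2"
      proof (rule second_difference_le[OF h refl, where f' = "D 1" and f'' = "D 2"])
        fix x assume x: "x \<in> {T - h - h..T - h + h}"
        show "(D 0 has_real_derivative D 1 x) (at x within {T - h - h..T - h + h})"
          using DERIV_subset[OF D' sub, of x 0] x sub by auto
        show "(D 1 has_real_derivative D 2 x) (at x within {T - h - h..T - h + h})"
          using DERIV_subset[OF D' sub, of x 1] x sub by (auto simp: numeral_2_eq_2)
        have "\<bar>D 2 x\<bar> \<le> E * x powr (\<gamma> - 2)" using DE[of 2 x] x sub by auto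
        also have "\<dots> \<le> E * 3 powr (2 - \<gamma>) * W" by (intro mono3) (use x sub t in auto)
        finally show "\<bar>D 2 x\<bar> \<le> E * 3 powr (2 - \<gamma>) * W" .
      qed
      also have "\<dots> \<le> 2 * (F * W) * h\<^sup>2" using F W h by (intro mult_right_mono mult_left_mono) auto
      finally have "\<bar>2 * B (T - h) - B T - B (T - 2 * h)\<bar> \<le> 2 * F * (h\<^sup>2 * W)"
        using D0 t T h by (simp add: mult_ac diff_diff_eq)
      moreover have "2 * C' * h\<^sup>2 \<le> 2 * (C' * R * (h\<^sup>2 * W))" using AR[of "h\<^sup>2"] by simp
      moreover have "2 * F * (h\<^sup>2 * W) \<ge> 0" "C' * R * (h\<^sup>2 * W) \<ge> 0" using F W C' R by auto
      ultimately show ?thesis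
        using Ab(3) AB[OF inL(1)] AB[OF inL(2)] AB[OF inL(3)] unfolding distrib_right
        by (simp add: mult.assoc; linarith)
    next
      case False
      then have i: "i = 0 \<and> T = h \<or> i = 1 \<and> T = 2 * h" by (auto simp: T_def)
      have bound: "\<bar>B t\<bar> \<le> F * (t\<^sup>2 * W)" if "t > 0" "t \<le> T" "T \<le> 3 * t" for t
      proof -
        have "\<bar>B t\<bar> \<le> t\<^sup>2 * (E * t powr (\<gamma> - 2))"
          using B_abs[of t] pw[of t] that T by (simp add: mult_ac)
        also have "\<dots> \<le> t\<^sup>2 * (F * W)"
          using mono3[of t] that F W by (intro mult_left_mono order.trans[OF mono3] mult_right_mono) auto
        finally show ?thesis by (simp add: mult_ac)
      qed
      have B1: "\<bar>B h\<bar> \<le> F * (h\<^sup>2 * W)" using i bound[of h] h by auto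
      have "\<bar>2 * B (T - h) - B T - B (T - 2 * h)\<bar> \<le> 6 * F * (h\<^sup>2 * W)"
      proof (cases "i = 0")
        case True
        then have "T = h" using i by auto
        have "h \<in> {-L..L}" using \<open>T = h\<close> inL by simp
        then have "B (- h) = B h" using AB[of h] AB[of "- h"] ev[of h] A(1) unfolding even_on_def by auto
        with B1 show ?thesis using B0 F W using mult_pos_pos[of F "h\<^sup>2 * W"] h by (simp add: \<open>T = h\<close>)
      next
        case False
        then have T2: "T = 2 * h" using i by auto
        have "\<bar>B (2 * h)\<bar> \<le> 4 * (F * (h\<^sup>2 * W))" using bound[of "2 * h"] h T2 by (simp add: power_mult_distrib)
        with B1 show ?thesis using B0 by (simp add: T2)
      qed
      moreover have "2 * C' * h\<^sup>2 \<le> 2 * (C' * R * (h\<^sup>2 * W))" using AR[of "h\<^sup>2"] by simp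
      moreover have "C' * R * (h\<^sup>2 * W) \<ge> 0" using W C' R by auto
      ultimately show ?thesis
        using Ab(3) AB[OF inL(1)] AB[OF inL(2)] AB[OF inL(3)] unfolding distrib_right
        by (simp add: mult.assoc; linarith)
    qed
    have K1: "\<bar>K (T - h)\<bar> \<le> (4 * C' * R + 6 * F) * W"
      using Ab(1) AR[of 1] Bb AB[OF inL(2)] C' R F W mult_pos_pos[of F W] mult_pos_pos[of "C' * R" W]
      unfolding distrib_right by (simp add: mult.assoc; linarith)
    have K2: "\<bar>K T - K (T - h)\<bar> \<le> (4 * C' * R + 6 * F) * (h * W)"
      using Ab(2) AR[of h] Bb AB[OF inL(1)] AB[OF inL(2)] C' R F W h 
        mult_pos_pos[of F "h * W"] mult_pos_pos[of "C' * R" "h * W"]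
      unfolding distrib_right by (simp add: mult.assoc; linarith)
    from S K1 K2 show ?thesis unfolding T' by (simp add: T_def W_def)
  qed
  show thesis
    by (rule that[of "4 * C' * R + 6 * F"]) (use main C' R F in \<open>auto intro!: add_pos_pos\<close>)
qed

text \<open>The even analytic part changes by O(h^2), negligible against h^\<alpha> for \<alpha> <
  2, so the quotient by h^\<alpha> tends to -c. The assumption \<open>nn\<close> makes -c
  nonnegative, and c \<noteq> 0 makes it positive.\<close>

lemma condition_A_variogram_lower:
  assumes L: "L > 0" and K: "condition_A L c \<alpha> K" and \<alpha>2: "\<alpha> < 2" and c: "c \<noteq> 0"
    and nn: "\<And>h. K h \<le> K 0"
  obtains c0 h0 where "c0 > 0" "h0 > 0" "\<And>h. 0 < h \<Longrightarrow> h < h0 \<Longrightarrow> c0 * h powr \<alpha> \<le> K 0 - K h"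
proof -
  obtain A B D C where \<alpha>: "\<alpha> > 0" and C: "C > 0"
    and AB: "\<And>t. t \<in> {-L..L} \<Longrightarrow> K t = A t + B t" and ev: "\<And>t. t \<in> {-L..L} \<Longrightarrow> K (- t) = K t"
    and A: "even_on L A" "extends_analytically A {-L..L}" and B0: "B 0 = 0"
    and D0: "\<And>t. t \<in> {0<..L} \<Longrightarrow> D (0::nat) t = B t"
    and D': "\<And>k t. t \<in> {0<..L} \<Longrightarrow> (D k has_real_derivative D (Suc k) t) (at t within {0<..L})"
    and D: "\<And>k t. k \<le> 2 \<Longrightarrow> t \<in> {0<..L} \<Longrightarrow> \<bar>D k t\<bar> \<le> C * t powr (\<alpha> - real k)"
    and lim: "((\<lambda>t. B t / t powr \<alpha>) \<longlongrightarrow> c) (at_right 0)"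
    by (rule condition_A_cases[OF L K]; rule that; assumption)
  obtain g g' g'' C' where C': "C' > 0" and g: "\<And>x. x \<in> {-L..L} \<Longrightarrow> g x = A x"
    "\<And>x. x \<in> {-L..L} \<Longrightarrow> (g has_real_derivative g' x) (at x)"
    "\<And>x. x \<in> {-L..L} \<Longrightarrow> (g' has_real_derivative g'' x) (at x)"
    "\<And>x. x \<in> {-L..L} \<Longrightarrow> \<bar>A x\<bar> \<le> C' \<and> \<bar>g' x\<bar> \<le> C' \<and> \<bar>g'' x\<bar> \<le> C'"
    by (rule extends_analytically_derivs[OF A(2)]; rule that; assumption)
  have evL: "\<forall>\<^sub>F t in at_right 0. 0 < t \<and> t \<le> L"
    using L by (auto simp: eventually_at_right_field intro!: exI[of _ L])
  have A_le: "\<bar>A 0 - A h\<bar> \<le> C' * h\<^sup>2" if h: "0 < h" "h \<le> L" for h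
  proof -
    have gd: "(g has_real_derivative g' x) (at x within S)" "(g' has_real_derivative g'' x) (at x within S)"
      if "x \<in> {-L..L}" for x S using g that by (auto intro: has_field_derivative_at_within)
    have "\<bar>2 * g 0 - g (0 + h) - g (0 - h)\<bar> \<le> 2 * C' * h\<^sup>2"
      by (rule second_difference_le[OF h(1) refl, where f' = g' and f'' = g''])
        (use gd g h in auto)
    moreover have "A (- h) = A h" using A(1) h unfolding even_on_def by auto
    ultimately show ?thesis using g(1)[of 0] g(1)[of h] g(1)[of "- h"] h by auto
  qed
  have "((\<lambda>h. (A 0 - A h) / h powr \<alpha>) \<longlongrightarrow> 0) (at_right 0)"
  proof (rule Lim_null_comparison)
    show "((\<lambda>h. C' * h powr (2 - \<alpha>)) \<longlongrightarrow> 0) (at_right 0)"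
      using \<alpha>2 by (intro tendsto_mult_right_zero tendsto_zero_powrI[OF tendsto_ident_at tendsto_const])
        (auto simp: eventually_at_right_field intro: exI[of _ 1])
    show "\<forall>\<^sub>F h in at_right 0. norm ((A 0 - A h) / h powr \<alpha>) \<le> C' * h powr (2 - \<alpha>)"
      using evL
    proof eventually_elim
      case (elim h)
      then show ?case using A_le[of h] by (simp add: powr_diff powr_numeral field_simps)
    qed
  qed
  from tendsto_diff[OF this lim]
  have "((\<lambda>h. (K 0 - K h) / h powr \<alpha>) \<longlongrightarrow> 0 - c) (at_right 0)"
    by (rule Lim_transform_eventually)
      (use evL L in \<open>auto elim!: eventually_mono simp: AB B0 diff_divide_distrib add_divide_distrib\<close>)
  then have lim': "((\<lambda>h. (K 0 - K h) / h powr \<alpha>) \<longlongrightarrow> - c) (at_right 0)" by simp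
  have "- c \<ge> 0"
    by (rule tendsto_lowerbound[OF lim']) (use nn in \<open>auto simp: divide_nonneg_nonneg intro!: always_eventually\<close>)
  with c have "- c / 2 < - c" "- c / 2 > 0" by auto
  with order_tendstoD(1)[OF lim'] have "\<forall>\<^sub>F h in at_right 0. - c / 2 < (K 0 - K h) / h powr \<alpha>" by blast
  then obtain h0 where "h0 > 0" and h0: "\<And>h. 0 < h \<Longrightarrow> h < h0 \<Longrightarrow> - c / 2 < (K 0 - K h) / h powr \<alpha>"
    unfolding eventually_at_right_field by auto
  have "(- c / 2) * h powr \<alpha> \<le> K 0 - K h" if "0 < h" "h < h0" for h
    using h0[OF that] that by (simp add: pos_less_divide_eq less_imp_le)
  then show thesis using that \<open>h0 > 0\<close> \<open>- c / 2 > 0\<close> by blast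
qed

text \<open>On each piece the derivative of the analytic extension is bounded. Consecutive pieces
  share their common endpoint, so increments across it add up and the larger constant serves both
  sides.\<close>

lemma piecewise_analytic_lipschitz:
  assumes f: "piecewise_analytic L f"
  obtains C where "C > 0"
    "\<And>x y. x \<in> {0..L} \<Longrightarrow> y \<in> {0..L} \<Longrightarrow> \<bar>f y - f x\<bar> \<le> C * \<bar>y - x\<bar>"
proof -
  from f obtain m \<tau> where \<tau>: "\<tau> 0 = 0" "\<tau> m = L" "\<And>r. r < m \<Longrightarrow> \<tau> r < \<tau> (Suc r)"
    and an: "\<And>r. r < m \<Longrightarrow> extends_analytically f {\<tau> r..\<tau> (Suc r)}"
    unfolding piecewise_analytic_def by blast
  have "\<exists>C>0. \<forall>x\<in>{0..\<tau> r}. \<forall>y\<in>{0..\<tau> r}. x \<le> y \<longrightarrow> \<bar>f y - f x\<bar> \<le> C * (y - x)" if "r \<le> m" for r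
    using that
  proof (induction r)
    case 0
    then show ?case by (auto simp: \<tau> intro!: exI[of _ 1])
  next
    case (Suc r)
    then obtain C where C: "C > 0" "\<And>x y. 0 \<le> x \<Longrightarrow> x \<le> y \<Longrightarrow> y \<le> \<tau> r \<Longrightarrow> \<bar>f y - f x\<bar> \<le> C * (y - x)"
      by fastforce
    obtain g g' g'' C' where C': "C' > 0" and g: "\<And>x. x \<in> {\<tau> r..\<tau> (Suc r)} \<Longrightarrow> g x = f x"
      "\<And>x. x \<in> {\<tau> r..\<tau> (Suc r)} \<Longrightarrow> (g has_real_derivative g' x) (at x)"
      "\<And>x. x \<in> {\<tau> r..\<tau> (Suc r)} \<Longrightarrow> (g' has_real_derivative g'' x) (at x)"
      "\<And>x. x \<in> {\<tau> r..\<tau> (Suc r)} \<Longrightarrow> \<bar>f x\<bar> \<le> C' \<and> \<bar>g' x\<bar> \<le> C' \<and> \<bar>g'' x\<bar> \<le> C'"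
      by (rule extends_analytically_derivs[OF an[of r]]) (use Suc.prems in simp, rule that, assumption+)
    have D: "\<bar>f y - f x\<bar> \<le> C' * (y - x)" if "\<tau> r \<le> x" "x \<le> y" "y \<le> \<tau> (Suc r)" for x y
    proof -
      have "\<bar>g y - g x\<bar> \<le> C' * (y - x)"
      proof (rule first_difference_le[where f' = g'])
        fix u assume u: "u \<in> {x..y}"
        then have u': "u \<in> {\<tau> r..\<tau> (Suc r)}" using that by auto
        show "(g has_real_derivative g' u) (at u within {x..y})"
          by (rule has_field_derivative_at_within[OF g(2)[OF u']])
        show "\<bar>g' u\<bar> \<le> C'" using g(4)[OF u'] by blast
      qed (use that in auto)
      then show ?thesis using g(1) that by auto
    qed
    have "\<bar>f y - f x\<bar> \<le> max C C' * (y - x)" if xy: "0 \<le> x" "x \<le> y" "y \<le> \<tau> (Suc r)" for x y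
    proof -
      have mx: "C * (v - u) \<le> max C C' * (v - u)" "C' * (v - u) \<le> max C C' * (v - u)" if "u \<le> v" for u v
        using that by (auto intro!: mult_right_mono)
      consider "y \<le> \<tau> r" | "\<tau> r \<le> x" | "x \<le> \<tau> r" "\<tau> r \<le> y" by linarith
      then show ?thesis
      proof cases
        case 1
        then show ?thesis using C(2)[OF xy(1,2)] mx(1)[OF xy(2)] by linarith
      next
        case 2
        then show ?thesis using D[OF _ xy(2,3)] mx(2)[OF xy(2)] by linarith
      next
        case 3
        have "\<bar>f y - f x\<bar> \<le> C * (\<tau> r - x) + C' * (y - \<tau> r)"
          using C(2)[of x "\<tau> r"] D[of "\<tau> r" y] 3 xy by linarith
        also have "\<dots> \<le> max C C' * (\<tau> r - x) + max C C' * (y - \<tau> r)"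
          using mx 3 by (intro add_mono) auto
        finally show ?thesis by (simp add: algebra_simps)
      qed
    qed
    moreover have "max C C' > 0" using C by auto
    ultimately show ?case by (intro exI[of _ "max C C'"]) auto
  qed
  from this[of m] obtain C where C: "C > 0"
    "\<And>x y. x \<in> {0..L} \<Longrightarrow> y \<in> {0..L} \<Longrightarrow> x \<le> y \<Longrightarrow> \<bar>f y - f x\<bar> \<le> C * (y - x)"
    by (auto simp: \<tau>)
  have "\<bar>f y - f x\<bar> \<le> C * \<bar>y - x\<bar>" if "x \<in> {0..L}" "y \<in> {0..L}" for x y
    using C(2)[OF that] C(2)[OF that(2,1)] by (cases "x \<le> y") (auto simp: abs_minus_commute)
  then show thesis using that C(1) by blast
qed

text \<open>Serves to pass from covariances to raw second moments: the product of the means is a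
  constant and is moved into the analytic part.\<close>

lemma condition_A_add_const:
  assumes "condition_A L c \<alpha> K"
  shows "condition_A L c \<alpha> (\<lambda>t. K t + m)"
proof -
  from assms obtain A B D where *: "\<alpha> > 0" "\<forall>m::nat. \<alpha> \<noteq> 2 * real m" "\<forall>t\<in>{-L..L}. K t = A t + B t"
        "even_on L A" "extends_analytically A {-L..L}"
        "even_on L B" "continuous_on {-L..L} B"
        "\<forall>t\<in>{0<..L}. D 0 t = B t"
        "\<forall>k. \<forall>t\<in>{0<..L}. (D k has_real_derivative D (Suc k) t) (at t within {0<..L})"
        "\<forall>k. (\<lambda>t. D k t - gamma_falling \<alpha> k * c * t powr (\<alpha> - real k))
                \<in> o[at_right 0](\<lambda>t. t powr (\<alpha> - real k))"
    unfolding condition_A_def by blast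
  have "extends_analytically (\<lambda>t. A t + m) {-L..L}"
  proof -
    obtain U g where U: "open U" "{-L..L} \<subseteq> U" "real_analytic_on g U" "\<forall>x\<in>{-L..L}. g x = A x"
      using *(5) unfolding extends_analytically_def by blast
    have "real_analytic_on (\<lambda>t. g t + m) U"
      unfolding real_analytic_on_def
    proof
      fix x assume "x \<in> U"
      then obtain a r where r: "r > 0" and a: "\<And>y. \<bar>y - x\<bar> < r \<Longrightarrow> (\<lambda>n. a n * (y - x) ^ n) sums g y"
        using U(3) unfolding real_analytic_on_def by blast
      define b where "b n = a n + (if n = 0 then m else 0)" for n :: nat
      have "(\<lambda>n. b n * (y - x) ^ n) sums (g y + m)" if "\<bar>y - x\<bar> < r" for y
      proof -
        have "(\<lambda>n. if n = 0 then m else 0) sums m" using sums_single[of 0 "\<lambda>_. m"] by simp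
        then have "(\<lambda>n. a n * (y - x) ^ n + (if n = 0 then m else 0)) sums (g y + m)"
          by (intro sums_add a that)
        then show ?thesis
          by (rule sums_cong[THEN iffD1, rotated]) (simp add: b_def)
      qed
      with r show "\<exists>a r. 0 < r \<and> (\<forall>y. \<bar>y - x\<bar> < r \<longrightarrow> (\<lambda>n. a n * (y - x) ^ n) sums (g y + m))"
        by blast
    qed
    with U show ?thesis unfolding extends_analytically_def
      by (intro exI[of _ U] exI[of _ "\<lambda>t. g t + m"]) auto
  qed
  moreover have "even_on L (\<lambda>t. A t + m)" using *(4) by (simp add: even_on_def)
  ultimately show ?thesis
    unfolding condition_A_def
    by (intro conjI *(1,2) exI[of _ "\<lambda>t. A t + m"] exI[of _ B] exI[of _ D] *(6-)) (use *(3) in auto)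
qed

text \<open>With s, s' and r, r' the scale values at the ends of steps j and m, and \<open>K\<close>
  the raw second moment function, the long expression is the second moment of two scaled increments.
  A discrete product rule splits it into a second difference of \<open>K\<close>, two first
  differences each times one scale increment, and a value of \<open>K\<close> times two.\<close>

lemma condition_A_scaled_increment_bound:
  assumes L: "L > 0" and K: "condition_A L c \<alpha> K" and \<gamma>: "\<gamma> \<le> \<alpha>" "\<gamma> \<le> 2" and S: "S > 0"
  obtains C where "C > 0"
    "\<And>n j m s s' r r' h. h = L / real n \<Longrightarrow> j \<in> {1..n} \<Longrightarrow> m \<in> {1..n} \<Longrightarrow>
       \<bar>s'\<bar> \<le> S \<Longrightarrow> \<bar>r'\<bar> \<le> S \<Longrightarrow> \<bar>s - s'\<bar> \<le> S * h \<Longrightarrow> \<bar>r - r'\<bar> \<le> S * h \<Longrightarrow>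
       \<bar>s * r * K ((real j - real m) * h) - s * r' * K ((real j - (real m - 1)) * h)
         - s' * r * K ((real j - 1 - real m) * h) + s' * r' * K ((real j - 1 - (real m - 1)) * h)\<bar>
       \<le> C * (h\<^sup>2 * ((\<bar>real j - real m\<bar> + 1) * h) powr (\<gamma> - 2))"
proof -
  obtain C where C: "C > 0" and
    bnd: "\<And>h i. h > 0 \<Longrightarrow> (real i + 1) * h \<le> L \<Longrightarrow>
      \<bar>K (real i * h)\<bar> \<le> C * ((real i + 1) * h) powr (\<gamma> - 2) \<and>
      \<bar>K ((real i + 1) * h) - K (real i * h)\<bar> \<le> C * (h * ((real i + 1) * h) powr (\<gamma> - 2)) \<and>
      \<bar>2 * K (real i * h) - K ((real i + 1) * h) - K ((real i - 1) * h)\<bar>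
         \<le> C * (h\<^sup>2 * ((real i + 1) * h) powr (\<gamma> - 2))"
    by (rule condition_A_lag_bounds[OF L K \<gamma>]; rule that; assumption)
  have even: "K (- t) = K t" if "t \<in> {-L..L}" for t
    by (rule condition_A_cases[OF L K]) (use that in blast)
  \<comment> \<open>\<open>Q\<close> pays for replacing the weight of lag i - 1 by that of lag i:
    for i \<ge> 1 the bases i h and (i + 1) h differ by a factor of at most 2.\<close>
  define Q where "Q = (2::real) powr (2 - \<gamma>)"
  have Q: "Q \<ge> 1" using \<gamma> unfolding Q_def by (intro ge_one_powr_ge_zero) auto
  \<comment> \<open>\<open>x\<close> and \<open>y\<close> will be 1 and \<open>Q\<close> in one of
    the two orders: the sign of j - m decides which of the two shifts decreases the lag, and only
    the sum 1 + Q enters the bound.\<close>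
  have main: "\<bar>s * r * K0 - s * r' * Kp - s' * r * Km + s' * r' * K0\<bar> \<le> S\<^sup>2 * C * (3 + Q) * (h\<^sup>2 * W)"
    if h: "h > 0" and W: "W > 0" and s: "\<bar>s'\<bar> \<le> S" "\<bar>r'\<bar> \<le> S" "\<bar>s - s'\<bar> \<le> S * h" "\<bar>r - r'\<bar> \<le> S * h"
      and K0: "\<bar>K0\<bar> \<le> C * W" and Kp: "\<bar>K0 - Kp\<bar> \<le> x * (C * (h * W))" and Km: "\<bar>K0 - Km\<bar> \<le> y * (C * (h * W))"
      and xy: "x + y = 1 + Q" "x \<ge> 0" "y \<ge> 0"
      and K2: "\<bar>2 * K0 - Kp - Km\<bar> \<le> C * (h\<^sup>2 * W)"
    for s s' r r' h K0 Kp Km W x y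
  proof -
    have am: "\<bar>a * b\<bar> \<le> A * B" if "\<bar>a\<bar> \<le> A" "\<bar>b\<bar> \<le> B" for a b A B :: real
      unfolding abs_mult using that by (intro mult_mono) auto
    have "s * r * K0 - s * r' * Kp - s' * r * Km + s' * r' * K0
      = (s' * r') * (2 * K0 - Kp - Km) + ((s - s') * r') * (K0 - Kp) + (s' * (r - r')) * (K0 - Km)
        + ((s - s') * (r - r')) * K0"
      by (simp add: algebra_simps)
    also have "\<bar>\<dots>\<bar> \<le> \<bar>(s' * r') * (2 * K0 - Kp - Km)\<bar> + \<bar>((s - s') * r') * (K0 - Kp)\<bar>
        + \<bar>(s' * (r - r')) * (K0 - Km)\<bar> + \<bar>((s - s') * (r - r')) * K0\<bar>"
      by linarith
    also have "\<dots> \<le> (S * S) * (C * (h\<^sup>2 * W)) + ((S * h) * S) * (x * (C * (h * W)))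
        + (S * (S * h)) * (y * (C * (h * W))) + ((S * h) * (S * h)) * (C * W)"
      by (intro add_mono am s K0 Kp Km K2)
    also have "\<dots> = S\<^sup>2 * C * (2 + (x + y)) * (h\<^sup>2 * W)"
      by (simp add: power2_eq_square algebra_simps)
    also have "2 + (x + y) = 3 + Q" using xy by simp
    finally show ?thesis .
  qed
  show thesis
  proof (rule that[of "S\<^sup>2 * C * (3 + Q)"])
    show "S\<^sup>2 * C * (3 + Q) > 0" using S C Q by auto
    fix n j m s s' r r' h
    assume h: "h = L / real n" and jm: "j \<in> {1..n}" "m \<in> {1..n}"
      and s: "\<bar>s'\<bar> \<le> S" "\<bar>r'\<bar> \<le> S" "\<bar>s - s'\<bar> \<le> S * h" "\<bar>r - r'\<bar> \<le> S * h"
    have h0: "h > 0" using h L jm by auto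
    define i where "i = (if m \<le> j then j - m else m - j)"
    have i: "\<bar>real j - real m\<bar> = real i" by (auto simp: i_def)
    have "real i + 1 \<le> real n" using jm by (auto simp: i_def)
    then have "(real i + 1) * h \<le> real n * h" using h0 by (intro mult_right_mono) auto
    moreover have "real n * h = L" using h jm by simp
    ultimately have iL: "(real i + 1) * h \<le> L" by simp
    define W where "W = ((real i + 1) * h) powr (\<gamma> - 2)"
    have W: "W > 0" using h0 by (auto simp: W_def)
    define k0 kp km where "k0 = K (real i * h)" and "kp = K ((real i + 1) * h)" and "km = K ((real i - 1) * h)"
    have b: "\<bar>k0\<bar> \<le> C * W" "\<bar>k0 - kp\<bar> \<le> C * (h * W)" "\<bar>2 * k0 - kp - km\<bar> \<le> C * (h\<^sup>2 * W)"
      using bnd[OF h0 iL] by (simp_all add: k0_def kp_def km_def W_def abs_minus_commute)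
    have bm: "\<bar>k0 - km\<bar> \<le> Q * (C * (h * W))"
    proof (cases "i = 0")
      case True
      have "h \<in> {-L..L}" using iL h0 True by auto
      then have "\<bar>k0 - km\<bar> \<le> 1 * (C * (h * W))" using b(2) even[of h] by (simp add: True k0_def km_def kp_def)
      also have "\<dots> \<le> Q * (C * (h * W))" using Q C h0 W by (intro mult_right_mono) auto
      finally show ?thesis .
    next
      case False
      then obtain i' where i': "i = Suc i'" by (cases i) auto
      have "(real i' + 1) * h \<le> (real i + 1) * h" unfolding i' using h0 by (intro mult_right_mono) auto
      then have "(real i' + 1) * h \<le> L" using iL by linarith
      from bnd[OF h0 this] have "\<bar>k0 - km\<bar> \<le> C * (h * ((real i' + 1) * h) powr (\<gamma> - 2))"
        by (simp add: i' k0_def km_def add.commute)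
      also have "((real i' + 1) * h) powr (\<gamma> - 2) \<le> ((real i + 1) * h / 2) powr (\<gamma> - 2)"
      proof (rule powr_mono2')
        have "(real i + 1) * h \<le> (2 * (real i' + 1)) * h"
          unfolding i' using h0 by (intro mult_right_mono) auto
        then show "(real i + 1) * h / 2 \<le> (real i' + 1) * h" by (simp add: algebra_simps)
      qed (use \<gamma> h0 in auto)
      also have "((real i + 1) * h / 2) powr (\<gamma> - 2) = W * Q"
        using h0 by (simp add: W_def Q_def powr_divide powr_diff)
      finally show ?thesis using C h0 by (simp add: mult_ac)
    qed
    have args: "(real j - 1 - (real m - 1)) = real j - real m" by simp
    have mem: "t * h \<in> {-L..L}" if "\<bar>t\<bar> \<le> real i + 1" for t
    proof -
      have "\<bar>t * h\<bar> \<le> (real i + 1) * h" using that h0 by (simp add: abs_mult)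
      then show ?thesis using iL by auto
    qed
    have "\<bar>s * r * K ((real j - real m) * h) - s * r' * K ((real j - (real m - 1)) * h)
         - s' * r * K ((real j - 1 - real m) * h) + s' * r' * K ((real j - real m) * h)\<bar>
       \<le> S\<^sup>2 * C * (3 + Q) * (h\<^sup>2 * W)"
    proof (cases "m \<le> j")
      case True
      then have r: "real j - real m = real i" by (simp add: i_def)
      then have *: "real j - (real m - 1) = real i + 1" "real j - 1 - real m = real i - 1" by auto
      show ?thesis unfolding r *
        by (rule main[OF h0 W s, where x = 1 and y = Q])
          (use b bm Q in \<open>simp_all add: k0_def kp_def km_def\<close>)
    next
      case False
      then have r: "real j - real m = - real i" by (simp add: i_def)
      then have *: "real j - (real m - 1) = - (real i - 1)" "real j - 1 - real m = - (real i + 1)" by auto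
      have ev: "K (- x * h) = K (x * h)" if "\<bar>x\<bar> \<le> real i + 1" for x
        using even[OF mem[OF that]] by simp
      have ev3: "K (- real i * h) = K (real i * h)" "K (- (real i - 1) * h) = K ((real i - 1) * h)"
        "K (- (real i + 1) * h) = K ((real i + 1) * h)"
        by (rule ev, simp)+
      show ?thesis unfolding r * ev3
        by (rule main[OF h0 W s, where x = Q and y = 1])
          (use b bm Q in \<open>simp_all add: k0_def kp_def km_def\<close>)
    qed
    then show "\<bar>s * r * K ((real j - real m) * h) - s * r' * K ((real j - (real m - 1)) * h)
         - s' * r * K ((real j - 1 - real m) * h) + s' * r' * K ((real j - 1 - (real m - 1)) * h)\<bar>
       \<le> S\<^sup>2 * C * (3 + Q) * (h\<^sup>2 * ((\<bar>real j - real m\<bar> + 1) * h) powr (\<gamma> - 2))"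
      unfolding args i W_def .
  qed
qed

subsection \<open>First-difference least squares\<close>

text \<open>For fixed j every lag |j - k| occurs at most twice, so each inner sum is at most twice
  the convergent series over all lags.\<close>

lemma lag_sum_bound:
  fixes e :: real
  assumes e: "e < -1"
  obtains C where "C > 0" "\<And>n. (\<Sum>j=1..n. \<Sum>k=1..n. (\<bar>real j - real k\<bar> + 1) powr e) \<le> C * real n"
proof -
  have sm: "summable (\<lambda>i. (real i + 1) powr e)"
    using e summable_real_powr_iff[of e] summable_iff_shift[of "\<lambda>i. real i powr e" 1] by (simp add: add.commute)
  define T where "T = (\<Sum>i. (real i + 1) powr e)"
  have fin: "(\<Sum>i\<in>I. (real i + 1) powr e) \<le> T" if "finite I" for I
    unfolding T_def by (rule sum_le_suminf[OF sm that]) auto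
  have "(\<Sum>k=1..n. (\<bar>real j - real k\<bar> + 1) powr e) \<le> 2 * T" if "j \<in> {1..n}" for j n
  proof -
    have "(\<Sum>k=1..n. (\<bar>real j - real k\<bar> + 1) powr e)
       \<le> (\<Sum>k\<in>{1..j}. (\<bar>real j - real k\<bar> + 1) powr e) + (\<Sum>k\<in>{j..n}. (\<bar>real j - real k\<bar> + 1) powr e)"
      using that by (subst sum.union_inter[symmetric])
        (auto simp: ivl_disj_un intro!: add_increasing2 sum_nonneg eq_refl sum.cong)
    also have "(\<Sum>k\<in>{1..j}. (\<bar>real j - real k\<bar> + 1) powr e) = (\<Sum>i\<in>(\<lambda>k. j - k) ` {1..j}. (real i + 1) powr e)"
      by (subst sum.reindex) (auto simp: inj_on_def of_nat_diff intro!: sum.cong)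
    also have "(\<Sum>k\<in>{j..n}. (\<bar>real j - real k\<bar> + 1) powr e) = (\<Sum>i\<in>(\<lambda>k. k - j) ` {j..n}. (real i + 1) powr e)"
      by (subst sum.reindex) (auto simp: inj_on_def of_nat_diff intro!: sum.cong)
    finally show ?thesis using fin[of "(\<lambda>k. j - k) ` {1..j}"] fin[of "(\<lambda>k. k - j) ` {j..n}"] by simp
  qed
  then have "(\<Sum>j=1..n. \<Sum>k=1..n. (\<bar>real j - real k\<bar> + 1) powr e) \<le> (\<Sum>j=1..n. 2 * T)" for n
    by (intro sum_mono) auto
  moreover have "T > 0"
  proof -
    have "(1::real) \<le> T" using fin[of "{0}"] by simp
    then show ?thesis by simp
  qed
  ultimately show thesis by (intro that[of "2 * T"]) (auto simp: mult_ac)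
qed

text \<open>Isserlis' formula is applied to each product in the expanded square; pairing each U_j
  with its own V_j produces the first square. The last term is nonpositive, which is why upper
  bounds can drop it.\<close>

lemma (in prob_space) gaussian_bilinear_second_moment:
  fixes U V :: "nat \<Rightarrow> 'a \<Rightarrow> real"
  assumes J: "finite J"
    and lin: "\<And>a b. normal_rv M (\<lambda>w. \<Sum>j\<in>J. a j * U j w + b j * V j w)"
  shows "integrable M (\<lambda>w. (\<Sum>j\<in>J. U j w * V j w)\<^sup>2)"
    and "expectation (\<lambda>w. (\<Sum>j\<in>J. U j w * V j w)\<^sup>2) =
      (\<Sum>j\<in>J. expectation (\<lambda>w. U j w * V j w))\<^sup>2
      + (\<Sum>j\<in>J. \<Sum>k\<in>J. expectation (\<lambda>w. U j w * U k w) * expectation (\<lambda>w. V j w * V k w)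
          + expectation (\<lambda>w. U j w * V k w) * expectation (\<lambda>w. V j w * U k w))
      - 2 * (\<Sum>j\<in>J. expectation (U j) * expectation (V j))\<^sup>2"
proof -
  have sq: "(\<Sum>j\<in>J. U j w * V j w)\<^sup>2 = (\<Sum>j\<in>J. \<Sum>k\<in>J. U j w * V j w * (U k w * V k w))" for w
    by (simp add: power2_eq_square sum_product)
  have iss: "integrable M (\<lambda>w. U j w * V j w * (U k w * V k w)) \<and>
     expectation (\<lambda>w. U j w * V j w * (U k w * V k w)) =
       expectation (\<lambda>w. U j w * V j w) * expectation (\<lambda>w. U k w * V k w)
     + expectation (\<lambda>w. U j w * U k w) * expectation (\<lambda>w. V j w * V k w)
     + expectation (\<lambda>w. U j w * V k w) * expectation (\<lambda>w. V j w * U k w)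
     - 2 * (expectation (U j) * expectation (V j) * expectation (U k) * expectation (V k))"
    if jk: "j \<in> J" "k \<in> J" for j k
  proof -
    define G where "G i = (case i of 0 \<Rightarrow> U j | Suc 0 \<Rightarrow> V j | Suc (Suc 0) \<Rightarrow> U k | _ \<Rightarrow> V k)" for i :: nat
    have G: "G 0 = U j" "G 1 = V j" "G 2 = U k" "G 3 = V k"
      by (simp_all add: G_def eval_nat_numeral)
    have "normal_rv M (\<lambda>w. \<Sum>i<4. a i * G i w)" for a
    proof -
      \<comment> \<open>For j = k the four variables sit at one index, and there the coefficients
        have to be added.\<close>
      let ?a = "\<lambda>i. (if i = j then a 0 else 0) + (if i = k then a 2 else 0)"
      let ?b = "\<lambda>i. (if i = j then a 1 else 0) + (if i = k then a 3 else 0)"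
      have "(\<Sum>i<4. a i * G i w) = (\<Sum>i\<in>J. ?a i * U i w + ?b i * V i w)" for w
      proof -
        have "(\<Sum>i\<in>J. ?a i * U i w + ?b i * V i w) =
          (\<Sum>i\<in>J. (if i = j then a 0 * U j w + a 1 * V j w else 0) + (if i = k then a 2 * U k w + a 3 * V k w else 0))"
          by (intro sum.cong refl) (auto simp: algebra_simps)
        also have "\<dots> = a 0 * U j w + a 1 * V j w + (a 2 * U k w + a 3 * V k w)"
          using J jk by (simp add: sum.distrib)
        finally show ?thesis by (simp add: G_def eval_nat_numeral)
      qed
      then show ?thesis using lin[of ?a ?b] by simp
    qed
    from isserlis[of G, OF this] show ?thesis unfolding G by (simp add: mult_ac)
  qed
  show "integrable M (\<lambda>w. (\<Sum>j\<in>J. U j w * V j w)\<^sup>2)"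
    unfolding sq using iss by (intro Bochner_Integration.integrable_sum) auto
  have "expectation (\<lambda>w. (\<Sum>j\<in>J. U j w * V j w)\<^sup>2)
     = (\<Sum>j\<in>J. \<Sum>k\<in>J. expectation (\<lambda>w. U j w * V j w * (U k w * V k w)))"
  proof -
    have "expectation (\<lambda>w. (\<Sum>j\<in>J. U j w * V j w)\<^sup>2)
       = (\<Sum>j\<in>J. expectation (\<lambda>w. \<Sum>k\<in>J. U j w * V j w * (U k w * V k w)))"
      unfolding sq using iss
      by (intro Bochner_Integration.integral_sum Bochner_Integration.integrable_sum) blast
    also have "\<dots> = (\<Sum>j\<in>J. \<Sum>k\<in>J. expectation (\<lambda>w. U j w * V j w * (U k w * V k w)))"
      using iss by (intro sum.cong refl Bochner_Integration.integral_sum) blast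
    finally show ?thesis .
  qed
  also have "\<dots> = (\<Sum>j\<in>J. \<Sum>k\<in>J. expectation (\<lambda>w. U j w * V j w) * expectation (\<lambda>w. U k w * V k w)
     + (expectation (\<lambda>w. U j w * U k w) * expectation (\<lambda>w. V j w * V k w)
     + expectation (\<lambda>w. U j w * V k w) * expectation (\<lambda>w. V j w * U k w))
     - 2 * ((expectation (U j) * expectation (V j)) * (expectation (U k) * expectation (V k))))"
    using iss by (intro sum.cong refl) (simp add: mult_ac)
  also have "\<dots> = (\<Sum>j\<in>J. expectation (\<lambda>w. U j w * V j w))\<^sup>2
      + (\<Sum>j\<in>J. \<Sum>k\<in>J. expectation (\<lambda>w. U j w * U k w) * expectation (\<lambda>w. V j w * V k w)
          + expectation (\<lambda>w. U j w * V k w) * expectation (\<lambda>w. V j w * U k w))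
      - 2 * (\<Sum>j\<in>J. expectation (U j) * expectation (V j))\<^sup>2"
  proof -
    have sq: "(\<Sum>j\<in>J. u j)\<^sup>2 = (\<Sum>j\<in>J. \<Sum>k\<in>J. u j * u k)" for u :: "nat \<Rightarrow> real"
      by (simp add: power2_eq_square sum_product)
    show ?thesis unfolding sq sum_distrib_left sum.distrib sum_subtractf by (simp add: sum.distrib sum_subtractf)
  qed
  finally show "expectation (\<lambda>w. (\<Sum>j\<in>J. U j w * V j w)\<^sup>2) =
      (\<Sum>j\<in>J. expectation (\<lambda>w. U j w * V j w))\<^sup>2
      + (\<Sum>j\<in>J. \<Sum>k\<in>J. expectation (\<lambda>w. U j w * U k w) * expectation (\<lambda>w. V j w * V k w)
          + expectation (\<lambda>w. U j w * V k w) * expectation (\<lambda>w. V j w * U k w))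
      - 2 * (\<Sum>j\<in>J. expectation (U j) * expectation (V j))\<^sup>2" .
qed

section \<open>Raw moments and linear combinations of the field\<close>

lemma stationary_gaussian_field_raw_moments:
  assumes Z: "stationary_gaussian_field M Z K"
  obtains \<mu> where
    "\<And>k s. k \<in> {1, 2} \<Longrightarrow> integrable M (Z k s)"
    "\<And>k l s t. k \<in> {1, 2} \<Longrightarrow> l \<in> {1, 2} \<Longrightarrow> integrable M (\<lambda>w. Z k s w * Z l t w)"
    "\<And>k l s t. k \<in> {1, 2} \<Longrightarrow> l \<in> {1, 2} \<Longrightarrow>
       (LINT w|M. Z k s w * Z l t w) = K k l (s - t) + \<mu> k * \<mu> l"
proof -
  from Z interpret prob_space M unfolding stationary_gaussian_field_def by blast
  from Z have comb: "\<And>S a b. finite S \<Longrightarrow> normal_rv M (\<lambda>w. \<Sum>s\<in>S. a s * Z 1 s w + b s * Z 2 s w)"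
    and mean: "\<forall>k\<in>{1, 2}. \<exists>m. \<forall>s. (LINT w|M. Z k s w) = m"
    and cov: "\<And>k l s t. k \<in> {1, 2} \<Longrightarrow> l \<in> {1, 2} \<Longrightarrow> covariance M (Z k (s + t)) (Z l s) = K k l t"
    unfolding stationary_gaussian_field_def by blast+
  from mean obtain \<mu> where \<mu>: "\<And>k s. k \<in> {1, 2} \<Longrightarrow> expectation (Z k s) = \<mu> k" by metis
  have nrm: "normal_rv M (Z k s)" if "k \<in> {1, 2}" for k s
    using comb[of "{s}" "\<lambda>_. if k = 1 then 1 else 0" "\<lambda>_. if k = 1 then 0 else 1"] that by auto
  note int1 = normal_rv_moments(1)[OF nrm]
  note int2 = normal_rv_mult_integrable[OF nrm nrm]
  have "(LINT w|M. Z k s w * Z l t w) = K k l (s - t) + \<mu> k * \<mu> l" if kl: "k \<in> {1, 2}" "l \<in> {1, 2}" for k l s t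
  proof -
    have "K k l (s - t) = expectation (\<lambda>w. (Z k s w - \<mu> k) * (Z l t w - \<mu> l))"
      using cov[OF kl, of t "s - t"] \<mu> kl by (simp add: covariance_def)
    also have "(\<lambda>w. (Z k s w - \<mu> k) * (Z l t w - \<mu> l)) =
       (\<lambda>w. Z k s w * Z l t w - \<mu> l * Z k s w - \<mu> k * Z l t w + \<mu> k * \<mu> l)"
      by (simp add: fun_eq_iff algebra_simps)
    also have "expectation \<dots> = expectation (\<lambda>w. Z k s w * Z l t w) - \<mu> l * \<mu> k - \<mu> k * \<mu> l + \<mu> k * \<mu> l"
      using int1[OF kl(1)] int1[OF kl(2)] int2[OF kl] \<mu> kl by (simp add: prob_space)
    finally show ?thesis by simp
  qed
  then show thesis using that int1 int2 by blast
qed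

text \<open>Neighbouring increments share sites, so their combinations do not literally have the
  form for which \<open>stationary_gaussian_field\<close> asserts normality. Closure of this set
  under sums and scaling restores that form.\<close>

definition gaussian_span :: "(nat \<Rightarrow> real \<Rightarrow> 'a \<Rightarrow> real) \<Rightarrow> ('a \<Rightarrow> real) set" where
  "gaussian_span Z = {V. \<exists>S a b. finite S \<and> V = (\<lambda>w. \<Sum>s\<in>S. a s * Z 1 s w + b s * Z 2 s w)}"

lemma gaussian_span_base:
  assumes "k \<in> {1, 2}"
  shows "Z k s \<in> gaussian_span Z"
proof -
  have "Z k s = (\<lambda>w. \<Sum>s\<in>{s}. (if k = 1 then 1 else 0) * Z 1 s w + (if k = 1 then 0 else 1) * Z 2 s w)"
    using assms by auto
  then show ?thesis unfolding gaussian_span_def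
    by (intro CollectI exI[of _ "{s}"] exI[of _ "\<lambda>_. if k = 1 then 1 else 0"]
        exI[of _ "\<lambda>_. if k = 1 then 0 else 1"]) auto
qed

lemma gaussian_span_scale: "V \<in> gaussian_span Z \<Longrightarrow> (\<lambda>w. r * V w) \<in> gaussian_span Z"
proof -
  assume "V \<in> gaussian_span Z"
  then obtain S a b where "finite S" "V = (\<lambda>w. \<Sum>s\<in>S. a s * Z 1 s w + b s * Z 2 s w)"
    unfolding gaussian_span_def by blast
  then show ?thesis unfolding gaussian_span_def
    by (intro CollectI exI[of _ S] exI[of _ "\<lambda>s. r * a s"] exI[of _ "\<lambda>s. r * b s"])
      (simp add: sum_distrib_left algebra_simps)
qed

lemma gaussian_span_add:
  assumes "V \<in> gaussian_span Z" "V' \<in> gaussian_span Z"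
  shows "(\<lambda>w. V w + V' w) \<in> gaussian_span Z"
proof -
  obtain S a b where V: "finite S" "V = (\<lambda>w. \<Sum>s\<in>S. a s * Z 1 s w + b s * Z 2 s w)"
    using assms(1) unfolding gaussian_span_def by blast
  obtain S' a' b' where V': "finite S'" "V' = (\<lambda>w. \<Sum>s\<in>S'. a' s * Z 1 s w + b' s * Z 2 s w)"
    using assms(2) unfolding gaussian_span_def by blast
  let ?r = "\<lambda>T f s. if s \<in> T then f s else 0 :: real"
  have "V w + V' w = (\<Sum>s\<in>S \<union> S'. (?r S a s + ?r S' a' s) * Z 1 s w + (?r S b s + ?r S' b' s) * Z 2 s w)" for w
  proof -
    have "V w = (\<Sum>s\<in>S \<union> S'. ?r S a s * Z 1 s w + ?r S b s * Z 2 s w)"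
      unfolding V(2) using V(1) V'(1) by (intro sum.mono_neutral_cong_left) auto
    moreover have "V' w = (\<Sum>s\<in>S \<union> S'. ?r S' a' s * Z 1 s w + ?r S' b' s * Z 2 s w)"
      unfolding V'(2) using V(1) V'(1) by (intro sum.mono_neutral_cong_left) auto
    ultimately show ?thesis by (simp add: sum.distrib[symmetric] algebra_simps)
  qed
  then show ?thesis unfolding gaussian_span_def using V(1) V'(1)
    by (intro CollectI exI[of _ "S \<union> S'"] exI[of _ "\<lambda>s. ?r S a s + ?r S' a' s"]
          exI[of _ "\<lambda>s. ?r S b s + ?r S' b' s"]) auto
qed

lemma gaussian_span_sum:
  assumes "\<And>j. j \<in> J \<Longrightarrow> V j \<in> gaussian_span Z"
  shows "(\<lambda>w. \<Sum>j\<in>J. V j w) \<in> gaussian_span Z"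
  using assms
proof (induction J rule: infinite_finite_induct)
  case (insert j J)
  then show ?case using gaussian_span_add[of "V j" Z "\<lambda>w. \<Sum>j\<in>J. V j w"] by simp
qed (auto simp: gaussian_span_def intro!: exI[of _ "{}"])

text \<open>The exponent conditions have separate tasks. \<alpha>_11 < \<alpha>_12 makes the mean of
  the numerator negligible against that of the denominator, \<alpha>_11 < \<alpha>_22 + 1 does so
  for the fluctuation of the numerator, and \<alpha>_11 < 2 gives the lower bound on the variogram
  and keeps 2 \<alpha>_11 - 1 below 3.\<close>

lemma ols_consistent_fixed_scale:
  fixes \<sigma> \<rho> :: "real \<Rightarrow> real"
  assumes L: "L > 0" and Z: "stationary_gaussian_field M Z K"
    and A: "\<And>k l. k \<in> {1, 2} \<Longrightarrow> l \<in> {1, 2} \<Longrightarrow> condition_A L (c k l) (\<alpha> k l) (K k l)"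
    and c: "c 1 1 \<noteq> 0"
    and \<alpha>: "\<alpha> 1 1 < \<alpha> 1 2" "\<alpha> 1 1 < \<alpha> 2 2 + 1" "\<alpha> 1 1 < 2"
    and \<sigma>: "\<And>s. \<sigma> s > 0" "piecewise_analytic L \<sigma>" and \<rho>: "piecewise_analytic L \<rho>"
  defines "X \<equiv> (\<lambda>s w. \<sigma> s * Z 1 s w)" and "W \<equiv> (\<lambda>s w. \<rho> s * Z 2 s w)"
  shows "converges_in_prob M (first_difference_ols L X (response \<beta> X W)) \<beta>"
proof -
  from Z interpret prob_space M unfolding stationary_gaussian_field_def by blast
  from Z have comb: "\<And>S a b. finite S \<Longrightarrow> normal_rv M (\<lambda>w. \<Sum>s\<in>S. a s * Z 1 s w + b s * Z 2 s w)"
    and meas: "\<And>k s. k \<in> {1, 2} \<Longrightarrow> Z k s \<in> borel_measurable M"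
    unfolding stationary_gaussian_field_def by blast+
  have spanN: "normal_rv M V" if "V \<in> gaussian_span Z" for V
    using that comb unfolding gaussian_span_def by blast
  have [measurable]: "Z 1 s \<in> borel_measurable M" "Z 2 s \<in> borel_measurable M"
    "Z (Suc 0) s \<in> borel_measurable M" for s
    using meas[of 1] meas[of 2] by auto
  obtain \<mu> where
    int2: "\<And>k l s t. k \<in> {1, 2} \<Longrightarrow> l \<in> {1, 2} \<Longrightarrow> integrable M (\<lambda>w. Z k s w * Z l t w)"
    and E2: "\<And>k l s t. k \<in> {1, 2} \<Longrightarrow> l \<in> {1, 2} \<Longrightarrow>
       expectation (\<lambda>w. Z k s w * Z l t w) = K k l (s - t) + \<mu> k * \<mu> l"
    by (rule stationary_gaussian_field_raw_moments[OF Z]; rule that; assumption)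
  \<comment> \<open>\<open>R\<close> is the raw second moment function, so that the increments need
    no centring.\<close>
  define R where "R k l t = K k l t + \<mu> k * \<mu> l" for k l t
  have RA: "condition_A L (c k l) (\<alpha> k l) (R k l)" if "k \<in> {1, 2}" "l \<in> {1, 2}" for k l
    unfolding R_def by (rule condition_A_add_const[OF A[OF that]])
  define mesh where "mesh n = L / real n" for n
  have mesh_pos: "mesh n > 0" and n_mesh: "real n * mesh n = L" if "n \<ge> 1" for n
    using that L by (simp_all add: mesh_def)
  have mesh_le: "mesh n \<le> L" if "n \<ge> 1" for n
  proof -
    have "1 * mesh n \<le> real n * mesh n" using that mesh_pos[OF that] by (intro mult_right_mono) auto
    then show ?thesis using n_mesh[OF that] by simp
  qed
  define P where "P k = (if k = 1 then \<sigma> else \<rho>)" for k :: nat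
  define I where "I k n j w = P k (real j * mesh n) * Z k (real j * mesh n) w
     - P k ((real j - 1) * mesh n) * Z k ((real j - 1) * mesh n) w" for k n j w
  let ?q = "\<lambda>k l n j m. expectation (\<lambda>w. I k n j w * I l n m w)"
  let ?wt = "\<lambda>\<gamma> n (j :: nat) (m :: nat). (mesh n)\<^sup>2 * ((\<bar>real j - real m\<bar> + 1) * mesh n) powr (\<gamma> - 2)"

  \<comment> \<open>Uniform bounds on the scale paths\<close>
  have "\<exists>S>0. \<forall>k. (\<forall>s\<in>{0..L}. \<bar>P k s\<bar> \<le> S) \<and> (\<forall>s\<in>{0..L}. \<forall>t\<in>{0..L}. \<bar>P k s - P k t\<bar> \<le> S * \<bar>s - t\<bar>)"
  proof -
    obtain C1 where C1: "C1 > 0" "\<And>x y. x \<in> {0..L} \<Longrightarrow> y \<in> {0..L} \<Longrightarrow> \<bar>\<sigma> y - \<sigma> x\<bar> \<le> C1 * \<bar>y - x\<bar>"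
      by (rule piecewise_analytic_lipschitz[OF \<sigma>(2)]; rule that; assumption)
    obtain C2 where C2: "C2 > 0" "\<And>x y. x \<in> {0..L} \<Longrightarrow> y \<in> {0..L} \<Longrightarrow> \<bar>\<rho> y - \<rho> x\<bar> \<le> C2 * \<bar>y - x\<bar>"
      by (rule piecewise_analytic_lipschitz[OF \<rho>]; rule that; assumption)
    define S where "S = (C1 + C2) + (C1 + C2) * L + \<bar>\<sigma> 0\<bar> + \<bar>\<rho> 0\<bar>"
    have S: "S > 0" "C1 + C2 \<le> S" using C1 C2 L by (auto simp: S_def add_pos_nonneg)
    have lip: "\<bar>P k s - P k t\<bar> \<le> (C1 + C2) * \<bar>s - t\<bar>" if "s \<in> {0..L}" "t \<in> {0..L}" for k s t
    proof -
      have "\<bar>P k s - P k t\<bar> \<le> C1 * \<bar>s - t\<bar> \<or> \<bar>P k s - P k t\<bar> \<le> C2 * \<bar>s - t\<bar>"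
        using C1(2)[of t s] C2(2)[of t s] that by (auto simp: P_def)
      moreover have "C1 * \<bar>s - t\<bar> \<ge> 0" "C2 * \<bar>s - t\<bar> \<ge> 0" using C1 C2 by auto
      ultimately show ?thesis unfolding distrib_right by linarith
    qed
    have "\<bar>P k s\<bar> \<le> S" if "s \<in> {0..L}" for k s
    proof -
      have "\<bar>P k s - P k 0\<bar> \<le> (C1 + C2) * \<bar>s - 0\<bar>" using lip[of s 0 k] that L by auto
      also have "\<dots> \<le> (C1 + C2) * L" using that C1 C2 by (intro mult_left_mono) auto
      finally have "\<bar>P k s\<bar> \<le> (C1 + C2) * L + \<bar>P k 0\<bar>" by linarith
      moreover have "\<bar>P k 0\<bar> \<le> \<bar>\<sigma> 0\<bar> + \<bar>\<rho> 0\<bar>" by (simp add: P_def)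
      ultimately show ?thesis using C1 C2 unfolding S_def by linarith
    qed
    moreover have "\<bar>P k s - P k t\<bar> \<le> S * \<bar>s - t\<bar>" if "s \<in> {0..L}" "t \<in> {0..L}" for k s t
      using lip[OF that, of k] mult_right_mono[OF S(2), of "\<bar>s - t\<bar>"] by simp
    ultimately show ?thesis using S(1) by blast
  qed
  then obtain S where S: "S > 0" and Pb: "\<And>k s. s \<in> {0..L} \<Longrightarrow> \<bar>P k s\<bar> \<le> S"
    and Plip: "\<And>k s t. s \<in> {0..L} \<Longrightarrow> t \<in> {0..L} \<Longrightarrow> \<bar>P k s - P k t\<bar> \<le> S * \<bar>s - t\<bar>" by blast

  \<comment> \<open>The scale is known to be positive only pointwise; the Lipschitz property makes
    it continuous, and it attains a positive minimum.\<close>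
  obtain s0 where s0: "s0 > 0" "\<And>s. s \<in> {0..L} \<Longrightarrow> s0 \<le> \<sigma> s"
  proof -
    have "S-lipschitz_on {0..L} \<sigma>"
      using Plip[of _ _ 1] S by (auto simp: lipschitz_on_def dist_real_def P_def)
    then have "continuous_on {0..L} \<sigma>" by (rule lipschitz_on_continuous_on)
    then obtain x where "x \<in> {0..L}" "\<And>s. s \<in> {0..L} \<Longrightarrow> \<sigma> x \<le> \<sigma> s"
      using continuous_attains_inf[of "{0..L}" \<sigma>] L by auto
    then show thesis using that \<sigma>(1) by blast
  qed

  have grid: "real j * mesh n \<in> {0..L}" "(real j - 1) * mesh n \<in> {0..L}" 
    "real j * mesh n - (real j - 1) * mesh n = mesh n"
    if "j \<in> {1..n}" for j n
  proof -
    have n: "n \<ge> 1" using that by auto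
    have "0 \<le> real j" "real j \<le> real n" "0 \<le> real j - 1" "real j - 1 \<le> real n" using that by auto
    moreover have "x * mesh n \<in> {0..L}" if "0 \<le> x" "x \<le> real n" for x
    proof -
      have "x * mesh n \<le> real n * mesh n" using that mesh_pos[OF n] by (intro mult_right_mono) auto
      then show ?thesis using n_mesh[OF n] mesh_pos[OF n] that by simp
    qed
    ultimately show "real j * mesh n \<in> {0..L}" "(real j - 1) * mesh n \<in> {0..L}" by blast+
    show "real j * mesh n - (real j - 1) * mesh n = mesh n" by (simp add: left_diff_distrib)
  qed

  \<comment> \<open>Second moments of scaled increments\<close>
  have I_span: "I k n j \<in> gaussian_span Z" if "k \<in> {1, 2}" for k n j
  proof -
    have "I k n j = (\<lambda>w. P k (real j * mesh n) * Z k (real j * mesh n) w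
       + (- P k ((real j - 1) * mesh n)) * Z k ((real j - 1) * mesh n) w)"
      by (simp add: I_def fun_eq_iff)
    then show ?thesis
      by (simp only:) (intro gaussian_span_add gaussian_span_scale gaussian_span_base that)
  qed
  have I_int: "integrable M (\<lambda>w. I k n j w * I l n m w)" if "k \<in> {1, 2}" "l \<in> {1, 2}" for k l n j m
    using that by (intro normal_rv_mult_integrable spanN I_span)
  have I_comb: "normal_rv M (\<lambda>w. \<Sum>j\<in>J. a j * I k n j w + b j * I l n j w)"
    if "k \<in> {1, 2}" "l \<in> {1, 2}" for a b k l n J
    by (intro spanN gaussian_span_sum gaussian_span_add gaussian_span_scale I_span that)
  have [measurable]: "I 1 n j \<in> borel_measurable M" "I 2 n j \<in> borel_measurable M" for n j
    using spanN[OF I_span] by (auto simp: normal_rv_def)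

  have E_I: "?q k l n j m =
     P k (real j * mesh n) * P l (real m * mesh n) * R k l ((real j - real m) * mesh n)
   - P k (real j * mesh n) * P l ((real m - 1) * mesh n) * R k l ((real j - (real m - 1)) * mesh n)
   - P k ((real j - 1) * mesh n) * P l (real m * mesh n) * R k l ((real j - 1 - real m) * mesh n)
   + P k ((real j - 1) * mesh n) * P l ((real m - 1) * mesh n) * R k l ((real j - 1 - (real m - 1)) * mesh n)"
    if kl: "k \<in> {1, 2}" "l \<in> {1, 2}" for k l n j m
  proof -
    let ?h = "mesh n"
    let ?a = "P k (real j * ?h)" and ?a' = "P k ((real j - 1) * ?h)"
      and ?b = "P l (real m * ?h)" and ?b' = "P l ((real m - 1) * ?h)"
    have "I k n j w * I l n m w =
       ?a * ?b * (Z k (real j * ?h) w * Z l (real m * ?h) w)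
       - ?a * ?b' * (Z k (real j * ?h) w * Z l ((real m - 1) * ?h) w)
       - ?a' * ?b * (Z k ((real j - 1) * ?h) w * Z l (real m * ?h) w)
       + ?a' * ?b' * (Z k ((real j - 1) * ?h) w * Z l ((real m - 1) * ?h) w)" for w
      unfolding I_def by algebra
    then show ?thesis
      using int2[OF kl] by (simp add: E2[OF kl] R_def left_diff_distrib)
  qed

  have bound: "\<exists>C>0. \<forall>n. \<forall>j\<in>{1..n}. \<forall>m\<in>{1..n}. \<bar>?q k l n j m\<bar>
      \<le> C * (?wt \<gamma> n j m)"
    if kl: "k \<in> {1, 2}" "l \<in> {1, 2}" and \<gamma>: "\<gamma> \<le> \<alpha> k l" "\<gamma> \<le> 2" for k l \<gamma>
  proof -
    obtain C where C: "C > 0"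
      "\<And>n j m s s' r r' h. h = L / real n \<Longrightarrow> j \<in> {1..n} \<Longrightarrow> m \<in> {1..n} \<Longrightarrow>
       \<bar>s'\<bar> \<le> S \<Longrightarrow> \<bar>r'\<bar> \<le> S \<Longrightarrow> \<bar>s - s'\<bar> \<le> S * h \<Longrightarrow> \<bar>r - r'\<bar> \<le> S * h \<Longrightarrow>
       \<bar>s * r * R k l ((real j - real m) * h) - s * r' * R k l ((real j - (real m - 1)) * h)
         - s' * r * R k l ((real j - 1 - real m) * h) + s' * r' * R k l ((real j - 1 - (real m - 1)) * h)\<bar>
       \<le> C * (h\<^sup>2 * ((\<bar>real j - real m\<bar> + 1) * h) powr (\<gamma> - 2))"
      by (rule condition_A_scaled_increment_bound[OF L RA[OF kl] \<gamma> S]; rule that; assumption)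
    have "\<bar>?q k l n j m\<bar>
      \<le> C * (?wt \<gamma> n j m)"
      if jm: "j \<in> {1..n}" "m \<in> {1..n}" for n j m
      unfolding E_I[OF kl]
    proof (rule C(2)[OF mesh_def jm])
      have "mesh n \<ge> 0" using mesh_pos[of n] jm by auto
      then show "\<bar>P k (real j * mesh n) - P k ((real j - 1) * mesh n)\<bar> \<le> S * mesh n"
        "\<bar>P l (real m * mesh n) - P l ((real m - 1) * mesh n)\<bar> \<le> S * mesh n"
        using Plip[OF grid(1,2)[OF jm(1)], of k] Plip[OF grid(1,2)[OF jm(2)], of l]
        unfolding grid(3)[OF jm(1)] grid(3)[OF jm(2)] by simp_all
    qed (use Pb grid jm in blast)+
    with C(1) show ?thesis by blast
  qed

  \<comment> \<open>Choice of exponents\<close>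
  define a where "a = \<alpha> 1 1"
  have "\<alpha> 2 2 > 0" "\<alpha> 1 1 > 0" using A[of 2 2] A[of 1 1] unfolding condition_A_def by auto
  \<comment> \<open>\<open>g\<close> is the total exponent of each product of two covariance bounds.
    The lower limit makes the double sum negligible against the squared mean of the denominator, and
    g < 3 makes the lag sum linear in n. The other limits allow the splittings a + (g - a) and g / 2
    + g / 2: each part must exceed neither the exponent of its covariance nor 2.\<close>
  obtain g where g: "2 * a - 1 < g" "g < a + \<alpha> 2 2" "g < a + 2" "g < 2 * a" "g < 3"
  proof -
    have "2 * a - 1 < min (min (a + \<alpha> 2 2) (a + 2)) (min (2 * a) 3)" using \<alpha> by (auto simp: a_def)
    from dense[OF this] show thesis using that by auto
  qed
  \<comment> \<open>The mean of the numerator involves lag 0 only, so its exponent is not lowered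
    towards \<open>g\<close> but merely capped at 2. Its ratio to the mean of the denominator will
    be of order h^(d - a).\<close>
  define d where "d = min (\<alpha> 1 2) 2"
  have d: "d > a" using \<alpha> by (simp add: d_def a_def)
  obtain C1 where C1: "C1 > 0" "\<And>n j m. j \<in> {1..n} \<Longrightarrow> m \<in> {1..n} \<Longrightarrow> \<bar>?q 1 1 n j m\<bar>
      \<le> C1 * (?wt a n j m)"
    using bound[of 1 1 a] \<alpha> by (auto simp: a_def)
  obtain C2 where C2: "C2 > 0" "\<And>n j m. j \<in> {1..n} \<Longrightarrow> m \<in> {1..n} \<Longrightarrow> \<bar>?q 2 2 n j m\<bar>
      \<le> C2 * (?wt (g - a) n j m)"
    using bound[of 2 2 "g - a"] g by auto
  obtain C3 where C3: "C3 > 0" "\<And>n j m. j \<in> {1..n} \<Longrightarrow> m \<in> {1..n} \<Longrightarrow> \<bar>?q 1 2 n j m\<bar>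
      \<le> C3 * (?wt (g / 2) n j m)"
    using bound[of 1 2 "g / 2"] g \<alpha> by (auto simp: a_def)
  obtain C4 where C4: "C4 > 0" "\<And>n j m. j \<in> {1..n} \<Longrightarrow> m \<in> {1..n} \<Longrightarrow> \<bar>?q 1 2 n j m\<bar>
      \<le> C4 * (?wt d n j m)"
    using bound[of 1 2 d] by (auto simp: d_def)
  obtain C5 where C5: "C5 > 0" "\<And>n j m. j \<in> {1..n} \<Longrightarrow> m \<in> {1..n} \<Longrightarrow> \<bar>?q 1 1 n j m\<bar>
      \<le> C5 * (?wt (g / 2) n j m)"
    using bound[of 1 1 "g / 2"] g \<alpha> by (auto simp: a_def)
  obtain Cs where Cs: "Cs > 0" "\<And>n. (\<Sum>j=1..n. \<Sum>k=1..n. (\<bar>real j - real k\<bar> + 1) powr (g - 4)) \<le> Cs * real n"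
    using lag_sum_bound[of "g - 4"] g by auto

  text \<open>Products of two covariance bounds have the common exponent \<open>g < 3\<close>, which makes the double
    sum over lags linear in \<open>n\<close>.\<close>
  have dbl: "(\<Sum>j=1..n. \<Sum>k=1..n. u j k * v j k) \<le> C * C' * Cs * mesh n powr g * real n"
    if u: "\<And>j k. j \<in> {1..n} \<Longrightarrow> k \<in> {1..n} \<Longrightarrow> \<bar>u j k\<bar>
        \<le> C * (?wt x n j k)"
      and v: "\<And>j k. j \<in> {1..n} \<Longrightarrow> k \<in> {1..n} \<Longrightarrow> \<bar>v j k\<bar>
        \<le> C' * (?wt y n j k)"
      and xy: "x + y = g" and C: "C > 0" "C' > 0" and n: "n \<ge> 1"
    for u v :: "nat \<Rightarrow> nat \<Rightarrow> real" and C C' x y n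
  proof -
    define h where "h = mesh n"
    have h: "h > 0" using mesh_pos n by (simp add: h_def)
    have "(\<Sum>j=1..n. \<Sum>k=1..n. u j k * v j k)
       \<le> (\<Sum>j=1..n. \<Sum>k=1..n. C * C' * h powr g * (\<bar>real j - real k\<bar> + 1) powr (g - 4))"
    proof (intro sum_mono)
      fix j k assume jk: "j \<in> {1..n}" "k \<in> {1..n}"
      define T where "T = \<bar>real j - real k\<bar> + 1"
      have T: "T > 0" by (simp add: T_def)
      have "u j k * v j k \<le> \<bar>u j k\<bar> * \<bar>v j k\<bar>" by (metis abs_ge_self abs_mult)
      also have "\<dots> \<le> (C * (h\<^sup>2 * (T * h) powr (x - 2))) * (C' * (h\<^sup>2 * (T * h) powr (y - 2)))"
        using u[OF jk] v[OF jk] C by (intro mult_mono) (auto simp: h_def T_def)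
      also have "\<dots> = C * C' * (h ^ 4 * ((T * h) powr (x - 2) * (T * h) powr (y - 2)))"
        by (simp add: power2_eq_square power4_eq_xxxx mult_ac)
      also have "(T * h) powr (x - 2) * (T * h) powr (y - 2) = (T * h) powr (g - 4)"
        using xy by (simp add: powr_add[symmetric] algebra_simps)
      also have "h ^ 4 * (T * h) powr (g - 4) = h powr g * T powr (g - 4)"
        using h T by (simp add: powr_mult powr_diff powr_numeral)
      finally show "u j k * v j k \<le> C * C' * h powr g * (\<bar>real j - real k\<bar> + 1) powr (g - 4)"
        by (simp add: T_def mult_ac)
    qed
    also have "\<dots> = C * C' * h powr g * (\<Sum>j=1..n. \<Sum>k=1..n. (\<bar>real j - real k\<bar> + 1) powr (g - 4))"
      by (simp add: sum_distrib_left)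
    also have "\<dots> \<le> C * C' * h powr g * (Cs * real n)"
      using C by (intro mult_left_mono Cs(2)) auto
    finally show ?thesis by (simp add: h_def mult_ac)
  qed

  \<comment> \<open>Numerator and denominator of the estimation error\<close>
  define N where "N n w = (\<Sum>j=1..n. I 1 n j w * I 2 n j w)" for n w
  define D where "D n w = (\<Sum>j=1..n. I 1 n j w * I 1 n j w)" for n w
  have [measurable]: "N n \<in> borel_measurable M" "D n \<in> borel_measurable M" for n
    unfolding N_def D_def by measurable

  have EN: "integrable M (\<lambda>w. (N n w)\<^sup>2)"
    "expectation (\<lambda>w. (N n w)\<^sup>2) \<le> (real n * (C4 * mesh n powr d))\<^sup>2
        + (C1 * C2 + C3 * C3) * Cs * mesh n powr g * real n" if n: "n \<ge> 1" for n
  proof -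
    have lin: "normal_rv M (\<lambda>w. \<Sum>j\<in>{1..n}. a j * I 1 n j w + b j * I 2 n j w)" for a b
      by (rule I_comb) auto
    note bil = gaussian_bilinear_second_moment[of "{1..n}" "I 1 n" "I 2 n", OF _ lin]
    show "integrable M (\<lambda>w. (N n w)\<^sup>2)" unfolding N_def by (rule bil) auto
    have "expectation (\<lambda>w. (N n w)\<^sup>2) \<le> (\<Sum>j=1..n. ?q 1 2 n j j)\<^sup>2
      + (\<Sum>j=1..n. \<Sum>k=1..n. ?q 1 1 n j k * ?q 2 2 n j k
          + ?q 1 2 n j k * ?q 2 1 n j k)"
      unfolding N_def by (subst bil(2)) auto
    also have "\<dots> \<le> (real n * (C4 * mesh n powr d))\<^sup>2
       + (C1 * C2 * Cs * mesh n powr g * real n + C3 * C3 * Cs * mesh n powr g * real n)"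
      unfolding sum.distrib
    proof (intro add_mono)
      have "\<bar>\<Sum>j=1..n. ?q 1 2 n j j\<bar> \<le> (\<Sum>j=1..n. C4 * mesh n powr d)"
      proof (rule order.trans[OF sum_abs sum_mono])
        fix j assume j: "j \<in> {1..n}"
        have "(mesh n)\<^sup>2 * mesh n powr (d - 2) = mesh n powr d"
          using mesh_pos[OF n] by (simp add: powr_diff powr_numeral)
        then show "\<bar>?q 1 2 n j j\<bar> \<le> C4 * mesh n powr d"
          using C4(2)[OF j j] by simp
      qed
      then have "\<bar>\<Sum>j=1..n. ?q 1 2 n j j\<bar> \<le> real n * (C4 * mesh n powr d)"
        by simp
      from power_mono[OF this abs_ge_zero, of 2]
      show "(\<Sum>j=1..n. ?q 1 2 n j j)\<^sup>2 \<le> (real n * (C4 * mesh n powr d))\<^sup>2"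
        by simp
      show "(\<Sum>j=1..n. \<Sum>k=1..n. ?q 1 1 n j k * ?q 2 2 n j k)
         \<le> C1 * C2 * Cs * mesh n powr g * real n"
        by (rule dbl[OF C1(2) C2(2)]) (use C1 C2 n in auto)
      \<comment> \<open>Exchanging the two factors and the two steps reduces the index pair (2, 1)
        to (1, 2), whose exponent is the one constrained.\<close>
      have C3': "\<bar>?q 2 1 n j m\<bar>
         \<le> C3 * (?wt (g / 2) n j m)"
        if "j \<in> {1..n}" "m \<in> {1..n}" for j m
        using C3(2)[OF that(2,1)] by (simp add: mult.commute abs_minus_commute)
      show "(\<Sum>j=1..n. \<Sum>k=1..n. ?q 1 2 n j k * ?q 2 1 n j k)
         \<le> C3 * C3 * Cs * mesh n powr g * real n"
        by (rule dbl[OF C3(2) C3']) (use C3 n in auto)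
    qed
    finally show "expectation (\<lambda>w. (N n w)\<^sup>2) \<le> (real n * (C4 * mesh n powr d))\<^sup>2
        + (C1 * C2 + C3 * C3) * Cs * mesh n powr g * real n" by (simp add: algebra_simps)
  qed

  have VD: "integrable M (\<lambda>w. (D n w)\<^sup>2)" "variance (D n) \<le> 2 * (C5 * C5 * Cs * mesh n powr g * real n)"
    if n: "n \<ge> 1" for n
  proof -
    have lin: "normal_rv M (\<lambda>w. \<Sum>j\<in>{1..n}. a j * I 1 n j w + b j * I 1 n j w)" for a b
      by (rule I_comb) auto
    note bil = gaussian_bilinear_second_moment[of "{1..n}" "I 1 n" "I 1 n", OF _ lin]
    show D2: "integrable M (\<lambda>w. (D n w)\<^sup>2)" unfolding D_def by (rule bil) auto
    have iD: "integrable M (D n)" unfolding D_def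
      by (intro Bochner_Integration.integrable_sum I_int) auto
    have ED: "expectation (D n) = (\<Sum>j=1..n. ?q 1 1 n j j)"
      unfolding D_def by (intro Bochner_Integration.integral_sum I_int) auto
    have "variance (D n) = expectation (\<lambda>w. (D n w)\<^sup>2) - (expectation (D n))\<^sup>2"
      by (rule variance_eq[OF iD D2])
    also have "\<dots> \<le> (\<Sum>j=1..n. \<Sum>k=1..n. ?q 1 1 n j k * ?q 1 1 n j k
          + ?q 1 1 n j k * ?q 1 1 n j k)"
      unfolding ED unfolding D_def by (subst bil(2)) auto
    also have "\<dots> \<le> C5 * C5 * Cs * mesh n powr g * real n + C5 * C5 * Cs * mesh n powr g * real n"
      unfolding sum.distrib by (intro add_mono; rule dbl[OF C5(2) C5(2)]) (use C5 n in auto)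
    finally show "variance (D n) \<le> 2 * (C5 * C5 * Cs * mesh n powr g * real n)" by linarith
  qed

  \<comment> \<open>Lower bound for the mean of the denominator\<close>
  have R11: "condition_A L (c 1 1) (\<alpha> 1 1) (R 1 1)" by (rule RA) auto
  have Rle: "R 1 1 h \<le> R 1 1 0" for h
  proof -
    have "0 \<le> expectation (\<lambda>w. (Z 1 h w - Z 1 0 w)\<^sup>2)" by simp
    also have "\<dots> = expectation (\<lambda>w. Z 1 h w * Z 1 h w - 2 * (Z 1 h w * Z 1 0 w) + Z 1 0 w * Z 1 0 w)"
      by (simp add: power2_eq_square algebra_simps)
    also have "\<dots> = 2 * R 1 1 0 - 2 * R 1 1 h"
      using int2[of 1 1] E2[of 1 1] by (simp add: R_def)
    finally show ?thesis by simp
  qed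
  have R0: "R 1 1 0 \<ge> 0"
  proof -
    have "0 \<le> expectation (\<lambda>w. Z 1 0 w * Z 1 0 w)" by simp
    also have "\<dots> = R 1 1 0" using E2[of 1 1 0 0] by (simp add: R_def)
    finally show ?thesis .
  qed
  obtain c0 h0 where c0: "c0 > 0" "h0 > 0" "\<And>h. 0 < h \<Longrightarrow> h < h0 \<Longrightarrow> c0 * h powr a \<le> R 1 1 0 - R 1 1 h"
    by (rule condition_A_variogram_lower[OF L R11 \<alpha>(3) c Rle, folded a_def]; rule that; assumption)
  \<comment> \<open>Half of the lower bound for the mean of the denominator: the denominator can be
    at most \<open>m n\<close> only if it deviates from its mean by at least
    \<open>m n\<close>.\<close>
  define m where "m n = real n * (s0\<^sup>2 * c0 * mesh n powr a)" for n
  have ED: "2 * m n \<le> expectation (D n)" if n: "n \<ge> 1" "mesh n < h0" for n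
  proof -
    let ?h = "mesh n"
    have h: "?h > 0" and hL: "?h \<in> {-L..L}" using mesh_pos[OF n(1)] mesh_le[OF n(1)] L by auto
    have ev: "R 1 1 (- ?h) = R 1 1 ?h"
      by (rule condition_A_cases[OF L R11]) (use hL in blast)
    have "2 * (s0\<^sup>2 * c0 * ?h powr a) \<le> ?q 1 1 n j j" if j: "j \<in> {1..n}" for j
    proof -
      let ?s = "\<sigma> (real j * ?h)" and ?s' = "\<sigma> ((real j - 1) * ?h)"
      \<comment> \<open>The change of scale adds a square times the raw second moment at lag 0,
        which is nonnegative, so it cannot lower the mean.\<close>
      have "?q 1 1 n j j =
          2 * (?s * ?s') * (R 1 1 0 - R 1 1 ?h) + (?s - ?s')\<^sup>2 * R 1 1 0"
        using E_I[of 1 1 n j j] ev by (simp add: P_def power2_eq_square algebra_simps)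
      moreover have "(?s - ?s')\<^sup>2 * R 1 1 0 \<ge> 0" using R0 by simp
      moreover have "2 * (s0 * s0) * (c0 * ?h powr a) \<le> 2 * (?s * ?s') * (R 1 1 0 - R 1 1 ?h)"
        using s0 grid[OF j] c0 h n less_imp_le[OF \<sigma>(1)]
        by (intro mult_mono c0) (auto intro!: mult_mono mult_nonneg_nonneg)
      ultimately show ?thesis by (simp add: power2_eq_square mult.assoc)
    qed
    then have "(\<Sum>j=1..n. 2 * (s0\<^sup>2 * c0 * ?h powr a)) \<le> (\<Sum>j=1..n. ?q 1 1 n j j)"
      by (intro sum_mono) auto
    also have "\<dots> = expectation (D n)"
      unfolding D_def by (intro Bochner_Integration.integral_sum[symmetric] I_int) auto
    finally show ?thesis by (simp add: m_def mult_ac)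
  qed

  have ols: "first_difference_ols L X (response \<beta> X W) n w = (\<beta> * D n w + N n w) / D n w" for n w
  proof -
    have "first_difference_ols L X (response \<beta> X W) n w
       = (\<Sum>j=1..n. I 1 n j w * (I 1 n j w * \<beta> + I 2 n j w)) / (\<Sum>j=1..n. (I 1 n j w)\<^sup>2)"
      unfolding first_difference_ols_def Let_def response_def X_def W_def I_def P_def mesh_def
      by (simp add: algebra_simps)
    also have "(\<Sum>j=1..n. (I 1 n j w)\<^sup>2) = D n w" by (simp add: D_def power2_eq_square)
    also have "(\<Sum>j=1..n. I 1 n j w * (I 1 n j w * \<beta> + I 2 n j w)) = \<beta> * D n w + N n w"
      by (simp add: D_def N_def sum.distrib sum_distrib_left algebra_simps)
    finally show ?thesis .
  qed

  \<comment> \<open>Chebyshev's inequality and the limit\<close>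
  show ?thesis
    unfolding converges_in_prob_def
  proof (intro allI impI)
    fix \<epsilon> :: real assume \<epsilon>: "\<epsilon> > 0"
    \<comment> \<open>\<open>A1\<close> and \<open>A2\<close> arise from dividing the bounds on the
      variance of \<open>D n\<close> and on the second moment of \<open>N n\<close> by the squares
      of m n and \<epsilon> m n, with n replaced by L / h. The factor 1 / n left over after
      cancellation supplies the extra 1 in the exponent g - 2 a + 1.\<close>
    define A1 where "A1 = 2 * (C5 * C5 * Cs) / (s0\<^sup>2 * c0)\<^sup>2 / L + (C1 * C2 + C3 * C3) * Cs / (\<epsilon> * (s0\<^sup>2 * c0))\<^sup>2 / L"
    define A2 where "A2 = (C4 / (\<epsilon> * (s0\<^sup>2 * c0)))\<^sup>2"
    have main: "measure M {w \<in> space M. \<bar>first_difference_ols L X (response \<beta> X W) n w - \<beta>\<bar> > \<epsilon>}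
        \<le> A1 * mesh n powr (g - 2 * a + 1) + A2 * mesh n powr (2 * (d - a))"
      if n: "n \<ge> 1" "mesh n < h0" for n
    proof -
      define h where "h = mesh n"
      have h: "h > 0" using mesh_pos n by (simp add: h_def)
      have nh: "real n = L / h" using n_mesh[OF n(1)] h by (simp add: h_def field_simps)
      have m: "m n > 0" using s0 c0 h n by (auto simp: m_def h_def)
      have "measure M {w \<in> space M. \<bar>first_difference_ols L X (response \<beta> X W) n w - \<beta>\<bar> > \<epsilon>}
        \<le> measure M ({w \<in> space M. m n \<le> \<bar>D n w - expectation (D n)\<bar>} \<union> {w \<in> space M. (\<epsilon> * m n)\<^sup>2 \<le> (N n w)\<^sup>2})"
      proof (intro finite_measure_mono subsetI)
        fix w assume w: "w \<in> {w \<in> space M. \<bar>first_difference_ols L X (response \<beta> X W) n w - \<beta>\<bar> > \<epsilon>}"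
        show "w \<in> {w \<in> space M. m n \<le> \<bar>D n w - expectation (D n)\<bar>} \<union> {w \<in> space M. (\<epsilon> * m n)\<^sup>2 \<le> (N n w)\<^sup>2}"
        proof (cases "D n w \<le> m n")
          case True
          then have "m n \<le> \<bar>D n w - expectation (D n)\<bar>" using ED[OF n] by linarith
          then show ?thesis using w by auto
        next
          case False
          then have Dp: "D n w > 0" using m by linarith
          have "\<epsilon> < \<bar>N n w\<bar> / D n w" using w Dp by (simp add: ols add_divide_distrib abs_divide)
          then have "\<epsilon> * D n w < \<bar>N n w\<bar>" using Dp by (simp add: pos_less_divide_eq)
          moreover have "\<epsilon> * m n \<le> \<epsilon> * D n w" using False \<epsilon> by (intro mult_left_mono) auto
          ultimately have "\<epsilon> * m n \<le> \<bar>N n w\<bar>" by linarith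
          then have "(\<epsilon> * m n)\<^sup>2 \<le> \<bar>N n w\<bar>\<^sup>2" using \<epsilon> m by (intro power_mono) auto
          then show ?thesis using w by auto
        qed
      qed measurable
      also have "\<dots> \<le> measure M {w \<in> space M. m n \<le> \<bar>D n w - expectation (D n)\<bar>}
           + measure M {w \<in> space M. (\<epsilon> * m n)\<^sup>2 \<le> (N n w)\<^sup>2}"
        by (rule measure_Un_le) measurable
      also have "\<dots> \<le> variance (D n) / (m n)\<^sup>2 + expectation (\<lambda>w. (N n w)\<^sup>2) / (\<epsilon> * m n)\<^sup>2"
      proof (intro add_mono)
        show "measure M {w \<in> space M. m n \<le> \<bar>D n w - expectation (D n)\<bar>} \<le> variance (D n) / (m n)\<^sup>2"
          by (rule Chebyshev_inequality) (use VD[OF n(1)] m in auto)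
        show "measure M {w \<in> space M. (\<epsilon> * m n)\<^sup>2 \<le> (N n w)\<^sup>2} \<le> expectation (\<lambda>w. (N n w)\<^sup>2) / (\<epsilon> * m n)\<^sup>2"
          using integral_Markov_inequality_measure[OF EN(1)[OF n(1)], of "space M" "(\<epsilon> * m n)\<^sup>2"] m \<epsilon> by auto
      qed
      also have "\<dots> \<le> 2 * (C5 * C5 * Cs * h powr g * real n) / (m n)\<^sup>2
          + ((real n * (C4 * h powr d))\<^sup>2 + (C1 * C2 + C3 * C3) * Cs * h powr g * real n) / (\<epsilon> * m n)\<^sup>2"
        using VD(2)[OF n(1)] EN(2)[OF n(1)] unfolding h_def by (intro add_mono divide_right_mono) auto
      also have "\<dots> = A1 * h powr (g - 2 * a + 1) + A2 * h powr (2 * (d - a))"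
      proof -
        have p: "h powr (g - 2 * a + 1) = h * h powr g / (h powr a)\<^sup>2"
          "h powr (2 * (d - a)) = (h powr d / h powr a)\<^sup>2"
          using h by (simp_all add: powr_diff powr_add power2_eq_square powr_add[symmetric] mult_2 algebra_simps)
        show ?thesis unfolding p A1_def A2_def m_def h_def[symmetric] nh using h L \<epsilon> s0 c0
          by (simp add: power_mult_distrib power_divide add_divide_distrib)
            (simp add: field_simps power2_eq_square)
      qed
      finally show ?thesis unfolding h_def .
    qed
    have hlim: "(\<lambda>n. mesh n) \<longlonglongrightarrow> 0" unfolding mesh_def by (rule lim_const_over_n)
    have "(\<lambda>n. A1 * mesh n powr (g - 2 * a + 1) + A2 * mesh n powr (2 * (d - a))) \<longlonglongrightarrow> A1 * 0 + A2 * 0"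
      using L g d by (intro tendsto_intros tendsto_zero_powrI[OF hlim tendsto_const])
        (auto simp: mesh_def)
    then have up: "(\<lambda>n. A1 * mesh n powr (g - 2 * a + 1) + A2 * mesh n powr (2 * (d - a))) \<longlonglongrightarrow> 0"
      by simp
    have "\<forall>\<^sub>F n in sequentially. measure M {w \<in> space M. \<bar>first_difference_ols L X (response \<beta> X W) n w - \<beta>\<bar> > \<epsilon>}
        \<le> A1 * mesh n powr (g - 2 * a + 1) + A2 * mesh n powr (2 * (d - a))"
      using order_tendstoD(2)[OF hlim c0(2)] eventually_ge_at_top[of 1]
      by eventually_elim (rule main)
    then show "(\<lambda>n. measure M {w \<in> space M. \<bar>first_difference_ols L X (response \<beta> X W) n w - \<beta>\<bar> > \<epsilon>}) \<longlonglongrightarrow> 0"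
      by (intro tendsto_sandwich[OF _ _ tendsto_const up]) auto
  qed
qed

lemma ols_consistent:
  assumes L: "L > 0" and set: "confounding_setting L \<alpha> c K M Z \<sigma>X \<sigma>W"
    and \<alpha>: "\<alpha> 1 1 < \<alpha> 1 2" "\<alpha> 1 1 < \<alpha> 2 2 + 1" "\<alpha> 1 1 < 2"
  shows "converges_in_prob M
    (first_difference_ols L (scaled \<sigma>X (Z 1)) (response \<beta> (scaled \<sigma>X (Z 1)) (scaled \<sigma>W (Z 2)))) \<beta>"
proof -
  have Z: "stationary_gaussian_field M Z K"
    and A: "\<And>k l. k \<in> {1, 2} \<Longrightarrow> l \<in> {1, 2} \<Longrightarrow> condition_A L (c k l) (\<alpha> k l) (K k l)"
    and c: "c 1 1 \<noteq> 0" and sc: "scale_processes L M Z \<sigma>X \<sigma>W"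
    using set unfolding confounding_setting_def by blast+
  from Z interpret prob_space M unfolding stationary_gaussian_field_def by blast
  let ?S = "\<Pi>\<^sub>M s\<in>UNIV. (borel :: (real \<times> real) measure)"
  define Zp where "Zp w = (\<lambda>s. (Z 1 s w, Z 2 s w))" for w
  define Sp where "Sp w = (\<lambda>s. (\<sigma>X s w, \<sigma>W s w))" for w
  have pos: "\<And>w s. w \<in> space M \<Longrightarrow> \<sigma>X s w > 0"
    and ind: "indep_var ?S Zp ?S Sp"
    and pa: "AE w in M. piecewise_analytic L (\<lambda>s. \<sigma>X s w) \<and> piecewise_analytic L (\<lambda>s. \<sigma>W s w)"
    using sc unfolding scale_processes_def Zp_def Sp_def by auto
  have Zp[measurable]: "Zp \<in> measurable M ?S" and Sp[measurable]: "Sp \<in> measurable M ?S"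
    using ind by (auto dest: indep_var_rv1 indep_var_rv2)
  have prod: "distr M ?S Zp \<Otimes>\<^sub>M distr M ?S Sp = distr M (?S \<Otimes>\<^sub>M ?S) (\<lambda>w. (Zp w, Sp w))"
    using ind by (simp add: indep_var_distribution_eq)
  interpret DZ: prob_space "distr M ?S Zp" by (rule prob_space_distr) measurable
  interpret DS: prob_space "distr M ?S Sp" by (rule prob_space_distr) measurable
  interpret ZS: pair_prob_space "distr M ?S Zp" "distr M ?S Sp" ..

  \<comment> \<open>The estimator as a function of the pair of paths. It reads finitely many
    coordinates for each n, so it is measurable for the product \<sigma>-algebra.\<close>
  define \<Phi> where "\<Phi> n p = first_difference_ols L (\<lambda>s p. fst (snd p s) * fst (fst p s))
     (response \<beta> (\<lambda>s p. fst (snd p s) * fst (fst p s)) (\<lambda>s p. snd (snd p s) * snd (fst p s))) n p"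
    for n and p :: "(real \<Rightarrow> real \<times> real) \<times> (real \<Rightarrow> real \<times> real)"
  have \<Phi>: "\<Phi> n (Zp w, Sp w') = first_difference_ols L (\<lambda>s w. \<sigma>X s w' * Z 1 s w)
     (response \<beta> (\<lambda>s w. \<sigma>X s w' * Z 1 s w) (\<lambda>s w. \<sigma>W s w' * Z 2 s w)) n w" for n w w'
    by (simp add: \<Phi>_def first_difference_ols_def response_def Zp_def Sp_def)
  have ols: "first_difference_ols L (scaled \<sigma>X (Z 1)) (response \<beta> (scaled \<sigma>X (Z 1)) (scaled \<sigma>W (Z 2))) n w
     = \<Phi> n (Zp w, Sp w)" for n w
    unfolding \<Phi> by (simp add: first_difference_ols_def response_def scaled_def)
  have [measurable]: "(\<lambda>p. fst (fst p s)) \<in> borel_measurable (?S \<Otimes>\<^sub>M ?S)"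
      "(\<lambda>p. snd (fst p s)) \<in> borel_measurable (?S \<Otimes>\<^sub>M ?S)"
      "(\<lambda>p. fst (snd p s)) \<in> borel_measurable (?S \<Otimes>\<^sub>M ?S)"
      "(\<lambda>p. snd (snd p s)) \<in> borel_measurable (?S \<Otimes>\<^sub>M ?S)" for s
  proof -
    have 1: "(\<lambda>p. fst p s) \<in> borel_measurable (?S \<Otimes>\<^sub>M ?S)" "(\<lambda>p. snd p s) \<in> borel_measurable (?S \<Otimes>\<^sub>M ?S)"
      by (rule measurable_compose[OF measurable_fst measurable_component_singleton], simp)
        (rule measurable_compose[OF measurable_snd measurable_component_singleton], simp)
    have 2: "fst \<in> borel_measurable (borel :: (real \<times> real) measure)" "snd \<in> borel_measurable (borel :: (real \<times> real) measure)"
      by (simp_all add: borel_prod[symmetric])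
    note 3 = measurable_compose[OF 1(1) 2(1)] measurable_compose[OF 1(1) 2(2)]
      measurable_compose[OF 1(2) 2(1)] measurable_compose[OF 1(2) 2(2)]
    show "(\<lambda>p. fst (fst p s)) \<in> borel_measurable (?S \<Otimes>\<^sub>M ?S)"
      "(\<lambda>p. snd (fst p s)) \<in> borel_measurable (?S \<Otimes>\<^sub>M ?S)"
      "(\<lambda>p. fst (snd p s)) \<in> borel_measurable (?S \<Otimes>\<^sub>M ?S)"
      "(\<lambda>p. snd (snd p s)) \<in> borel_measurable (?S \<Otimes>\<^sub>M ?S)" using 3 by simp_all
  qed
  have [measurable]: "\<Phi> n \<in> borel_measurable (?S \<Otimes>\<^sub>M ?S)" for n
    unfolding \<Phi>_def first_difference_ols_def response_def Let_def by measurable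

  show ?thesis
    unfolding converges_in_prob_def
  proof (intro allI impI)
    fix \<epsilon> :: real assume \<epsilon>: "\<epsilon> > 0"
    define B where "B n = {p \<in> space (?S \<Otimes>\<^sub>M ?S). \<bar>\<Phi> n p - \<beta>\<bar> > \<epsilon>}" for n
    have B[measurable]: "B n \<in> sets (?S \<Otimes>\<^sub>M ?S)" for n unfolding B_def by measurable
    \<comment> \<open>\<open>u n w\<close> is the failure probability when the scales are frozen at
      their values for \<open>w\<close> while the field is drawn afresh.\<close>
    define u where "u n w = emeasure M {w' \<in> space M. \<bar>\<Phi> n (Zp w', Sp w) - \<beta>\<bar> > \<epsilon>}" for n w
    have slice: "emeasure (distr M ?S Zp) ((\<lambda>z. (z, Sp w)) -` B n) = u n w" if w: "w \<in> space M" for n w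
    proof -
      have Sw: "Sp w \<in> space ?S" using Sp w by (rule measurable_space)
      have "(\<lambda>z. (z, Sp w)) -` B n \<in> sets ?S"
        using sets_Pair2[OF B] by simp
      then have "emeasure (distr M ?S Zp) ((\<lambda>z. (z, Sp w)) -` B n)
         = emeasure M (Zp -` ((\<lambda>z. (z, Sp w)) -` B n) \<inter> space M)"
        by (rule emeasure_distr[OF Zp])
      also have "Zp -` ((\<lambda>z. (z, Sp w)) -` B n) \<inter> space M = {w' \<in> space M. \<bar>\<Phi> n (Zp w', Sp w) - \<beta>\<bar> > \<epsilon>}"
        using Sw measurable_space[OF Zp] by (auto simp: B_def space_pair_measure)
      finally show ?thesis by (simp add: u_def)
    qed
    have Bm: "B n \<in> sets (distr M ?S Zp \<Otimes>\<^sub>M distr M ?S Sp)" for n unfolding prod by simp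
    have Em: "(\<lambda>y. emeasure (distr M ?S Zp) ((\<lambda>z. (z, y)) -` B n)) \<in> borel_measurable ?S" for n
      using ZS.measurable_emeasure_Pair2[OF Bm[of n]] by simp
    have eq: "emeasure M {w \<in> space M. \<bar>\<Phi> n (Zp w, Sp w) - \<beta>\<bar> > \<epsilon>} = (\<integral>\<^sup>+w. u n w \<partial>M)" for n
    proof -
      have "{w \<in> space M. \<bar>\<Phi> n (Zp w, Sp w) - \<beta>\<bar> > \<epsilon>} = (\<lambda>w. (Zp w, Sp w)) -` B n \<inter> space M"
        using measurable_space[OF Zp] measurable_space[OF Sp] by (auto simp: B_def space_pair_measure)
      also have "emeasure M \<dots> = emeasure (distr M (?S \<Otimes>\<^sub>M ?S) (\<lambda>w. (Zp w, Sp w))) (B n)"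
        by (rule emeasure_distr[symmetric]) measurable
      also have "\<dots> = (\<integral>\<^sup>+y. emeasure (distr M ?S Zp) ((\<lambda>z. (z, y)) -` B n) \<partial>distr M ?S Sp)"
        unfolding prod[symmetric] by (rule ZS.emeasure_pair_measure_alt2) measurable
      \<comment> \<open>Piecewise analyticity holds almost surely under \<open>M\<close> but need
        not be an event of the \<sigma>-algebra on paths. The average over scale paths is therefore
        carried back to \<open>M\<close> before the limit is taken.\<close>
      also have "\<dots> = (\<integral>\<^sup>+w. emeasure (distr M ?S Zp) ((\<lambda>z. (z, Sp w)) -` B n) \<partial>M)"
        by (rule nn_integral_distr[OF Sp]) (use Em in simp)
      also have "\<dots> = (\<integral>\<^sup>+w. u n w \<partial>M)"
        by (rule nn_integral_cong) (rule slice)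
      finally show ?thesis .
    qed
    have um: "u n \<in> borel_measurable M" for n
    proof -
      have "(\<lambda>w. emeasure (distr M ?S Zp) ((\<lambda>z. (z, Sp w)) -` B n)) \<in> borel_measurable M"
        by (rule measurable_compose[OF Sp Em])
      then show ?thesis by (rule measurable_cong[THEN iffD1, rotated]) (rule slice)
    qed
    have "(\<lambda>n. \<integral>\<^sup>+w. u n w \<partial>M) \<longlonglongrightarrow> (\<integral>\<^sup>+w. 0 \<partial>M)"
    proof (rule nn_integral_dominated_convergence[where w = "\<lambda>_. 1"])
      show "AE w in M. (\<lambda>n. u n w) \<longlonglongrightarrow> 0"
        using pa AE_space
      proof eventually_elim
        case (elim w)
        have "converges_in_prob M (first_difference_ols L (\<lambda>s w'. \<sigma>X s w * Z 1 s w')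
           (response \<beta> (\<lambda>s w'. \<sigma>X s w * Z 1 s w') (\<lambda>s w'. \<sigma>W s w * Z 2 s w'))) \<beta>"
          by (rule ols_consistent_fixed_scale[OF L Z A c \<alpha>]) (use elim pos in auto)
        then have "(\<lambda>n. measure M {w' \<in> space M. \<bar>\<Phi> n (Zp w', Sp w) - \<beta>\<bar> > \<epsilon>}) \<longlonglongrightarrow> 0"
          unfolding converges_in_prob_def \<Phi> using \<epsilon> by blast
        then have "(\<lambda>n. ennreal (measure M {w' \<in> space M. \<bar>\<Phi> n (Zp w', Sp w) - \<beta>\<bar> > \<epsilon>})) \<longlonglongrightarrow> ennreal 0"
          by (rule tendsto_ennrealI)
        then show ?case unfolding u_def emeasure_eq_measure by simp
      qed
      show "AE w in M. u n w \<le> 1" for n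
        unfolding u_def using emeasure_le_1 by auto
    qed (use um in \<open>auto simp: emeasure_space_1\<close>)
    then have "(\<lambda>n. ennreal (measure M {w \<in> space M. \<bar>\<Phi> n (Zp w, Sp w) - \<beta>\<bar> > \<epsilon>})) \<longlonglongrightarrow> ennreal 0"
      unfolding emeasure_eq_measure[symmetric] eq by simp
    then have "(\<lambda>n. measure M {w \<in> space M. \<bar>\<Phi> n (Zp w, Sp w) - \<beta>\<bar> > \<epsilon>}) \<longlonglongrightarrow> 0"
      by (subst (asm) tendsto_ennreal_iff) auto
    then show "(\<lambda>n. measure M {w \<in> space M. \<bar>first_difference_ols L (scaled \<sigma>X (Z 1))
        (response \<beta> (scaled \<sigma>X (Z 1)) (scaled \<sigma>W (Z 2))) n w - \<beta>\<bar> > \<epsilon>}) \<longlonglongrightarrow> 0"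
      unfolding ols .
  qed
qed

subsection \<open>Gaussian laws are determined by their covariances\<close>

text \<open>Normalising reduces this to Levy's uniqueness theorem, since the total mass is the value
  of the characteristic function at 0. Finite measures are the right class because the laws compared
  below are weighted or restricted to events.\<close>

lemma finite_measure_char_unique:
  fixes \<mu> \<nu> :: "real measure"
  assumes \<mu>: "finite_measure \<mu>" "sets \<mu> = sets borel" and \<nu>: "finite_measure \<nu>" "sets \<nu> = sets borel"
    and char: "char \<mu> = char \<nu>"
  shows "\<mu> = \<nu>"
proof -
  interpret \<mu>: finite_measure \<mu> by fact
  interpret \<nu>: finite_measure \<nu> by fact
  have sp: "space \<mu> = UNIV" "space \<nu> = UNIV" using sets_eq_imp_space_eq[OF \<mu>(2)] sets_eq_imp_space_eq[OF \<nu>(2)] by auto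
  define m where "m = measure \<mu> UNIV"
  have m: "measure \<nu> UNIV = m"
    using fun_cong[OF char, of 0] by (simp add: char_def m_def sp)
  show ?thesis
  proof (cases "m = 0")
    case True
    have "emeasure \<mu> A = 0" "emeasure \<nu> A = 0" if "A \<in> sets borel" for A
    proof -
      have "measure \<mu> A \<le> measure \<mu> UNIV" "measure \<nu> A \<le> measure \<nu> UNIV"
        using \<mu>.bounded_measure[of A] \<nu>.bounded_measure[of A] by (auto simp: sp)
      then show "emeasure \<mu> A = 0" "emeasure \<nu> A = 0"
        using True m m_def by (simp_all add: \<mu>.emeasure_eq_measure \<nu>.emeasure_eq_measure measure_le_0_iff)
    qed
    then show ?thesis using \<mu>(2) \<nu>(2) by (intro measure_eqI) auto
  next
    case False
    then have mp: "m > 0" by (simp add: m_def zero_less_measure_iff)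
    define P where "P M = density M (\<lambda>_::real. ennreal (1 / m))" for M
    have rd: "real_distribution (P M)" if "finite_measure M" "sets M = sets borel" "measure M UNIV = m" "space M = UNIV" for M
    proof -
      interpret finite_measure M by fact
      have "emeasure (P M) (space (P M)) = ennreal (1 / m) * emeasure M UNIV"
        unfolding P_def using that by (simp add: emeasure_density_const)
      also have "\<dots> = 1" using mp that by (simp add: emeasure_eq_measure ennreal_mult[symmetric])
      finally show ?thesis
        unfolding real_distribution_def real_distribution_axioms_def
        using that by (auto intro!: prob_spaceI simp: P_def)
    qed
    have ch: "char (P M) t = char M t / m" if "sets M = sets borel" for M t
    proof -
      have [measurable_cong]: "sets M = sets borel" by fact
      have "char (P M) t = (CLINT x|M. (1 / m) *\<^sub>R iexp (t * x))"
        unfolding char_def P_def by (subst integral_density) (use mp in auto)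
      then show ?thesis by (simp add: char_def scaleR_conv_of_real)
    qed
    have "P \<mu> = P \<nu>"
      by (rule Levy_uniqueness[OF rd rd]) (use \<mu> \<nu> sp m m_def char ch in \<open>auto simp: fun_eq_iff\<close>)
    have "emeasure \<mu> A = emeasure \<nu> A" if "A \<in> sets borel" for A
    proof -
      have "ennreal (1 / m) * emeasure \<mu> A = ennreal (1 / m) * emeasure \<nu> A"
        using arg_cong[OF \<open>P \<mu> = P \<nu>\<close>, of "\<lambda>M. emeasure M A"] that \<mu>(2) \<nu>(2)
        by (simp add: P_def emeasure_density_const)
      then show ?thesis using mp by (simp add: ennreal_mult_cancel_left)
    qed
    then show ?thesis using \<mu>(2) \<nu>(2) by (intro measure_eqI) auto
  qed
qed

lemma (in finite_measure) integrable_iexp':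
  assumes [measurable]: "V \<in> borel_measurable M"
  shows "integrable M (\<lambda>w. iexp (V w))"
  by (rule integrable_const_bound[where B = 1]) auto

text \<open>Expressing cosine and sine by exponentials turns the weight into a combination of 1,
  iexp v and iexp (- v). The characteristic function of the weighted law of \<open>u\<close> is thus
  made of values of the joint characteristic function at (t, 0), (t, 1) and (t, -1).\<close>

lemma (in finite_measure) trig_weighted_law:
  fixes u v :: "'a \<Rightarrow> real" and g :: "real \<Rightarrow> real" and c d :: real
  assumes [measurable]: "u \<in> borel_measurable M" "v \<in> borel_measurable M"
    and g: "g = (\<lambda>x. 1 + c * cos x + d * sin x)" and nn: "\<And>x. g x \<ge> 0"
  defines "\<mu> \<equiv> distr (density M (\<lambda>w. ennreal (g (v w)))) borel u"
  shows "finite_measure \<mu>"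
    and "A \<in> sets borel \<Longrightarrow> measure \<mu> A = (LINT w|M. indicator A (u w) * g (v w))"
    and "char \<mu> t = (CLINT w|M. iexp (t * u w + 0 * v w))
        + (of_real c / 2 - \<i> * of_real d / 2) * (CLINT w|M. iexp (t * u w + 1 * v w))
        + (of_real c / 2 + \<i> * of_real d / 2) * (CLINT w|M. iexp (t * u w + (- 1) * v w))"
proof -
  have [measurable]: "g \<in> borel_measurable borel" unfolding g by measurable
  have bound: "\<bar>g x\<bar> \<le> 1 + \<bar>c\<bar> + \<bar>d\<bar>" for x
  proof -
    have "\<bar>c * cos x\<bar> \<le> \<bar>c\<bar> * 1" "\<bar>d * sin x\<bar> \<le> \<bar>d\<bar> * 1" unfolding abs_mult by (intro mult_left_mono; simp)+
    then show ?thesis unfolding g by linarith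
  qed
  have gi: "of_real (g x) = 1 + (of_real c / 2 - \<i> * of_real d / 2) * iexp x + (of_real c / 2 + \<i> * of_real d / 2) * iexp (- x)" for x
    by (simp add: g complex_eq_iff Re_exp Im_exp field_simps)
  have int: "integrable M (\<lambda>w. g (v w))"
    by (rule integrable_const_bound[where B = "1 + \<bar>c\<bar> + \<bar>d\<bar>"]) (use bound in auto)
  have "emeasure \<mu> (space \<mu>) = (\<integral>\<^sup>+w. ennreal (g (v w)) \<partial>M)"
    unfolding \<mu>_def by (simp add: emeasure_distr emeasure_density cong: nn_integral_cong)
  also have "\<dots> < \<infinity>" using int nn by (simp add: nn_integral_eq_integral)
  finally show fin: "finite_measure \<mu>" by (intro finite_measureI) auto
  interpret \<mu>: finite_measure \<mu> by fact
  have [simp]: "sets \<mu> = sets borel" "space \<mu> = UNIV" by (simp_all add: \<mu>_def)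
  show "measure \<mu> A = (LINT w|M. indicator A (u w) * g (v w))" if [measurable]: "A \<in> sets borel"
  proof -
    have "measure \<mu> A = (LINT x|\<mu>. indicator A x)"
      by simp
    also have "\<dots> = (LINT w|M. g (v w) *\<^sub>R indicator A (u w))"
      unfolding \<mu>_def using nn by (subst integral_distr, simp, simp, subst integral_density) auto
    finally show ?thesis by (simp add: mult.commute)
  qed
  have "char \<mu> t = (CLINT w|M. g (v w) *\<^sub>R iexp (t * u w))"
    unfolding \<mu>_def char_def using nn by (subst integral_distr, simp, simp, subst integral_density) auto
  also have "\<dots> = (CLINT w|M. iexp (t * u w + 0 * v w)
    + (of_real c / 2 - \<i> * of_real d / 2) * iexp (t * u w + 1 * v w)
    + (of_real c / 2 + \<i> * of_real d / 2) * iexp (t * u w + (- 1) * v w))"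
  proof (intro Bochner_Integration.integral_cong refl)
    fix w
    have e: "iexp (t * u w + r * v w) = iexp (t * u w) * iexp (r * v w)" for r
      by (simp add: exp_add[symmetric] algebra_simps)
    show "g (v w) *\<^sub>R iexp (t * u w) = iexp (t * u w + 0 * v w)
      + (of_real c / 2 - \<i> * of_real d / 2) * iexp (t * u w + 1 * v w)
      + (of_real c / 2 + \<i> * of_real d / 2) * iexp (t * u w + (- 1) * v w)"
      unfolding e scaleR_conv_of_real gi by (simp add: algebra_simps)
  qed
  also have "\<dots> = (CLINT w|M. iexp (t * u w + 0 * v w))
    + (of_real c / 2 - \<i> * of_real d / 2) * (CLINT w|M. iexp (t * u w + 1 * v w))
    + (of_real c / 2 + \<i> * of_real d / 2) * (CLINT w|M. iexp (t * u w + (- 1) * v w))"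
  proof -
    have i: "integrable M (\<lambda>w. iexp (t * u w + r * v w))" for r
      by (rule integrable_iexp') measurable
    have gen: "(CLINT w|M. f w + a * f1 w + b * f2 w) = (CLINT w|M. f w) + a * (CLINT w|M. f1 w) + b * (CLINT w|M. f2 w)"
      if "integrable M f" "integrable M f1" "integrable M f2" for f f1 f2 :: "'a \<Rightarrow> complex" and a b
      using that by simp
    show ?thesis by (rule gen[OF i i i])
  qed
  finally show "char \<mu> t = (CLINT w|M. iexp (t * u w + 0 * v w))
    + (of_real c / 2 - \<i> * of_real d / 2) * (CLINT w|M. iexp (t * u w + 1 * v w))
    + (of_real c / 2 + \<i> * of_real d / 2) * (CLINT w|M. iexp (t * u w + (- 1) * v w))" .
qed

lemma (in finite_measure) integral_iexp_restrict_decomp: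
  fixes u v :: "'a \<Rightarrow> real"
  assumes [measurable]: "u \<in> borel_measurable M" "v \<in> borel_measurable M" "A \<in> sets borel"
  shows "(CLINT w|M. indicator A (u w) *\<^sub>R iexp (v w)) =
      of_real (LINT w|M. indicator A (u w) * (1 + cos (v w))) + \<i> * of_real (LINT w|M. indicator A (u w) * (1 + sin (v w)))
       - (1 + \<i>) * of_real (LINT w|M. indicator A (u w))"
proof -
  have i: "integrable M (\<lambda>w. indicator A (u w) * (1 + cos (v w)) :: real)"
    "integrable M (\<lambda>w. indicator A (u w) * (1 + sin (v w)) :: real)" "integrable M (\<lambda>w. indicator A (u w) :: real)"
  proof -
    have b: "\<bar>1 + cos x\<bar> \<le> 2" "\<bar>1 + sin x\<bar> \<le> 2" for x :: real
      using cos_ge_minus_one[of x] cos_le_one[of x] sin_ge_minus_one[of x] sin_le_one[of x] by linarith+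
    show "integrable M (\<lambda>w. indicator A (u w) * (1 + cos (v w)) :: real)"
      by (rule integrable_const_bound[where B = 2]) (use b in \<open>auto split: split_indicator\<close>)
    show "integrable M (\<lambda>w. indicator A (u w) * (1 + sin (v w)) :: real)"
      by (rule integrable_const_bound[where B = 2]) (use b in \<open>auto split: split_indicator\<close>)
    show "integrable M (\<lambda>w. indicator A (u w) :: real)"
      by (rule integrable_const_bound[where B = 1]) auto
  qed
  have "(CLINT w|M. indicator A (u w) *\<^sub>R iexp (v w)) =
      (CLINT w|M. of_real (indicator A (u w) * (1 + cos (v w))) + \<i> * of_real (indicator A (u w) * (1 + sin (v w)))
       - (1 + \<i>) * of_real (indicator A (u w)))"
    by (intro Bochner_Integration.integral_cong refl)
      (simp add: complex_eq_iff Re_exp Im_exp split: split_indicator)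
  also have "\<dots> = of_real (LINT w|M. indicator A (u w) * (1 + cos (v w))) + \<i> * of_real (LINT w|M. indicator A (u w) * (1 + sin (v w)))
       - (1 + \<i>) * of_real (LINT w|M. indicator A (u w))"
    using i by (simp del: of_real_mult of_real_add)
  finally show ?thesis .
qed

text \<open>The weights \<open>1\<close>, \<open>1 + cos V\<close> and \<open>1 + sin V\<close> are nonnegative, so the one-dimensional uniqueness
  theorem applies to the weighted laws of \<open>U\<close>.\<close>

lemma integral_iexp_restrict_eq:
  fixes U V :: "'a \<Rightarrow> real" and U' V' :: "'b \<Rightarrow> real"
  assumes P: "finite_measure P" and Q: "finite_measure Q"
    and m[measurable]: "U \<in> borel_measurable P" "V \<in> borel_measurable P"
      "U' \<in> borel_measurable Q" "V' \<in> borel_measurable Q"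
    and eq: "\<And>t r. (CLINT w|P. iexp (t * U w + r * V w)) = (CLINT w|Q. iexp (t * U' w + r * V' w))"
    and A[measurable]: "A \<in> sets borel"
  shows "(CLINT w|P. indicator A (U w) *\<^sub>R iexp (V w)) = (CLINT w|Q. indicator A (U' w) *\<^sub>R iexp (V' w))"
proof -
  interpret P: finite_measure P by fact
  interpret Q: finite_measure Q by fact
  have weight: "(LINT w|P. indicator A (U w) * g (V w)) = (LINT w|Q. indicator A (U' w) * g (V' w))"
    if g: "g = (\<lambda>x. 1 + c * cos x + d * sin x)" "\<And>x. g x \<ge> 0" for g :: "real \<Rightarrow> real" and c d :: real
  proof -
    note p = P.trig_weighted_law[OF m(1,2) g] and q = Q.trig_weighted_law[OF m(3,4) g]
    have "distr (density P (\<lambda>w. ennreal (g (V w)))) borel U = distr (density Q (\<lambda>w. ennreal (g (V' w)))) borel U'"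
      by (rule finite_measure_char_unique[OF p(1) _ q(1)], simp, simp, rule ext, simp only: p(3) q(3) eq)
    then show ?thesis using p(2)[OF A] q(2)[OF A] by simp
  qed
  have w1: "(LINT w|P. indicator A (U w)) = (LINT w|Q. indicator A (U' w) :: real)"
    using weight[of "\<lambda>x. 1 + 0 * cos x + 0 * sin x" 0 0] by simp
  have wc: "(LINT w|P. indicator A (U w) * (1 + cos (V w))) = (LINT w|Q. indicator A (U' w) * (1 + cos (V' w)))"
  proof -
    have "0 \<le> 1 + 1 * cos x + 0 * sin x" for x :: real using cos_ge_minus_one[of x] by linarith
    from weight[OF refl this] show ?thesis by simp
  qed
  have ws: "(LINT w|P. indicator A (U w) * (1 + sin (V w))) = (LINT w|Q. indicator A (U' w) * (1 + sin (V' w)))"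
  proof -
    have "0 \<le> 1 + 0 * cos x + 1 * sin x" for x :: real using sin_ge_minus_one[of x] by linarith
    from weight[OF refl this] show ?thesis by simp
  qed
  show ?thesis unfolding P.integral_iexp_restrict_decomp[OF m(1,2) A] Q.integral_iexp_restrict_decomp[OF m(3,4) A]
    by (simp only: w1 wc ws)
qed

lemma emeasure_density_indicator:
  fixes u :: "'a \<Rightarrow> real"
  assumes [measurable]: "u \<in> borel_measurable M" "A \<in> sets borel" "S \<in> sets M"
  shows "emeasure (density M (\<lambda>w. ennreal (indicator A (u w)))) S = emeasure M (S \<inter> {w \<in> space M. u w \<in> A})"
proof -
  have "emeasure (density M (\<lambda>w. ennreal (indicator A (u w)))) S = (\<integral>\<^sup>+w. indicator (S \<inter> {w \<in> space M. u w \<in> A}) w \<partial>M)"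
  proof -
    have "emeasure (density M (\<lambda>w. ennreal (indicator A (u w)))) S
       = (\<integral>\<^sup>+w. ennreal (indicator A (u w)) * indicator S w \<partial>M)"
      by (rule emeasure_density) measurable
    also have "\<dots> = (\<integral>\<^sup>+w. indicator (S \<inter> {w \<in> space M. u w \<in> A}) w \<partial>M)"
      by (intro nn_integral_cong) (auto split: split_indicator)
    finally show ?thesis .
  qed
  then show ?thesis by simp
qed

text \<open>Multivariate uniqueness from the one-dimensional theorem. In the induction, which ranges
  over all finite measures, the event for one coordinate is moved into the measure as a density, and
  \<open>integral_iexp_restrict_eq\<close> shows that the characteristic functions of the remaining
  coordinates still agree.\<close>

lemma finite_dim_law_eq:
  fixes X :: "'i \<Rightarrow> 'a \<Rightarrow> real" and Y :: "'i \<Rightarrow> 'b \<Rightarrow> real"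
  assumes "finite J" and "finite_measure P" "finite_measure Q"
    and "\<And>i. i \<in> J \<Longrightarrow> X i \<in> borel_measurable P" "\<And>i. i \<in> J \<Longrightarrow> Y i \<in> borel_measurable Q"
    and "\<And>b. (CLINT w|P. iexp (\<Sum>i\<in>J. b i * X i w)) = (CLINT w|Q. iexp (\<Sum>i\<in>J. b i * Y i w))"
    and "\<And>i. i \<in> J \<Longrightarrow> A i \<in> sets borel"
  shows "measure P {w \<in> space P. \<forall>i\<in>J. X i w \<in> A i} = measure Q {w \<in> space Q. \<forall>i\<in>J. Y i w \<in> A i}"
  using assms
proof (induction J arbitrary: P Q rule: finite_induct)
  \<comment> \<open>With no coordinates left, the hypothesis says that the total masses
    agree.\<close>
  case empty
  then show ?case by (simp add: of_real_eq_iff[symmetric, where 'a = complex] del: of_real_eq_iff)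
next
  case (insert j J)
  interpret P: finite_measure P by fact
  interpret Q: finite_measure Q by fact
  have mX[measurable]: "X i \<in> borel_measurable P" and mY[measurable]: "Y i \<in> borel_measurable Q"
    if "i \<in> insert j J" for i using insert.prems that by auto
  have mXj[measurable]: "X j \<in> borel_measurable P" and mYj[measurable]: "Y j \<in> borel_measurable Q" by (simp_all add: mX mY)
  have Aj[measurable]: "A j \<in> sets borel" and AJ: "\<And>i. i \<in> J \<Longrightarrow> A i \<in> sets borel" using insert.prems by auto
  have sX[measurable]: "(\<lambda>w. \<Sum>i\<in>J. b i * X i w) \<in> borel_measurable P" for b
    by (intro borel_measurable_sum borel_measurable_times) (auto intro: mX)
  have sY[measurable]: "(\<lambda>w. \<Sum>i\<in>J. b i * Y i w) \<in> borel_measurable Q" for b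
    by (intro borel_measurable_sum borel_measurable_times) (auto intro: mY)
  define P' where "P' = density P (\<lambda>w. ennreal (indicator (A j) (X j w)))"
  define Q' where "Q' = density Q (\<lambda>w. ennreal (indicator (A j) (Y j w)))"
  have fP: "finite_measure P'"
    unfolding P'_def by (rule finite_measureI)
      (use P.integrable_const_bound[of "\<lambda>w. indicator (A j) (X j w) :: real" 1] in \<open>simp add: emeasure_density nn_integral_eq_integral cong: nn_integral_cong\<close>)
  have fQ: "finite_measure Q'"
    unfolding Q'_def by (rule finite_measureI)
      (use Q.integrable_const_bound[of "\<lambda>w. indicator (A j) (Y j w) :: real" 1] in \<open>simp add: emeasure_density nn_integral_eq_integral cong: nn_integral_cong\<close>)
  have eq: "(CLINT w|P'. iexp (\<Sum>i\<in>J. b i * X i w)) = (CLINT w|Q'. iexp (\<Sum>i\<in>J. b i * Y i w))" for b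
  proof -
    have "(CLINT w|P'. iexp (\<Sum>i\<in>J. b i * X i w)) = (CLINT w|P. indicator (A j) (X j w) *\<^sub>R iexp (\<Sum>i\<in>J. b i * X i w))"
      unfolding P'_def by (subst integral_density) auto
    also have "\<dots> = (CLINT w|Q. indicator (A j) (Y j w) *\<^sub>R iexp (\<Sum>i\<in>J. b i * Y i w))"
    proof (rule integral_iexp_restrict_eq[OF P.finite_measure_axioms Q.finite_measure_axioms mXj sX mYj sY _ Aj])
      fix t r
      let ?b = "\<lambda>i. if i = j then t else r * b i"
      have "(\<Sum>i\<in>insert j J. ?b i * Z i) = t * Z j + r * (\<Sum>i\<in>J. b i * Z i)" for Z :: "'i \<Rightarrow> real"
      proof -
        have "(\<Sum>i\<in>J. ?b i * Z i) = (\<Sum>i\<in>J. r * (b i * Z i))"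
          using insert.hyps by (intro sum.cong) auto
        then show ?thesis using insert.hyps by (simp add: sum_distrib_left)
      qed
      with insert.prems(5)[of ?b]
      show "(CLINT w|P. iexp (t * X j w + r * (\<Sum>i\<in>J. b i * X i w))) = (CLINT w|Q. iexp (t * Y j w + r * (\<Sum>i\<in>J. b i * Y i w)))"
        by simp
    qed
    also have "\<dots> = (CLINT w|Q'. iexp (\<Sum>i\<in>J. b i * Y i w))"
      unfolding Q'_def by (subst integral_density) auto
    finally show ?thesis .
  qed
  have IH: "measure P' {w \<in> space P'. \<forall>i\<in>J. X i w \<in> A i} = measure Q' {w \<in> space Q'. \<forall>i\<in>J. Y i w \<in> A i}"
    by (rule insert.IH[OF fP fQ _ _ eq AJ]) (auto simp: P'_def Q'_def mX mY)
  have sets: "{w \<in> space P. \<forall>i\<in>J. X i w \<in> A i} \<in> sets P" "{w \<in> space Q. \<forall>i\<in>J. Y i w \<in> A i} \<in> sets Q"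
    using insert.hyps(1) mX mY AJ
    by (auto intro!: sets.sets_Collect_finite_All measurable_sets_Collect[where P = "\<lambda>x. x \<in> A _"])
  have "emeasure P' {w \<in> space P. \<forall>i\<in>J. X i w \<in> A i} = emeasure P {w \<in> space P. \<forall>i\<in>insert j J. X i w \<in> A i}"
    unfolding P'_def emeasure_density_indicator[OF mXj Aj sets(1)]
    by (rule arg_cong[where f = "emeasure P"]) auto
  moreover have "emeasure Q' {w \<in> space Q. \<forall>i\<in>J. Y i w \<in> A i} = emeasure Q {w \<in> space Q. \<forall>i\<in>insert j J. Y i w \<in> A i}"
    unfolding Q'_def emeasure_density_indicator[OF mYj Aj sets(2)]
    by (rule arg_cong[where f = "emeasure Q"]) auto
  ultimately show ?case using IH by (simp add: measure_def P'_def Q'_def)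
qed

text \<open>Stating the formula through mean and variance lets one expression cover the degenerate
  laws as well.\<close>

lemma (in prob_space) char_normal_rv:
  assumes V: "normal_rv M V"
  shows "(CLINT w|M. iexp (V w)) = iexp (expectation V) * of_real (exp (- variance V / 2))"
  using V
proof (cases rule: normal_rv_cases)
  case (dens \<mu> s)
  note D = dens(2)
  have mV[measurable]: "V \<in> borel_measurable M" using V by (simp add: normal_rv_def)
  have D': "distributed M lborel (\<lambda>w. (V w - \<mu>) / s) std_normal_density"
    using normal_standard_normal_convert[OF dens(1)] D mV by simp
  have m: "expectation V = \<mu>" "expectation (\<lambda>w. (V w)\<^sup>2) = \<mu>\<^sup>2 + s\<^sup>2"
    using distributed_integral[OF D, of "\<lambda>x. x"] distributed_integral[OF D, of "\<lambda>x. x\<^sup>2"]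
      normal_moment_nz_1[OF dens(1), THEN has_bochner_integral_integral_eq]
      normal_density_moments(1)[OF dens(1), THEN has_bochner_integral_integral_eq] by simp_all
  have v: "variance V = s\<^sup>2"
    using variance_eq[OF normal_rv_moments(1)[OF V] normal_rv_moments(2)[OF V]] m by simp
  have "(CLINT w|M. iexp (V w)) = (CLINT w|M. iexp \<mu> * iexp (s * ((V w - \<mu>) / s)))"
  proof -
    have *: "s * ((x - \<mu>) / s) = x - \<mu>" for x using dens(1) by simp
    show ?thesis unfolding * by (simp add: exp_add[symmetric] algebra_simps)
  qed
  also have "\<dots> = iexp \<mu> * (CLINT w|M. iexp (s * ((V w - \<mu>) / s)))"
    by simp
  also have "(CLINT w|M. iexp (s * ((V w - \<mu>) / s))) = (CLINT x|distr M lborel (\<lambda>w. (V w - \<mu>) / s). iexp (s * x))"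
    by (subst integral_distr) auto
  also have "distr M lborel (\<lambda>w. (V w - \<mu>) / s) = std_normal_distribution"
    using D' by (simp add: distributed_def)
  also have "(CLINT x|std_normal_distribution. iexp (s * x)) = of_real (exp (- s\<^sup>2 / 2))"
    using fun_cong[OF char_std_normal_distribution, of s] by (simp add: char_def)
  finally show ?thesis using m v by simp
next
  case (const \<mu>)
  have mV[measurable]: "V \<in> borel_measurable M" using V by (simp add: normal_rv_def)
  have E: "expectation V = expectation (\<lambda>w. \<mu>)" by (rule integral_cong_AE) (use const in auto)
  have V: "variance V = expectation (\<lambda>w. 0)"
    by (rule integral_cong_AE) (use const E in \<open>auto simp: prob_space\<close>)
  have "(CLINT w|M. iexp (V w)) = (CLINT w|M. iexp \<mu>)"
    by (rule integral_cong_AE) (use const in auto)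
  then show ?thesis using E V by (simp add: prob_space)
qed

lemma (in prob_space) covariance_sum_right:
  assumes "\<And>s. s \<in> F \<Longrightarrow> integrable M (W s)" "integrable M V" "\<And>s. s \<in> F \<Longrightarrow> integrable M (\<lambda>w. V w * W s w)"
  shows "covariance M V (\<lambda>w. \<Sum>s\<in>F. u s * W s w) = (\<Sum>s\<in>F. u s * covariance M V (W s))"
proof -
  have "covariance M V (\<lambda>w. \<Sum>s\<in>F. u s * W s w)
    = expectation (\<lambda>w. \<Sum>s\<in>F. u s * ((V w - expectation V) * (W s w - expectation (W s))))"
    unfolding covariance_def using assms
    by (intro Bochner_Integration.integral_cong refl)
      (simp add: Bochner_Integration.integral_sum sum_subtractf[symmetric] right_diff_distrib[symmetric] sum_distrib_left mult_ac)
  also have "\<dots> = (\<Sum>s\<in>F. expectation (\<lambda>w. u s * ((V w - expectation V) * (W s w - expectation (W s)))))"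
  proof (rule Bochner_Integration.integral_sum)
    fix s assume s: "s \<in> F"
    have eq: "(\<lambda>w. (V w - expectation V) * (W s w - expectation (W s)))
       = (\<lambda>w. V w * W s w - expectation (W s) * V w - expectation V * W s w + expectation V * expectation (W s))"
      by (simp add: fun_eq_iff algebra_simps)
    have "integrable M (\<lambda>w. (V w - expectation V) * (W s w - expectation (W s)))"
      unfolding eq using assms s by simp
    then show "integrable M (\<lambda>w. u s * ((V w - expectation V) * (W s w - expectation (W s))))"
      by (rule integrable_mult_right)
  qed
  finally show ?thesis by (simp add: covariance_def)
qed

subsection \<open>Total variation under shifts of Gaussian vectors\<close>

lemma covariance_commute: "covariance M U V = covariance M V U"
  by (simp add: covariance_def mult.commute)

lemma measure_pair_prob_eq_integral:
  assumes M: "prob_space M" and N: "prob_space N" and A: "A \<in> sets (M \<Otimes>\<^sub>M N)"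
  shows "measure (M \<Otimes>\<^sub>M N) A = (LINT x|M. measure N (Pair x -` A))"
    and "integrable M (\<lambda>x. measure N (Pair x -` A))"
proof -
  interpret M: prob_space M by fact
  interpret N: prob_space N by fact
  interpret pair_prob_space M N ..
  have [measurable]: "(\<lambda>x. measure N (Pair x -` A)) \<in> borel_measurable M"
    unfolding measure_def using N.measurable_emeasure_Pair[OF A] by measurable
  show i: "integrable M (\<lambda>x. measure N (Pair x -` A))"
    by (rule M.integrable_const_bound[where B = 1]) auto
  have "emeasure (M \<Otimes>\<^sub>M N) A = (\<integral>\<^sup>+x. ennreal (measure N (Pair x -` A)) \<partial>M)"
    by (subst N.emeasure_pair_measure_alt[OF A]) (simp add: N.emeasure_eq_measure)
  also have "\<dots> = ennreal (LINT x|M. measure N (Pair x -` A))"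
    using i by (intro nn_integral_eq_integral) auto
  finally show "measure (M \<Otimes>\<^sub>M N) A = (LINT x|M. measure N (Pair x -` A))"
    by (simp add: measure_def)
qed

text \<open>For a shift d \<ge> 0 the shifted density dominates beyond d / 2 and is dominated
  before, so a half-line is the worst event. There the difference is the mass of an interval of
  length d, and the density is at most 1. Complements give the other sign of the difference,
  translated sets the other sign of the shift.\<close>

lemma std_normal_shift_tv:
  assumes B[measurable]: "B \<in> sets borel"
  shows "\<bar>measure std_normal_distribution {y. y + \<delta> \<in> B} - measure std_normal_distribution B\<bar> \<le> \<bar>\<delta>\<bar>"
proof -
  let ?N = std_normal_distribution
  interpret N: real_distribution ?N by (rule real_dist_normal_dist)
  let ?g = "std_normal_density"
  have ig[simp]: "integrable lborel (\<lambda>y. indicator B y * ?g y)" "integrable lborel (\<lambda>y. indicator B y * ?g (y - d))"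
    if [measurable]: "B \<in> sets borel" for B d
  proof -
    have 1: "integrable lborel ?g" by simp
    have 2: "integrable lborel (\<lambda>y. ?g (y - d))"
      using lborel_integrable_real_affine[OF 1, of 1 "- d"] by (simp add: algebra_simps)
    show "integrable lborel (\<lambda>y. indicator B y * ?g y)" "integrable lborel (\<lambda>y. indicator B y * ?g (y - d))"
      by (rule Bochner_Integration.integrable_bound[OF 1]; auto split: split_indicator)
        (rule Bochner_Integration.integrable_bound[OF 2]; auto split: split_indicator)
  qed
  have mN: "measure ?N B = (LINT y|lborel. indicator B y * ?g y)"
    if [measurable]: "B \<in> sets borel" for B
  proof -
    have "measure ?N B = (LINT y|?N. indicator B y)" by simp
    also have "\<dots> = (LINT y|lborel. ?g y *\<^sub>R indicator B y)" by (subst integral_density) auto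
    finally show ?thesis by (simp add: mult.commute)
  qed
  have mNd: "measure ?N {y. y + d \<in> B} = (LINT y|lborel. indicator B y * ?g (y - d))"
    if [measurable]: "B \<in> sets borel" for B d
  proof -
    have "{y. y + d \<in> B} \<in> sets borel" by measurable
    then have "measure ?N {y. y + d \<in> B} = (LINT y|lborel. indicator B (d + 1 * y) * ?g (d + 1 * y - d))"
      by (simp add: mN indicator_def add.commute)
    also have "\<dots> = (LINT y|lborel. indicator B y * ?g (y - d))"
      using lborel_integral_real_affine[of 1 "\<lambda>y. indicator B y * ?g (y - d)" d] by simp
    finally show ?thesis .
  qed
  have up: "measure ?N {y. y + d \<in> B} - measure ?N B \<le> d"
    if d: "d \<ge> 0" and B[measurable]: "B \<in> sets borel" for B d
  proof -
    let ?H = "{d / 2<..}"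
    have "measure ?N {y. y + d \<in> B} - measure ?N B
       = (LINT y|lborel. indicator B y * ?g (y - d) - indicator B y * ?g y)"
      unfolding mN[OF B] mNd[OF B] using B by simp
    also have "\<dots> \<le> (LINT y|lborel. indicator ?H y * ?g (y - d) - indicator ?H y * ?g y)"
    proof (rule integral_mono)
      fix y :: real
      have "?g (y - d) \<le> ?g y" if "y \<le> d / 2"
      proof -
        have "y\<^sup>2 \<le> (y - d)\<^sup>2" using that d mult_left_mono[of "2 * y" d d] by (simp add: power2_eq_square algebra_simps)
        then show ?thesis by (simp add: std_normal_density_def divide_right_mono mult_left_mono)
      qed
      moreover have "?g y \<le> ?g (y - d)" if "y > d / 2"
      proof -
        have "(y - d)\<^sup>2 \<le> y\<^sup>2" using that d mult_left_mono[of d "2 * y" d] by (simp add: power2_eq_square algebra_simps)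
        then show ?thesis by (simp add: std_normal_density_def divide_right_mono mult_left_mono)
      qed
      ultimately show "indicator B y * ?g (y - d) - indicator B y * ?g y
         \<le> indicator ?H y * ?g (y - d) - indicator ?H y * ?g y"
        by (auto split: split_indicator)
    qed (use B in auto)
    also have "\<dots> = measure ?N {y. y + d \<in> ?H} - measure ?N ?H"
    proof -
      have H: "?H \<in> sets borel" by simp
      show ?thesis unfolding mN[OF H] mNd[OF H] using ig[OF H] by simp
    qed
    also have "\<dots> = measure ?N ({y. y + d \<in> ?H} - ?H)"
      by (rule N.finite_measure_Diff[symmetric]) (use d in auto)
    also have "{y. y + d \<in> ?H} - ?H = {- d / 2<..d / 2}" by auto
    also have "measure ?N {- d / 2<..d / 2} = (LINT y|lborel. indicator {- d / 2<..d / 2} y * ?g y)"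
      by (rule mN) auto
    also have "\<dots> \<le> (LINT y|lborel. indicator {- d / 2<..d / 2} y * 1)"
    proof (rule integral_mono)
      fix y :: real
      have "1 \<le> sqrt (2 * pi)" using pi_ge_two by simp
      then have "1 / sqrt (2 * pi) \<le> 1" by simp
      then have "1 / sqrt (2 * pi) * exp (- y\<^sup>2 / 2) \<le> 1 * 1" by (intro mult_mono) auto
      then have "?g y \<le> 1" unfolding std_normal_density_def by simp
      then show "indicator {- d / 2<..d / 2} y * ?g y \<le> indicator {- d / 2<..d / 2} y * 1"
        by (intro mult_left_mono) auto
    qed (use d in \<open>auto intro!: integrable_real_indicator\<close>)
    also have "\<dots> = d" using d by simp
    finally show ?thesis .
  qed
  have both: "\<bar>measure ?N {y. y + d \<in> B} - measure ?N B\<bar> \<le> d"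
    if d: "d \<ge> 0" and B[measurable]: "B \<in> sets borel" for B d
  proof -
    have "measure ?N {y. y + d \<in> - B} = 1 - measure ?N {y. y + d \<in> B}"
      using N.prob_compl[of "{y. y + d \<in> B}"] by (simp add: Compl_eq_Diff_UNIV[symmetric] Collect_neg_eq)
    moreover have "measure ?N (- B) = 1 - measure ?N B"
      using N.prob_compl[of B] by (simp add: Compl_eq_Diff_UNIV)
    ultimately show ?thesis using up[OF d B] up[OF d, of "- B"] by auto
  qed
  show ?thesis
  proof (cases "\<delta> \<ge> 0")
    case True
    then show ?thesis using both B by simp
  next
    case False
    then show ?thesis using both[of "- \<delta>" "{y. y + \<delta> \<in> B}"] by (simp add: abs_minus_commute)
  qed
qed

text \<open>Regression on \<open>U\<close>: W_i is a part uncorrelated with \<open>U\<close> plus a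
  multiple of \<open>U\<close>, and replacing \<open>U\<close> there by an independent variable of
  the same law leaves the joint law unchanged. Moving that variable by \<beta> Var U moves
  coordinate i by \<beta> Cov(W_i, U); in standard units this is a move by \<beta> times the
  standard deviation of \<open>U\<close>.\<close>

lemma gaussian_shift_tv:
  fixes W :: "'i \<Rightarrow> 'a \<Rightarrow> real"
  assumes M: "prob_space M" and F: "finite F"
    and comb: "\<And>b. normal_rv M (\<lambda>w. \<Sum>i\<in>F. b i * W i w)"
    and U: "U = (\<lambda>w. \<Sum>i\<in>F. u i * W i w)"
    and A[measurable]: "A \<in> sets (\<Pi>\<^sub>M i\<in>F. (borel :: real measure))"
  shows "\<bar>measure M {w \<in> space M. (\<lambda>i\<in>F. W i w) \<in> A}
      - measure M {w \<in> space M. (\<lambda>i\<in>F. W i w + \<beta> * covariance M (W i) U) \<in> A}\<bar>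
    \<le> \<bar>\<beta>\<bar> * sqrt (covariance M U U)"
proof -
  interpret prob_space M by fact
  let ?N = "std_normal_distribution"
  interpret N: real_distribution ?N by (rule real_dist_normal_dist)
  interpret MN: pair_prob_space M ?N ..
  define S where "S = covariance M U U"
  define x where "x i = covariance M (W i) U" for i
  have Wn: "normal_rv M (W i)" if "i \<in> F" for i
  proof -
    have "(\<Sum>j\<in>F. (if j = i then 1 else 0) * W j w) = W i w" for w
      using F that by (simp add: if_distrib[of "\<lambda>x. x * _"] cong: if_cong)
    then show ?thesis using comb[of "\<lambda>j. if j = i then 1 else 0"] by simp
  qed
  have Un: "normal_rv M U" unfolding U by (rule comb)
  have Wm[measurable]: "W i \<in> borel_measurable M" if "i \<in> F" for i using Wn[OF that] by (simp add: normal_rv_def)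
  have Um[measurable]: "U \<in> borel_measurable M" using Un by (simp add: normal_rv_def)
  have Sv: "S = variance U" by (simp add: S_def covariance_def power2_eq_square)
  then have S0: "S \<ge> 0" by simp
  show ?thesis
  proof (cases "S = 0")
    \<comment> \<open>If the variance is 0, \<open>U\<close> is almost surely constant and every
      shift vanishes.\<close>
    case True
    have int: "integrable M (\<lambda>w. (U w - expectation U)\<^sup>2)"
      using normal_rv_moments(1,2)[OF Un] by (simp add: power2_diff)
    have "AE w in M. (U w - expectation U)\<^sup>2 = 0"
      using True Sv integral_nonneg_eq_0_iff_AE[OF int] by simp
    then have Uc: "AE w in M. U w - expectation U = 0" by eventually_elim simp
    have x0: "covariance M (W i) U = 0" if "i \<in> F" for i
    proof -
      have "covariance M (W i) U = expectation (\<lambda>w. 0)"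
        unfolding covariance_def using that by (intro integral_cong_AE) (use Uc in auto)
      then show ?thesis by simp
    qed
    have "(\<lambda>i\<in>F. W i w + \<beta> * covariance M (W i) U) = (\<lambda>i\<in>F. W i w)" for w
      by (rule restrict_ext) (simp add: x0)
    then show ?thesis using S0 by (simp add: S_def)
  next
    case False
    then have Sp: "S > 0" using S0 by simp
    \<comment> \<open>\<open>T\<close> rebuilds W_i with \<open>U\<close> replaced by its mean plus
      sqrt S times the second coordinate, an independent standard normal variable.\<close>
    define T where "T p i = W i (fst p) - x i * (U (fst p)) / S + x i * expectation U / S + x i * snd p / sqrt S"
      for p :: "'a \<times> real" and i
    have Tm[measurable]: "(\<lambda>p. T p i) \<in> borel_measurable (M \<Otimes>\<^sub>M ?N)" if "i \<in> F" for i
    proof -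
      have [measurable]: "W i \<in> borel_measurable M" by (rule Wm[OF that])
      show ?thesis unfolding T_def by measurable
    qed
    have bU: "integrable M (W i)" "integrable M (\<lambda>w. W i w * U w)" if "i \<in> F" for i
      using normal_rv_moments(1)[OF Wn[OF that]] normal_rv_mult_integrable[OF Wn[OF that] Un] by auto
    \<comment> \<open>\<open>V\<close> is the combination without its component along
      \<open>U\<close>. It has lost the variance q^2 / S, which the independent coordinate with
      factor q / sqrt S restores.\<close>
    have chars: "(CLINT w|M. iexp (\<Sum>i\<in>F. b i * W i w)) = (CLINT p|M \<Otimes>\<^sub>M ?N. iexp (\<Sum>i\<in>F. b i * T p i))" for b
    proof -
      define P where "P w = (\<Sum>i\<in>F. b i * W i w)" for w
      define q where "q = (\<Sum>i\<in>F. b i * x i)"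
      have Pn: "normal_rv M P" unfolding P_def by (rule comb)
      have [measurable]: "P \<in> borel_measurable M" using Pn by (simp add: normal_rv_def)
      define V where "V w = P w - q / S * U w" for w
      have Vn: "normal_rv M V"
      proof -
        have "V = (\<lambda>w. \<Sum>i\<in>F. (b i - q / S * u i) * W i w)"
          by (simp add: fun_eq_iff V_def P_def U left_diff_distrib sum_subtractf sum_distrib_left mult.assoc)
        then show ?thesis using comb by simp
      qed
      note iP = normal_rv_moments(1,2)[OF Pn] and iU = normal_rv_moments(1,2)[OF Un]
        and iPU = normal_rv_mult_integrable[OF Pn Un]
      have covPU: "covariance M P U = q"
      proof -
        have "covariance M U P = (\<Sum>i\<in>F. b i * covariance M U (W i))"
          unfolding P_def using bU iU by (intro covariance_sum_right) (auto simp: mult.commute)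
        then show ?thesis by (simp add: q_def x_def covariance_commute[of M _ U])
      qed
      have EV: "expectation V = expectation P - q / S * expectation U"
        unfolding V_def using iP iU by simp
      have "variance V = expectation (\<lambda>w. (P w - expectation P)\<^sup>2 - 2 * (q / S) * ((P w - expectation P) * (U w - expectation U))
          + (q / S)\<^sup>2 * (U w - expectation U)\<^sup>2)"
        unfolding EV by (intro Bochner_Integration.integral_cong refl) (simp add: V_def power2_eq_square algebra_simps)
      also have "\<dots> = variance P - 2 * (q / S) * covariance M P U + (q / S)\<^sup>2 * variance U"
      proof -
        have 1: "integrable M (\<lambda>w. (P w - expectation P)\<^sup>2)" "integrable M (\<lambda>w. (U w - expectation U)\<^sup>2)"
          using iP iU by (simp_all add: power2_diff)
        have "(\<lambda>w. (P w - expectation P) * (U w - expectation U))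
             = (\<lambda>w. P w * U w - expectation P * U w - expectation U * P w + expectation P * expectation U)"
            by (simp add: fun_eq_iff algebra_simps)
        then have 2: "integrable M (\<lambda>w. (P w - expectation P) * (U w - expectation U))"
          using iP iU iPU by simp
        show ?thesis unfolding covariance_def using 1 2 by simp
      qed
      finally have VV: "variance V = variance P - q\<^sup>2 / S"
        unfolding covPU Sv[symmetric] using Sp by (simp add: power2_eq_square field_simps)
      have T: "(\<Sum>i\<in>F. b i * T p i) = V (fst p) + q * expectation U / S + q / sqrt S * snd p" for p
      proof -
        have "(\<Sum>i\<in>F. b i * T p i) = (\<Sum>i\<in>F. b i * W i (fst p) - (b i * x i) * (U (fst p) / S)
           + (b i * x i) * (expectation U / S) + (b i * x i) * (snd p / sqrt S))"
          by (intro sum.cong refl) (simp add: T_def algebra_simps)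
        then show ?thesis
          unfolding sum.distrib sum_subtractf sum_distrib_right[symmetric] by (simp add: V_def P_def q_def)
      qed
      have [measurable]: "V \<in> borel_measurable M" using Vn by (simp add: normal_rv_def)
      have "(CLINT p|M \<Otimes>\<^sub>M ?N. iexp (\<Sum>i\<in>F. b i * T p i))
         = (CLINT w|M. (CLINT y|?N. iexp (V w + q * expectation U / S + q / sqrt S * y)))"
      proof -
        have "integrable (M \<Otimes>\<^sub>M ?N) (\<lambda>p. iexp (V (fst p) + q * expectation U / S + q / sqrt S * snd p))"
          by (rule MN.P.integrable_const_bound[where B = 1]) auto
        from MN.integral_fst'[OF this] show ?thesis unfolding T by simp
      qed
      also have "\<dots> = (CLINT w|M. iexp (V w) * (iexp (q * expectation U / S) * of_real (exp (- (q / sqrt S)\<^sup>2 / 2))))"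
      proof (rule Bochner_Integration.integral_cong[OF refl])
        fix w
        have "(CLINT y|?N. iexp (V w + q * expectation U / S + q / sqrt S * y))
           = (CLINT y|?N. (iexp (V w) * iexp (q * expectation U / S)) * iexp (q / sqrt S * y))"
          by (intro Bochner_Integration.integral_cong refl) (simp add: exp_add[symmetric] algebra_simps)
        also have "\<dots> = (iexp (V w) * iexp (q * expectation U / S)) * char ?N (q / sqrt S)"
          unfolding char_def by (rule integral_mult_right_zero)
        finally show "(CLINT y|?N. iexp (V w + q * expectation U / S + q / sqrt S * y)) =
            iexp (V w) * (iexp (q * expectation U / S) * of_real (exp (- (q / sqrt S)\<^sup>2 / 2)))"
          unfolding char_std_normal_distribution by (simp only: mult.assoc)
      qed
      also have "\<dots> = (CLINT w|M. iexp (V w)) * (iexp (q * expectation U / S) * of_real (exp (- (q / sqrt S)\<^sup>2 / 2)))"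
        by (rule integral_mult_left_zero)
      also have "\<dots> = (iexp (expectation V) * iexp (q * expectation U / S))
          * (of_real (exp (- variance V / 2)) * of_real (exp (- (q / sqrt S)\<^sup>2 / 2)))"
        unfolding char_normal_rv[OF Vn] by (simp only: mult_ac)
      also have "iexp (expectation V) * iexp (q * expectation U / S) = iexp (expectation P)"
        by (simp add: EV exp_add[symmetric] algebra_simps)
      also have "of_real (exp (- variance V / 2)) * of_real (exp (- (q / sqrt S)\<^sup>2 / 2)) = (of_real (exp (- variance P / 2)) :: complex)"
        unfolding of_real_mult[symmetric] exp_add[symmetric] VV using Sp
          by (simp add: power_divide diff_divide_distrib add_divide_distrib)
      also have "iexp (expectation P) * of_real (exp (- variance P / 2)) = (CLINT w|M. iexp (P w))"
        by (rule char_normal_rv[OF Pn, symmetric])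
      finally show ?thesis by (simp add: P_def)
    qed
    let ?B = "\<Pi>\<^sub>M i\<in>F. (borel :: real measure)"
    have mW[measurable]: "(\<lambda>w. \<lambda>i\<in>F. W i w) \<in> measurable M ?B"
      by (rule measurable_restrict) (rule Wm)
    have mT[measurable]: "(\<lambda>p. \<lambda>i\<in>F. T p i) \<in> measurable (M \<Otimes>\<^sub>M ?N) ?B"
      by (rule measurable_restrict) (rule Tm)
    have law: "distr M ?B (\<lambda>w. \<lambda>i\<in>F. W i w) = distr (M \<Otimes>\<^sub>M ?N) ?B (\<lambda>p. \<lambda>i\<in>F. T p i)"
    proof (rule measure_eqI_PiM_finite[OF F])
      fix E :: "'i \<Rightarrow> real set" assume E: "\<And>i. i \<in> F \<Longrightarrow> E i \<in> sets borel"
      have C: "Pi\<^sub>E F E \<in> sets ?B" using F E by simp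
      have "emeasure (distr M ?B (\<lambda>w. \<lambda>i\<in>F. W i w)) (Pi\<^sub>E F E) = measure M {w \<in> space M. \<forall>i\<in>F. W i w \<in> E i}"
        unfolding emeasure_distr[OF mW C] emeasure_eq_measure
        by (rule arg_cong[where f = "\<lambda>C. ennreal (measure M C)"]) (auto simp: PiE_iff)
      also have "\<dots> = measure (M \<Otimes>\<^sub>M ?N) {p \<in> space (M \<Otimes>\<^sub>M ?N). \<forall>i\<in>F. T p i \<in> E i}"
        using finite_dim_law_eq[OF F finite_measure_axioms MN.P.finite_measure_axioms Wm Tm chars E] by simp
      also have "\<dots> = emeasure (distr (M \<Otimes>\<^sub>M ?N) ?B (\<lambda>p. \<lambda>i\<in>F. T p i)) (Pi\<^sub>E F E)"
        unfolding emeasure_distr[OF mT C] MN.P.emeasure_eq_measure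
        by (rule arg_cong[where f = "\<lambda>C. ennreal (measure (M \<Otimes>\<^sub>M ?N) C)"]) (auto simp: PiE_iff)
      finally show "emeasure (distr M ?B (\<lambda>w. \<lambda>i\<in>F. W i w)) (Pi\<^sub>E F E) = emeasure (distr (M \<Otimes>\<^sub>M ?N) ?B (\<lambda>p. \<lambda>i\<in>F. T p i)) (Pi\<^sub>E F E)" .
    next
      show "range (\<lambda>_. space ?B) \<subseteq> prod_algebra F (\<lambda>_. borel)"
        using F by (auto simp: space_PiM intro!: prod_algebraI_finite)
    qed (auto simp: emeasure_distr emeasure_eq_measure)
    have Peq: "measure M {w \<in> space M. (\<lambda>i\<in>F. W i w) \<in> C} = measure (M \<Otimes>\<^sub>M ?N) {p \<in> space (M \<Otimes>\<^sub>M ?N). (\<lambda>i\<in>F. T p i) \<in> C}"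
      if C: "C \<in> sets ?B" for C
      using arg_cong[OF law, of "\<lambda>D. measure D C"] C
      by (simp add: measure_distr vimage_def Int_def conj_commute)
    define \<delta> where "\<delta> = \<beta> * sqrt S"
    define sh where "sh v = (\<lambda>i\<in>F. v i + \<beta> * x i)" for v :: "'i \<Rightarrow> real"
    have msh[measurable]: "sh \<in> measurable ?B ?B"
      unfolding sh_def by (rule measurable_restrict) measurable
    have T_shift: "sh (\<lambda>i\<in>F. T (w, y) i) = (\<lambda>i\<in>F. T (w, y + \<delta>) i)" for w y
    proof (unfold sh_def, rule restrict_ext)
      fix i assume "i \<in> F"
      have "x i * \<delta> / sqrt S = \<beta> * x i" using Sp by (simp add: \<delta>_def)
      then show "(\<lambda>i\<in>F. T (w, y) i) i + \<beta> * x i = T (w, y + \<delta>) i"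
        using \<open>i \<in> F\<close> by (simp add: T_def distrib_left add_divide_distrib)
    qed
    define A' where "A' = sh -` A \<inter> space ?B"
    have A'[measurable]: "A' \<in> sets ?B" unfolding A'_def by measurable
    define G where "G = {p \<in> space (M \<Otimes>\<^sub>M ?N). (\<lambda>i\<in>F. T p i) \<in> A}"
    define G' where "G' = {p \<in> space (M \<Otimes>\<^sub>M ?N). (\<lambda>i\<in>F. T p i) \<in> A'}"
    have GM[measurable]: "G \<in> sets (M \<Otimes>\<^sub>M ?N)" "G' \<in> sets (M \<Otimes>\<^sub>M ?N)"
      unfolding G_def G'_def by measurable
    have "{w \<in> space M. (\<lambda>i\<in>F. W i w + \<beta> * covariance M (W i) U) \<in> A} = {w \<in> space M. (\<lambda>i\<in>F. W i w) \<in> A'}"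
      using measurable_space[OF mW] by (auto simp: A'_def sh_def x_def cong: restrict_cong)
    then have e2: "measure M {w \<in> space M. (\<lambda>i\<in>F. W i w + \<beta> * covariance M (W i) U) \<in> A} = measure (M \<Otimes>\<^sub>M ?N) G'"
      using Peq[OF A'] by (simp add: G'_def)
    have e1: "measure M {w \<in> space M. (\<lambda>i\<in>F. W i w) \<in> A} = measure (M \<Otimes>\<^sub>M ?N) G"
      using Peq[OF A] by (simp add: G_def)
    have slice: "\<bar>measure ?N (Pair w -` G) - measure ?N (Pair w -` G')\<bar> \<le> \<bar>\<delta>\<bar>" if w: "w \<in> space M" for w
    proof -
      have "Pair w -` G' = {y. y + \<delta> \<in> Pair w -` G}"
        using w measurable_space[OF mT] by (auto simp: G_def G'_def A'_def T_shift space_pair_measure)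
      moreover have "Pair w -` G \<in> sets borel" using sets_Pair1[OF GM(1), of w] by simp
      ultimately show ?thesis using std_normal_shift_tv[of "Pair w -` G" \<delta>] by (simp add: abs_minus_commute)
    qed
    note pG = measure_pair_prob_eq_integral[OF M N.prob_space_axioms GM(1)]
      and pG' = measure_pair_prob_eq_integral[OF M N.prob_space_axioms GM(2)]
    have "\<bar>measure (M \<Otimes>\<^sub>M ?N) G - measure (M \<Otimes>\<^sub>M ?N) G'\<bar>
       = \<bar>LINT w|M. measure ?N (Pair w -` G) - measure ?N (Pair w -` G')\<bar>"
      using pG pG' by simp
    also have "\<dots> \<le> (LINT w|M. \<bar>measure ?N (Pair w -` G) - measure ?N (Pair w -` G')\<bar>)"
      using integral_norm_bound[of M "\<lambda>w. measure ?N (Pair w -` G) - measure ?N (Pair w -` G')"] by simp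
    also have "\<dots> \<le> (LINT w|M. \<bar>\<delta>\<bar>)"
      by (rule integral_mono) (use pG pG' slice in auto)
    also have "\<dots> = \<bar>\<beta>\<bar> * sqrt (covariance M U U)"
      using S0 by (simp add: prob_space \<delta>_def abs_mult S_def[symmetric])
    finally show ?thesis unfolding e1 e2 .
  qed
qed

subsection \<open>A uniform trace bound from the spectral densities\<close>

lemma integrable_one_plus_abs_powr:
  fixes e :: real
  assumes e: "e < -1"
  shows "integrable lborel (\<lambda>x. (1 + \<bar>x\<bar>) powr e)"
proof -
  have lim: "((\<lambda>x. (1 + x) powr (e + 1) / (e + 1)) \<longlongrightarrow> 0 / (e + 1)) at_top"
    by (intro tendsto_divide tendsto_const tendsto_neg_powr)
      (use e in \<open>auto intro!: filterlim_tendsto_add_at_top[OF tendsto_const] filterlim_ident\<close>)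
  have "(\<integral>\<^sup>+x. ennreal ((1 + x) powr e) * indicator {0..} x \<partial>lborel) = ennreal (0 - (1 + 0) powr (e + 1) / (e + 1))"
  proof (rule nn_integral_FTC_atLeast)
    fix x :: real assume "0 \<le> x"
    then show "((\<lambda>x. (1 + x) powr (e + 1) / (e + 1)) has_real_derivative (1 + x) powr e) (at x)"
      using e by (auto intro!: derivative_eq_intros)
  qed (use lim in auto)
  moreover have "(\<integral>\<^sup>+x. ennreal (indicator {0..} x *\<^sub>R (1 + \<bar>x\<bar>) powr e) \<partial>lborel)
     = (\<integral>\<^sup>+x. ennreal ((1 + x) powr e) * indicator {0..} x \<partial>lborel)"
    by (intro nn_integral_cong) (auto split: split_indicator)
  ultimately have nn: "(\<integral>\<^sup>+x. ennreal (indicator {0..} x *\<^sub>R (1 + \<bar>x\<bar>) powr e) \<partial>lborel) = ennreal (- 1 / (e + 1))"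
    by simp
  have "has_bochner_integral lborel (\<lambda>x. indicator {0..} x *\<^sub>R (1 + \<bar>x\<bar>) powr e) (- 1 / (e + 1))"
    by (rule has_bochner_integral_nn_integral[OF _ _ _ nn]) (use e in \<open>auto simp: divide_nonpos_neg\<close>)
  from has_bochner_integral_even_function[OF this] show ?thesis
    by (auto simp: has_bochner_integral_iff)
qed

text \<open>Outside a compact interval the order relation gives both bounds; on it the quotient is
  continuous and positive and attains its extrema. Using 1 + |x| instead of |x| is what makes the
  bounds global.\<close>

lemma continuous_Theta_bounds:
  fixes f :: "real \<Rightarrow> real" and e :: real
  assumes pos: "\<And>x. f x > 0" and cont: "continuous_on UNIV f"
    and th: "f \<in> \<Theta>[at_infinity](\<lambda>x. \<bar>x\<bar> powr e)"
  obtains c C where "c > 0" "C > 0" "\<And>x. c * (1 + \<bar>x\<bar>) powr e \<le> f x" "\<And>x. f x \<le> C * (1 + \<bar>x\<bar>) powr e"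
proof -
  from th obtain C1 where C1: "C1 > 0" "\<forall>\<^sub>F x in at_infinity. norm (f x) \<le> C1 * norm (\<bar>x\<bar> powr e)"
    by (auto elim!: landau_o.bigE simp: bigtheta_def)
  from th obtain C2 where C2: "C2 > 0" "\<forall>\<^sub>F x in at_infinity. norm (f x) \<ge> C2 * norm (\<bar>x\<bar> powr e)"
    by (auto elim!: landau_omega.bigE simp: bigtheta_def)
  obtain R1 where R1: "\<And>x. R1 \<le> \<bar>x\<bar> \<Longrightarrow> f x \<le> C1 * \<bar>x\<bar> powr e"
    using C1(2) pos[THEN less_imp_le] unfolding eventually_at_infinity by auto
  obtain R2 where R2: "\<And>x. R2 \<le> \<bar>x\<bar> \<Longrightarrow> C2 * \<bar>x\<bar> powr e \<le> f x"
    using C2(2) pos[THEN less_imp_le] unfolding eventually_at_infinity by auto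
  define R where "R = max 1 (max R1 R2)"
  \<comment> \<open>For |x| \<ge> 1 the numbers |x| and 1 + |x| differ by a factor of at most 2, so
    their powers differ by at most 2^|e| for either sign of e.\<close>
  define Q where "Q = (2::real) powr \<bar>e\<bar>"
  have Q: "Q \<ge> 1" unfolding Q_def by (rule ge_one_powr_ge_zero) auto
  have cmp: "\<bar>x\<bar> powr e \<le> Q * (1 + \<bar>x\<bar>) powr e" "(1 + \<bar>x\<bar>) powr e \<le> Q * \<bar>x\<bar> powr e" if "\<bar>x\<bar> \<ge> 1" for x :: real
  proof -
    have b: "\<bar>x\<bar> \<le> 1 + \<bar>x\<bar>" "1 + \<bar>x\<bar> \<le> 2 * \<bar>x\<bar>" using that by auto
    have "\<bar>x\<bar> powr e \<le> Q * (1 + \<bar>x\<bar>) powr e \<and> (1 + \<bar>x\<bar>) powr e \<le> Q * \<bar>x\<bar> powr e"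
    proof (cases "e \<ge> 0")
      case True
      have "\<bar>x\<bar> powr e \<le> (1 + \<bar>x\<bar>) powr e" using True b by (intro powr_mono2) auto
      also have "\<dots> \<le> Q * (1 + \<bar>x\<bar>) powr e" using Q by (simp add: mult_le_cancel_right1)
      finally have 1: "\<bar>x\<bar> powr e \<le> Q * (1 + \<bar>x\<bar>) powr e" .
      have "(1 + \<bar>x\<bar>) powr e \<le> (2 * \<bar>x\<bar>) powr e" using True b by (intro powr_mono2) auto
      also have "\<dots> = Q * \<bar>x\<bar> powr e" using True by (simp add: Q_def powr_mult)
      finally show ?thesis using 1 by simp
    next
      case False
      have "(1 + \<bar>x\<bar>) powr e \<le> \<bar>x\<bar> powr e" using False b that by (intro powr_mono2') auto
      also have "\<dots> \<le> Q * \<bar>x\<bar> powr e" using Q by (simp add: mult_le_cancel_right1)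
      finally have 1: "(1 + \<bar>x\<bar>) powr e \<le> Q * \<bar>x\<bar> powr e" .
      have "(2 * \<bar>x\<bar>) powr e \<le> (1 + \<bar>x\<bar>) powr e" using False b that by (intro powr_mono2') auto
      then have "Q * (2 * \<bar>x\<bar>) powr e \<le> Q * (1 + \<bar>x\<bar>) powr e" using Q by (intro mult_left_mono) auto
      moreover have "Q * (2 * \<bar>x\<bar>) powr e = \<bar>x\<bar> powr e" using False by (simp add: Q_def powr_mult powr_minus field_simps)
      ultimately show ?thesis using 1 by simp
    qed
    then show "\<bar>x\<bar> powr e \<le> Q * (1 + \<bar>x\<bar>) powr e" "(1 + \<bar>x\<bar>) powr e \<le> Q * \<bar>x\<bar> powr e" by auto
  qed
  have pw: "(1 + \<bar>x\<bar>) powr e > 0" for x :: real by (simp add: add_pos_nonneg)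
  define h where "h x = f x / (1 + \<bar>x\<bar>) powr e" for x
  have hc: "continuous_on {-R..R} h" unfolding h_def
    by (intro continuous_intros continuous_on_subset[OF cont]) (use pw in \<open>auto simp: add_pos_nonneg\<close>)
  have ne: "{-R..R} \<noteq> {}" by (auto simp: R_def)
  obtain xm where xm: "\<And>x. x \<in> {-R..R} \<Longrightarrow> h xm \<le> h x" using continuous_attains_inf[OF compact_Icc ne hc] by blast
  obtain xM where xM: "\<And>x. x \<in> {-R..R} \<Longrightarrow> h x \<le> h xM" using continuous_attains_sup[OF compact_Icc ne hc] by blast
  have hp: "h x > 0" for x using pos pw by (simp add: h_def)
  have lo: "min (h xm) (C2 / Q) \<le> h x" and up: "h x \<le> max (h xM) (C1 * Q)" for x
  proof -
    have "min (h xm) (C2 / Q) \<le> h x \<and> h x \<le> max (h xM) (C1 * Q)"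
    proof (cases "\<bar>x\<bar> \<le> R")
      case True
      then have "x \<in> {-R..R}" by auto
      then show ?thesis using xm[of x] xM[of x] by (auto simp: min_le_iff_disj le_max_iff_disj)
    next
      case False
      then have x: "\<bar>x\<bar> \<ge> 1" "R1 \<le> \<bar>x\<bar>" "R2 \<le> \<bar>x\<bar>" by (auto simp: R_def)
      have "f x \<le> C1 * (Q * (1 + \<bar>x\<bar>) powr e)"
        using R1[OF x(2)] mult_left_mono[OF cmp(1)[OF x(1)], of C1] C1 by linarith
      then have 1: "h x \<le> C1 * Q" using pw[of x] by (simp add: h_def pos_divide_le_eq mult.assoc)
      have "C2 * ((1 + \<bar>x\<bar>) powr e / Q) \<le> C2 * \<bar>x\<bar> powr e"
        using cmp(2)[OF x(1)] C2 Q by (intro mult_left_mono) (auto simp: pos_divide_le_eq mult.commute)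
      also have "\<dots> \<le> f x" by (rule R2[OF x(3)])
      finally have "C2 / Q \<le> h x" using pw[of x] by (simp add: h_def pos_le_divide_eq mult.commute)
      with 1 show ?thesis by (auto simp: min_le_iff_disj le_max_iff_disj)
    qed
    then show "min (h xm) (C2 / Q) \<le> h x" "h x \<le> max (h xM) (C1 * Q)" by auto
  qed
  have hf: "f x = h x * (1 + \<bar>x\<bar>) powr e" for x using pw[of x] by (simp add: h_def)
  show thesis
  proof (rule that[of "min (h xm) (C2 / Q)" "max (h xM) (C1 * Q)"])
    show "min (h xm) (C2 / Q) > 0" using hp C2 Q by auto
    show "max (h xM) (C1 * Q) > 0" using hp[of xM] by (simp add: less_max_iff_disj)
    show "min (h xm) (C2 / Q) * (1 + \<bar>x\<bar>) powr e \<le> f x" for x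
      unfolding hf[of x] by (intro mult_right_mono lo) simp
    show "f x \<le> max (h xM) (C1 * Q) * (1 + \<bar>x\<bar>) powr e" for x
      unfolding hf[of x] by (intro mult_right_mono up) simp
  qed
qed

text \<open>The law of a sum of n independent uniform variables on [-1, 1], whose characteristic
  function is the n-th power of sin t / t. Any polynomial rate of decay is thus available with
  bounded support.\<close>

lemma compactly_supported_decaying_char:
  "\<exists>M. real_distribution M \<and> (AE x in M. \<bar>x\<bar> \<le> real n) \<and> (\<forall>t. cmod (char M t) \<le> (2 / (1 + \<bar>t\<bar>)) ^ n)"
proof (induction n)
  case 0
  have "real_distribution (return borel (0::real))"
    by (simp add: real_distribution_def real_distribution_axioms_def prob_space_return)
  moreover have "AE x in return borel (0::real). \<bar>x\<bar> \<le> 0" by (subst AE_return) auto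
  moreover have "cmod (char M t) \<le> 1" if "real_distribution M" for M t
    using real_distribution.cmod_char_le_1[OF that] .
  ultimately show ?case by auto
next
  case (Suc n)
  then obtain M where M: "real_distribution M" "AE x in M. \<bar>x\<bar> \<le> real n"
    "\<And>t. cmod (char M t) \<le> (2 / (1 + \<bar>t\<bar>)) ^ n" by blast
  interpret M: real_distribution M by fact
  define U where "U = uniform_measure lborel {-1..1::real}"
  have U: "real_distribution U"
    unfolding real_distribution_def real_distribution_axioms_def U_def
    by (auto intro!: prob_space_uniform_measure)
  interpret U: real_distribution U by fact
  have AU: "AE x in U. \<bar>x\<bar> \<le> 1"
    unfolding U_def by (rule AE_uniform_measureI) auto
  have charU: "cmod (char U t) \<le> 2 / (1 + \<bar>t\<bar>)" for t
  proof -
    have 1: "cmod (char U t) \<le> 1" by (rule U.cmod_char_le_1)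
    have 2: "cmod (char U t) \<le> 1 / \<bar>t\<bar>" if t: "t \<noteq> 0"
    proof -
      have "U = density lborel (\<lambda>x. ennreal (indicator {-1..1} x / 2))"
        unfolding U_def uniform_measure_def
        by (intro density_cong) (auto split: split_indicator simp: divide_ennreal[of 1 2, simplified])
      then have "char U t = (CLINT x|lborel. (indicator {-1..1} x / 2) *\<^sub>R iexp (t * x))"
        unfolding char_def by (simp only:) (subst integral_density, auto)
      also have "\<dots> = (CLINT x|lborel. indicator {-1..1} x *\<^sub>R iexp (t * x)) / 2"
        by (simp add: scaleR_conv_of_real)
      also have "(CLINT x|lborel. indicator {-1..1} x *\<^sub>R iexp (t * x)) = iexp (t * 1) / (\<i> * t) - iexp (t * (-1)) / (\<i> * t)"
      proof (rule integral_FTC_Icc)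
        fix x :: real
        have "((\<lambda>x. exp (\<i> * (of_real t * of_real x)) / (\<i> * of_real t)) has_vector_derivative iexp (t * x)) (at x within {-1..1})"
        proof (rule has_vector_derivative_real_field)
          show "((\<lambda>z. exp (\<i> * (of_real t * z)) / (\<i> * of_real t)) has_field_derivative iexp (t * x)) (at (of_real x))"
            using t by (auto intro!: derivative_eq_intros simp: mult_ac)
        qed
        then show "((\<lambda>x. iexp (t * x) / (\<i> * t)) has_vector_derivative iexp (t * x)) (at x within {-1..1})"
          by simp
      qed (auto intro!: continuous_intros)
      finally have "char U t = (iexp t - iexp (- t)) / (2 * \<i> * t)" using t by (simp add: field_simps)
      then have "cmod (char U t) = cmod (iexp t - iexp (- t)) / (2 * \<bar>t\<bar>)" by (simp add: norm_divide norm_mult)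
      also have "\<dots> \<le> 2 / (2 * \<bar>t\<bar>)"
      proof (rule divide_right_mono)
        have "cmod (iexp t - iexp (- t)) \<le> cmod (iexp t) + cmod (iexp (- t))" by (rule norm_triangle_ineq4)
        then show "cmod (iexp t - iexp (- t)) \<le> 2" by simp
      qed simp
      finally show ?thesis by simp
    qed
    show ?thesis
    proof (cases "\<bar>t\<bar> \<le> 1")
      case True
      then have "1 \<le> 2 / (1 + \<bar>t\<bar>)" by simp
      then show ?thesis using 1 by linarith
    next
      case False
      then have "1 / \<bar>t\<bar> \<le> 2 / (1 + \<bar>t\<bar>)" by (simp add: field_simps)
      then show ?thesis using 2 False by force
    qed
  qed
  interpret MU: pair_prob_space M U ..
  define V where "V = distr (M \<Otimes>\<^sub>M U) borel (\<lambda>p. fst p + snd p)"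
  have [measurable_cong]: "sets M = sets borel" "sets U = sets borel" by simp_all
  have V: "real_distribution V"
    unfolding real_distribution_def real_distribution_axioms_def V_def
    by (auto intro!: MU.P.prob_space_distr)
  moreover have "AE x in V. \<bar>x\<bar> \<le> real (Suc n)"
  proof -
    have 1: "AE p in M \<Otimes>\<^sub>M U. \<bar>fst p\<bar> \<le> real n"
    proof (rule MU.AE_pair_measure)
      show "{p \<in> space (M \<Otimes>\<^sub>M U). \<bar>fst p\<bar> \<le> real n} \<in> sets (M \<Otimes>\<^sub>M U)" by measurable
    qed (use M(2) in auto)
    have 2: "AE p in M \<Otimes>\<^sub>M U. \<bar>snd p\<bar> \<le> 1"
    proof (rule MU.AE_pair_measure)
      show "{p \<in> space (M \<Otimes>\<^sub>M U). \<bar>snd p\<bar> \<le> 1} \<in> sets (M \<Otimes>\<^sub>M U)" by measurable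
    qed (use AU in auto)
    have "AE p in M \<Otimes>\<^sub>M U. \<bar>fst p + snd p\<bar> \<le> real (Suc n)"
      using 1 2 by eventually_elim auto
    then show ?thesis unfolding V_def by (subst AE_distr_iff) auto
  qed
  moreover have "char V t = char M t * char U t" for t
  proof -
    have int: "integrable (M \<Otimes>\<^sub>M U) (\<lambda>p. iexp (t * fst p) * iexp (t * snd p))"
      by (rule MU.P.integrable_const_bound[where B = 1]) (auto simp: norm_mult)
    have "char V t = (CLINT p|M \<Otimes>\<^sub>M U. iexp (t * fst p) * iexp (t * snd p))"
      unfolding char_def V_def by (subst integral_distr) (auto simp: exp_add[symmetric] algebra_simps)
    also have "\<dots> = (CLINT x|M. (CLINT y|U. iexp (t * x) * iexp (t * y)))"
      using MU.integral_fst'[OF int] by simp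
    also have "\<dots> = char M t * char U t" by (simp add: char_def)
    finally show ?thesis .
  qed
  then have "cmod (char V t) \<le> (2 / (1 + \<bar>t\<bar>)) ^ Suc n" for t
    using mult_mono[OF charU[of t] M(3)[of t]] by (simp add: norm_mult mult.commute)
  ultimately show ?case by blast
qed

text \<open>The kernel is the Fourier transform of a smoothed indicator of an interval, and its
  reproducing property is the inversion theorem applied to the smoothing law.\<close>

lemma reproducing_kernel:
  assumes L: "L > 0" and n: "n \<ge> 2"
  obtains \<kappa> :: "real \<Rightarrow> complex" and C :: real where "C > 0" "\<kappa> \<in> borel_measurable lborel"
    "\<And>u. cmod (\<kappa> u) \<le> C * (1 + \<bar>u\<bar>) powr (- real n)"
    "\<And>t. t \<in> {0..L} \<Longrightarrow> (CLINT u|lborel. \<kappa> u * iexp (- (u * t))) = 1"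
proof -
  obtain M where M: "real_distribution M" "AE x in M. \<bar>x\<bar> \<le> real n"
    "\<And>t. cmod (char M t) \<le> (2 / (1 + \<bar>t\<bar>)) ^ n" using compactly_supported_decaying_char[of n] by blast
  interpret M: real_distribution M by fact
  \<comment> \<open>The smoothing law lives on [-n, n]; moved by any t in [0, L] it still lies
    strictly inside (-R, R). The inversion formula for this interval therefore yields the full mass
    1.\<close>
  define R where "R = L + real n + 1"
  have R: "R > 0" using L by (simp add: R_def)
  \<comment> \<open>The factor attached to the interval from -R to R by Levy's inversion formula. At
    u = 0 division by zero gives the value 0, which is harmless on a null set.\<close>
  define s where "s u = (iexp (u * R) - iexp (- (u * R))) / (\<i> * of_real u)" for u :: real
  define \<kappa> where "\<kappa> u = 1 / (2 * pi) * s u * char M u" for u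
  have s_meas[measurable]: "s \<in> borel_measurable borel" unfolding s_def by measurable
  have \<kappa>_meas[measurable]: "\<kappa> \<in> borel_measurable borel" unfolding \<kappa>_def by measurable
  have s_le: "cmod (s u) \<le> 2 * R" for u
  proof (cases "u = 0")
    case False
    then show ?thesis using Levy_Inversion_aux2[of "- R" R u] R by (simp add: s_def)
  qed (use R in \<open>simp add: s_def\<close>)
  have \<kappa>_le: "cmod (\<kappa> u) \<le> (R / pi * 2 ^ n) * (1 + \<bar>u\<bar>) powr (- real n)" for u
  proof -
    have "cmod (\<kappa> u) = 1 / (2 * pi) * (cmod (s u) * cmod (char M u))"
      by (simp add: \<kappa>_def norm_mult norm_divide)
    also have "\<dots> \<le> 1 / (2 * pi) * ((2 * R) * (2 / (1 + \<bar>u\<bar>)) ^ n)"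
      using R by (intro mult_left_mono mult_mono s_le M(3)) auto
    also have "(2 / (1 + \<bar>u\<bar>)) ^ n = 2 ^ n * (1 + \<bar>u\<bar>) powr (- real n)"
      by (simp add: power_divide powr_minus powr_realpow add_pos_nonneg divide_inverse power_inverse)
    finally show ?thesis by simp
  qed
  have int: "integrable lborel (\<lambda>u. (1 + \<bar>u\<bar>) powr (- real n))"
    using n by (intro integrable_one_plus_abs_powr) auto
  have rep: "(CLINT u|lborel. \<kappa> u * iexp (- (u * t))) = 1" if t: "t \<in> {0..L}" for t
  proof -
    define N where "N = distr M borel (\<lambda>x. x - t)"
    have N: "real_distribution N"
      unfolding real_distribution_def real_distribution_axioms_def N_def
      by (auto intro!: M.prob_space_distr)
    interpret N: real_distribution N by fact
    have AN: "AE x in N. - R < x \<and> x < R"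
    proof -
      have "AE x in M. - R < x - t \<and> x - t < R" using M(2) by eventually_elim (use t in \<open>auto simp: R_def\<close>)
      then show ?thesis unfolding N_def by (subst AE_distr_iff) auto
    qed
    have "AE x in N. x \<notin> {- R}" "AE x in N. x \<notin> {R}" "AE x in N. x \<in> {- R<..R}"
      using AN by (eventually_elim; simp)+
    then have null: "measure N {- R} = 0" "measure N {R} = 0" and full: "measure N {- R<..R} = 1"
      by (simp_all add: N.prob_eq_0 N.prob_eq_1)
    have charN: "char N u = iexp (- (u * t)) * char M u" for u
    proof -
      have "char N u = (CLINT x|M. iexp (- (u * t)) * iexp (u * x))"
        unfolding char_def N_def by (subst integral_distr) (auto simp: exp_add[symmetric] algebra_simps)
      also have "\<dots> = iexp (- (u * t)) * char M u" unfolding char_def by (rule integral_mult_right_zero)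
      finally show ?thesis .
    qed
    define g where "g u = s u * char N u" for u
    have g_meas[measurable]: "g \<in> borel_measurable borel" unfolding g_def by measurable
    have g\<kappa>: "\<kappa> u * iexp (- (u * t)) = 1 / (2 * pi) * g u" for u
      by (simp add: \<kappa>_def g_def charN)
    have "cmod (g u) = 2 * pi * cmod (\<kappa> u)" for u
      using arg_cong[OF g\<kappa>[of u], of cmod] by (simp add: norm_mult norm_divide field_simps)
    then have g_le: "cmod (g u) \<le> 2 * pi * ((R / pi * 2 ^ n) * (1 + \<bar>u\<bar>) powr (- real n))" for u
      using mult_left_mono[OF \<kappa>_le[of u], of "2 * pi"] by simp
    \<comment> \<open>The inversion formula speaks of limits of truncated integrals; the decay of
      the kernel turns the limit into an integral.\<close>
    have lim1: "(\<lambda>T. CLINT u|lborel. indicator {- real T<..<real T} u *\<^sub>R g u) \<longlonglongrightarrow> (CLINT u|lborel. g u)"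
    proof (rule integral_dominated_convergence[where w = "\<lambda>u. 2 * pi * ((R / pi * 2 ^ n) * (1 + \<bar>u\<bar>) powr (- real n))"])
      show "AE u in lborel. (\<lambda>T. indicator {- real T<..<real T} u *\<^sub>R g u) \<longlonglongrightarrow> g u"
      proof (intro AE_I2 tendsto_eventually)
        fix u :: real
        obtain T0 :: nat where T0: "\<bar>u\<bar> < real T0" using reals_Archimedean2 by blast
        show "\<forall>\<^sub>F T in sequentially. indicator {- real T<..<real T} u *\<^sub>R g u = g u"
          using eventually_ge_at_top[of T0]
        proof eventually_elim
          case (elim T)
          then have "\<bar>u\<bar> < real T" using T0 by linarith
          then show ?case by (simp add: indicator_def abs_less_iff)
        qed
      qed
      show "AE u in lborel. cmod (indicator {- real T<..<real T} u *\<^sub>R g u) \<le> 2 * pi * ((R / pi * 2 ^ n) * (1 + \<bar>u\<bar>) powr (- real n))" for T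
        using g_le R by (auto split: split_indicator)
    qed (use int in auto)
    have "(\<lambda>T. 1 / (2 * pi) * (CLINT u|lborel. indicator {- real T<..<real T} u *\<^sub>R g u)) \<longlonglongrightarrow> 1"
      using N.Levy_Inversion[of "- R" R] R null full
      unfolding interval_lebesgue_integral_def set_lebesgue_integral_def by (simp add: g_def s_def)
    moreover have "(\<lambda>T. 1 / (2 * pi) * (CLINT u|lborel. indicator {- real T<..<real T} u *\<^sub>R g u)) \<longlonglongrightarrow> 1 / (2 * pi) * (CLINT u|lborel. g u)"
      by (intro tendsto_mult tendsto_const lim1)
    ultimately have "1 / (2 * pi) * (CLINT u|lborel. g u) = 1" by (rule LIMSEQ_unique[rotated])
    then show ?thesis unfolding g\<kappa> by simp
  qed
  show thesis by (rule that[of "R / pi * 2 ^ n" \<kappa>]) (use R \<kappa>_le rep in auto)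
qed

text \<open>For a maximal orthonormal family of the \<open>K2\<close>-form the first sum is the
  trace of Q_2^(-1) Q_1 and the second the squared kernel norm of the constant function, which
  accounts for a non-zero mean. Both follow from one pointwise bound: the sum of |p_k(\<omega>)|^2
  is at most a multiple of (1 + |\<omega>|)^(\<alpha>2 + 1). Integration against \<open>f1\<close>
  gives the first, \<omega> = 0 the second.\<close>

lemma spectral_trace_bound:
  fixes \<alpha>1 \<alpha>2 :: real
  assumes L: "L > 0" and sd1: "spectral_density K1 f1" and sd2: "spectral_density K2 f2"
    and pos: "\<And>x. f1 x > 0" "\<And>x. f2 x > 0" and cont: "continuous_on UNIV f1" "continuous_on UNIV f2"
    and th1: "f1 \<in> \<Theta>[at_infinity](\<lambda>x. \<bar>x\<bar> powr (- (\<alpha>1 + 1)))"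
    and th2: "f2 \<in> \<Theta>[at_infinity](\<lambda>x. \<bar>x\<bar> powr (- (\<alpha>2 + 1)))"
    and \<alpha>: "\<alpha>1 > \<alpha>2 + 1" "\<alpha>2 > 0"
  obtains C where "C > 0" "\<And>F J (b :: nat \<Rightarrow> real \<Rightarrow> real). finite F \<Longrightarrow> F \<subseteq> {0..L} \<Longrightarrow> finite J \<Longrightarrow>
     (\<And>k l. k \<in> J \<Longrightarrow> l \<in> J \<Longrightarrow> (\<Sum>s\<in>F. \<Sum>t\<in>F. b k s * b l t * K2 (s - t)) = (if k = l then 1 else 0)) \<Longrightarrow>
     (\<Sum>k\<in>J. \<Sum>s\<in>F. \<Sum>t\<in>F. b k s * b k t * K1 (s - t)) \<le> C \<and> (\<Sum>k\<in>J. (\<Sum>s\<in>F. b k s)\<^sup>2) \<le> C"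
proof -
  obtain c1 C1 where f1: "c1 > 0" "C1 > 0" "\<And>x. c1 * (1 + \<bar>x\<bar>) powr (- (\<alpha>1 + 1)) \<le> f1 x"
    "\<And>x. f1 x \<le> C1 * (1 + \<bar>x\<bar>) powr (- (\<alpha>1 + 1))"
    by (rule continuous_Theta_bounds[OF pos(1) cont(1) th1]; rule that; assumption)
  obtain c2 C2 where f2: "c2 > 0" "C2 > 0" "\<And>x. c2 * (1 + \<bar>x\<bar>) powr (- (\<alpha>2 + 1)) \<le> f2 x"
    "\<And>x. f2 x \<le> C2 * (1 + \<bar>x\<bar>) powr (- (\<alpha>2 + 1))"
    by (rule continuous_Theta_bounds[OF pos(2) cont(2) th2]; rule that; assumption)
  define q where "q = \<alpha>2 + 1"
  \<comment> \<open>The decay order is chosen so large that q - 2 n < -1, which makes the squared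
    kernel integrable against the growth of 1 / f2.\<close>
  define n where "n = nat \<lceil>q\<rceil> + 2"
  have q: "q > 1" using \<alpha> by (simp add: q_def)
  have n: "n \<ge> 2" "real n \<ge> q + 2" unfolding n_def by linarith+
  obtain \<kappa> :: "real \<Rightarrow> complex" and Ck where Ck: "Ck > 0" and km: "\<kappa> \<in> borel_measurable lborel"
    and kb: "\<And>u. cmod (\<kappa> u) \<le> Ck * (1 + \<bar>u\<bar>) powr (- real n)"
    and kr: "\<And>t. t \<in> {0..L} \<Longrightarrow> (CLINT u|lborel. \<kappa> u * iexp (- (u * t))) = 1"
    by (rule reproducing_kernel[OF L n(1)]; rule that; assumption)
  have km'[measurable]: "\<kappa> \<in> borel_measurable borel" using km by simp
  define I where "I = (LINT u|lborel. (1 + \<bar>u\<bar>) powr (q - 2 * real n))"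
  have Iint: "integrable lborel (\<lambda>u. (1 + \<bar>u\<bar>) powr (q - 2 * real n))"
    using n q by (intro integrable_one_plus_abs_powr) auto
  have I0: "I \<ge> 0" unfolding I_def by (intro Bochner_Integration.integral_nonneg) auto
  define C3 where "C3 = Ck\<^sup>2 / c2 * I"
  have C3: "C3 \<ge> 0" using I0 f2 by (simp add: C3_def)
  \<comment> \<open>By Peetre's inequality 1 + |v| \<le> (1 + |\<omega>|) (1 + |\<omega> - v|), the
    growth of 1 / f2 splits into a factor depending on \<omega> alone and one whose integral over v
    does not depend on \<omega>.\<close>
  define bd where "bd \<omega> v = Ck\<^sup>2 / c2 * (1 + \<bar>\<omega>\<bar>) powr q * (1 + \<bar>\<omega> - v\<bar>) powr (q - 2 * real n)" for \<omega> v
  have bd_int: "integrable lborel (bd \<omega>)" "(LINT v|lborel. bd \<omega> v) = C3 * (1 + \<bar>\<omega>\<bar>) powr q" for \<omega>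
  proof -
    have 1: "integrable lborel (\<lambda>v. (1 + \<bar>\<omega> - v\<bar>) powr (q - 2 * real n))"
      using lborel_integrable_real_affine[OF Iint, of "-1" \<omega>] by simp
    have 2: "(LINT v|lborel. (1 + \<bar>\<omega> - v\<bar>) powr (q - 2 * real n)) = I"
      using lborel_integral_real_affine[of "-1" "\<lambda>u. (1 + \<bar>u\<bar>) powr (q - 2 * real n)" \<omega>] by (simp add: I_def)
    show "integrable lborel (bd \<omega>)" unfolding bd_def by (intro integrable_mult_right 1)
    show "(LINT v|lborel. bd \<omega> v) = C3 * (1 + \<bar>\<omega>\<bar>) powr q"
      unfolding bd_def by (simp add: 2 C3_def)
  qed
  have bd: "(cmod (\<kappa> (\<omega> - v)))\<^sup>2 / f2 v \<le> bd \<omega> v" for \<omega> v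
  proof -
    have "(cmod (\<kappa> (\<omega> - v)))\<^sup>2 / f2 v \<le> (Ck * (1 + \<bar>\<omega> - v\<bar>) powr (- real n))\<^sup>2 / (c2 * (1 + \<bar>v\<bar>) powr (- q))"
      using f2(3)[of v] f2(1) kb[of "\<omega> - v"] by (intro frac_le power_mono) (auto simp: q_def add_pos_nonneg)
    also have "\<dots> = Ck\<^sup>2 / c2 * ((1 + \<bar>v\<bar>) powr q * (1 + \<bar>\<omega> - v\<bar>) powr (- 2 * real n))"
    proof -
      have "((1 + \<bar>\<omega> - v\<bar>) powr (- real n))\<^sup>2 = (1 + \<bar>\<omega> - v\<bar>) powr (- 2 * real n)"
        by (simp only: power2_eq_square powr_add[symmetric]) simp
      moreover have "inverse ((1 + \<bar>v\<bar>) powr (- q)) = (1 + \<bar>v\<bar>) powr q" by (simp add: powr_minus)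
      ultimately show ?thesis
        by (simp only: power_mult_distrib divide_inverse inverse_mult_distrib) (simp only: mult_ac)
    qed
    also have "\<dots> \<le> Ck\<^sup>2 / c2 * (((1 + \<bar>\<omega>\<bar>) powr q * (1 + \<bar>\<omega> - v\<bar>) powr q) * (1 + \<bar>\<omega> - v\<bar>) powr (- 2 * real n))"
    proof (intro mult_left_mono mult_right_mono)
      have "1 + \<bar>v\<bar> \<le> (1 + \<bar>\<omega>\<bar>) * (1 + \<bar>\<omega> - v\<bar>)"
      proof -
        have "0 \<le> \<bar>\<omega>\<bar> * \<bar>\<omega> - v\<bar>" by simp
        moreover have "(1 + \<bar>\<omega>\<bar>) * (1 + \<bar>\<omega> - v\<bar>) = 1 + \<bar>\<omega>\<bar> + \<bar>\<omega> - v\<bar> + \<bar>\<omega>\<bar> * \<bar>\<omega> - v\<bar>"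
          by (simp add: algebra_simps)
        ultimately show ?thesis by linarith
      qed
      then have "(1 + \<bar>v\<bar>) powr q \<le> ((1 + \<bar>\<omega>\<bar>) * (1 + \<bar>\<omega> - v\<bar>)) powr q" using q by (intro powr_mono2) auto
      then show "(1 + \<bar>v\<bar>) powr q \<le> (1 + \<bar>\<omega>\<bar>) powr q * (1 + \<bar>\<omega> - v\<bar>) powr q" by (simp add: powr_mult)
    qed (use f2 in auto)
    also have "\<dots> = bd \<omega> v"
      by (simp add: bd_def powr_add[symmetric] mult.assoc)
    finally show ?thesis .
  qed
  \<comment> \<open>The exponent is q - (\<alpha>1 + 1); it lies below -1 exactly when \<alpha>1 >
    \<alpha>2 + 1.\<close>
  have Jint: "integrable lborel (\<lambda>u. (1 + \<bar>u\<bar>) powr (\<alpha>2 - \<alpha>1))"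
    using \<alpha> by (intro integrable_one_plus_abs_powr) auto
  define J0 where "J0 = (LINT u|lborel. (1 + \<bar>u\<bar>) powr (\<alpha>2 - \<alpha>1))"
  have J0: "J0 \<ge> 0" unfolding J0_def by (intro Bochner_Integration.integral_nonneg) auto
  have main: "(\<Sum>k\<in>J. \<Sum>s\<in>F. \<Sum>t\<in>F. b k s * b k t * K1 (s - t)) \<le> C3 * C1 * J0 \<and> (\<Sum>k\<in>J. (\<Sum>s\<in>F. b k s)\<^sup>2) \<le> C3"
    if F: "finite F" "F \<subseteq> {0..L}" and J: "finite J" and
      orth: "\<And>k l. k \<in> J \<Longrightarrow> l \<in> J \<Longrightarrow> (\<Sum>s\<in>F. \<Sum>t\<in>F. b k s * b l t * K2 (s - t)) = (if k = l then 1 else 0)"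
    for F J and b :: "nat \<Rightarrow> real \<Rightarrow> real"
  proof -
    \<comment> \<open>The trigonometric polynomial of the k-th functional; the spectral
      representation turns the forms of \<open>K1\<close> and \<open>K2\<close> into integrals of
      products of these against \<open>f1\<close> and \<open>f2\<close>.\<close>
    define p where "p k \<omega> = (\<Sum>s\<in>F. of_real (b k s) * iexp (\<omega> * s))" for k \<omega>
    have pm[measurable]: "p k \<in> borel_measurable borel" for k unfolding p_def by measurable
    have spec: "integrable lborel (\<lambda>v. p k v * cnj (p l v) * of_real (f v)) \<and>
        (CLINT v|lborel. p k v * cnj (p l v) * of_real (f v)) = of_real (\<Sum>s\<in>F. \<Sum>t\<in>F. b k s * b l t * K (s - t))"
      if sd: "spectral_density K f" for K f k l
    proof -
      have fi: "integrable lborel f" and K: "\<And>t. (CLINT v|lborel. iexp (v * t) * of_real (f v)) = of_real (K t)"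
        using sd unfolding spectral_density_def by auto
      have i: "integrable lborel (\<lambda>v. iexp (v * t) * of_real (f v))" for t
        by (rule Bochner_Integration.integrable_bound[OF fi])
          (use borel_measurable_integrable[OF fi] in \<open>auto simp: norm_mult\<close>)
      have eq: "p k v * cnj (p l v) * of_real (f v) = (\<Sum>s\<in>F. \<Sum>t\<in>F. of_real (b k s * b l t) * (iexp (v * (s - t)) * of_real (f v)))" for v
      proof -
        have e: "iexp (v * (s - t)) = iexp (v * s) * cnj (iexp (v * t))" for s t
          by (simp add: exp_cnj exp_add[symmetric] algebra_simps)
        have "p k v * cnj (p l v) = (\<Sum>s\<in>F. \<Sum>t\<in>F. of_real (b k s * b l t) * iexp (v * (s - t)))"
          unfolding p_def cnj_sum sum_product e by (intro sum.cong refl) (simp add: mult_ac)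
        then show ?thesis unfolding sum_distrib_right by (simp only: sum_distrib_right mult.assoc)
      qed
      have ii: "integrable lborel (\<lambda>v. of_real (b k s * b l t) * (iexp (v * (s - t)) * of_real (f v)))" for s t
        by (intro integrable_mult_right i)
      have "(CLINT v|lborel. p k v * cnj (p l v) * of_real (f v))
         = (\<Sum>s\<in>F. (CLINT v|lborel. \<Sum>t\<in>F. of_real (b k s * b l t) * (iexp (v * (s - t)) * of_real (f v))))"
        unfolding eq by (intro Bochner_Integration.integral_sum Bochner_Integration.integrable_sum ii)
      also have "\<dots> = (\<Sum>s\<in>F. \<Sum>t\<in>F. (CLINT v|lborel. of_real (b k s * b l t) * (iexp (v * (s - t)) * of_real (f v))))"
        by (intro sum.cong refl Bochner_Integration.integral_sum ii)
      also have "\<dots> = (\<Sum>s\<in>F. \<Sum>t\<in>F. of_real (b k s * b l t) * of_real (K (s - t)))"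
        by (intro sum.cong refl) (simp only: integral_mult_right_zero K)
      finally have "(CLINT v|lborel. p k v * cnj (p l v) * of_real (f v)) = of_real (\<Sum>s\<in>F. \<Sum>t\<in>F. b k s * b l t * K (s - t))"
        by simp
      moreover have "integrable lborel (\<lambda>v. p k v * cnj (p l v) * of_real (f v))"
        unfolding eq by (intro Bochner_Integration.integrable_sum ii)
      ultimately show ?thesis by simp
    qed
    have kint: "integrable lborel \<kappa>"
    proof (rule Bochner_Integration.integrable_bound)
      show "integrable lborel (\<lambda>u. Ck * (1 + \<bar>u\<bar>) powr (- real n))"
        using n by (intro integrable_mult_right integrable_one_plus_abs_powr) auto
      show "AE u in lborel. cmod (\<kappa> u) \<le> norm (Ck * (1 + \<bar>u\<bar>) powr (- real n))"
        using kb Ck by (auto simp: abs_mult)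
    qed simp
    have rep_exp: "integrable lborel (\<lambda>v. \<kappa> (\<omega> - v) * iexp (v * t)) \<and> (CLINT v|lborel. \<kappa> (\<omega> - v) * iexp (v * t)) = iexp (\<omega> * t)"
      if t: "t \<in> {0..L}" for \<omega> t
    proof -
      have i: "integrable lborel (\<lambda>u. \<kappa> u * iexp ((\<omega> - u) * t))"
        by (rule Bochner_Integration.integrable_bound[OF kint]) (auto simp: norm_mult)
      have "(CLINT v|lborel. \<kappa> (\<omega> - v) * iexp (v * t)) = (CLINT u|lborel. \<kappa> u * iexp ((\<omega> - u) * t))"
        using lborel_integral_real_affine[of "-1" "\<lambda>u. \<kappa> u * iexp ((\<omega> - u) * t)" \<omega>] by simp
      also have "\<dots> = (CLINT u|lborel. iexp (\<omega> * t) * (\<kappa> u * iexp (- (u * t))))"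
        by (intro Bochner_Integration.integral_cong refl) (simp add: exp_add[symmetric] exp_diff exp_minus algebra_simps divide_inverse)
      also have "\<dots> = iexp (\<omega> * t)" by (simp only: integral_mult_right_zero kr[OF t] mult_1_right)
      finally show ?thesis using lborel_integrable_real_affine[OF i, of "-1" \<omega>] by simp
    qed
    have rep: "integrable lborel (\<lambda>v. \<kappa> (\<omega> - v) * p k v) \<and> (CLINT v|lborel. \<kappa> (\<omega> - v) * p k v) = p k \<omega>" for k \<omega>
    proof -
      have eq: "\<kappa> (\<omega> - v) * p k v = (\<Sum>s\<in>F. of_real (b k s) * (\<kappa> (\<omega> - v) * iexp (v * s)))" for v
        unfolding p_def sum_distrib_left by (intro sum.cong refl) (simp add: mult_ac)
      have ii: "integrable lborel (\<lambda>v. of_real (b k s) * (\<kappa> (\<omega> - v) * iexp (v * s)))" if "s \<in> F" for s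
        using rep_exp[of s \<omega>] F that by (intro integrable_mult_right) auto
      have "(CLINT v|lborel. \<kappa> (\<omega> - v) * p k v) = (\<Sum>s\<in>F. (CLINT v|lborel. of_real (b k s) * (\<kappa> (\<omega> - v) * iexp (v * s))))"
        unfolding eq by (intro Bochner_Integration.integral_sum ii)
      also have "\<dots> = p k \<omega>" unfolding p_def
        using rep_exp F by (intro sum.cong refl) (simp only: integral_mult_right_zero, auto)
      finally have 1: "(CLINT v|lborel. \<kappa> (\<omega> - v) * p k v) = p k \<omega>" .
      have "integrable lborel (\<lambda>v. \<kappa> (\<omega> - v) * p k v)"
        unfolding eq by (intro Bochner_Integration.integrable_sum ii)
      with 1 show ?thesis by simp
    qed
    text \<open>With \<open>Q = \<Sum>k. cnj (p k \<omega>) p k\<close>, both the value \<open>Q \<omega>\<close> and the squared norm of \<open>Q\<close> in the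
      spectral space of \<open>K2\<close> equal \<open>\<Sum>k. \<bar>p k \<omega>\<bar>\<^sup>2\<close>; the reproducing property and the arithmetic-geometric
      mean inequality then bound this number.\<close>
    have diag: "(\<Sum>k\<in>J. (cmod (p k \<omega>))\<^sup>2) \<le> C3 * (1 + \<bar>\<omega>\<bar>) powr q" for \<omega>
    proof -
      define S where "S = (\<Sum>k\<in>J. (cmod (p k \<omega>))\<^sup>2)"
      define Q where "Q v = (\<Sum>k\<in>J. cnj (p k \<omega>) * p k v)" for v
      have Qm[measurable]: "Q \<in> borel_measurable borel" unfolding Q_def by measurable
      have kQ: "integrable lborel (\<lambda>v. \<kappa> (\<omega> - v) * Q v)" "(CLINT v|lborel. \<kappa> (\<omega> - v) * Q v) = of_real S"
      proof -
        have eq: "\<kappa> (\<omega> - v) * Q v = (\<Sum>k\<in>J. cnj (p k \<omega>) * (\<kappa> (\<omega> - v) * p k v))" for v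
          unfolding Q_def sum_distrib_left by (intro sum.cong refl) (simp add: mult_ac)
        have ii: "integrable lborel (\<lambda>v. cnj (p k \<omega>) * (\<kappa> (\<omega> - v) * p k v))" for k
          using rep by (intro integrable_mult_right) auto
        show "integrable lborel (\<lambda>v. \<kappa> (\<omega> - v) * Q v)"
          unfolding eq by (intro Bochner_Integration.integrable_sum ii)
        have "(CLINT v|lborel. \<kappa> (\<omega> - v) * Q v) = (\<Sum>k\<in>J. (CLINT v|lborel. cnj (p k \<omega>) * (\<kappa> (\<omega> - v) * p k v)))"
          unfolding eq by (intro Bochner_Integration.integral_sum ii)
        also have "\<dots> = (\<Sum>k\<in>J. cnj (p k \<omega>) * p k \<omega>)" using rep by (simp only: integral_mult_right_zero)
        also have "\<dots> = of_real S" unfolding S_def of_real_sum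
          by (intro sum.cong refl) (simp only: complex_norm_square mult.commute)
        finally show "(CLINT v|lborel. \<kappa> (\<omega> - v) * Q v) = of_real S" .
      qed
      have Q2: "integrable lborel (\<lambda>v. (cmod (Q v))\<^sup>2 * f2 v)" "(LINT v|lborel. (cmod (Q v))\<^sup>2 * f2 v) = S"
      proof -
        have eq: "of_real ((cmod (Q v))\<^sup>2 * f2 v) = (\<Sum>k\<in>J. \<Sum>l\<in>J. (cnj (p k \<omega>) * p l \<omega>) * (p k v * cnj (p l v) * of_real (f2 v)))" for v
        proof -
          have "of_real ((cmod (Q v))\<^sup>2) = (\<Sum>k\<in>J. \<Sum>l\<in>J. (cnj (p k \<omega>) * p l \<omega>) * (p k v * cnj (p l v)))"
            unfolding complex_norm_square Q_def cnj_sum sum_product by (intro sum.cong refl) (simp add: mult_ac)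
          then show ?thesis by (simp only: of_real_mult sum_distrib_right mult.assoc)
        qed
        have ii: "integrable lborel (\<lambda>v. (cnj (p k \<omega>) * p l \<omega>) * (p k v * cnj (p l v) * of_real (f2 v)))" for k l
          using spec[OF sd2] by (intro integrable_mult_right) auto
        have i: "integrable lborel (\<lambda>v. of_real ((cmod (Q v))\<^sup>2 * f2 v) :: complex)"
          unfolding eq by (intro Bochner_Integration.integrable_sum ii)
        then show "integrable lborel (\<lambda>v. (cmod (Q v))\<^sup>2 * f2 v)" by (simp only: complex_of_real_integrable_eq)
        have "of_real (LINT v|lborel. (cmod (Q v))\<^sup>2 * f2 v) = (CLINT v|lborel. of_real ((cmod (Q v))\<^sup>2 * f2 v))"
          by (rule integral_complex_of_real[symmetric])
        also have "\<dots> = (\<Sum>k\<in>J. (CLINT v|lborel. \<Sum>l\<in>J. (cnj (p k \<omega>) * p l \<omega>) * (p k v * cnj (p l v) * of_real (f2 v))))"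
          unfolding eq by (intro Bochner_Integration.integral_sum Bochner_Integration.integrable_sum ii)
        also have "\<dots> = (\<Sum>k\<in>J. \<Sum>l\<in>J. (CLINT v|lborel. (cnj (p k \<omega>) * p l \<omega>) * (p k v * cnj (p l v) * of_real (f2 v))))"
          by (intro sum.cong refl Bochner_Integration.integral_sum ii)
        also have "\<dots> = (\<Sum>k\<in>J. \<Sum>l\<in>J. (cnj (p k \<omega>) * p l \<omega>) * (if k = l then 1 else 0))"
          using spec[OF sd2] orth by (intro sum.cong refl) (simp only: integral_mult_right_zero, simp)
        also have "\<dots> = (\<Sum>k\<in>J. cnj (p k \<omega>) * p k \<omega>)" using J by (simp add: if_distrib[of "\<lambda>x. _ * x"] cong: if_cong)
        also have "\<dots> = of_real S" unfolding S_def of_real_sum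
          by (intro sum.cong refl) (simp only: complex_norm_square mult.commute)
        finally show "(LINT v|lborel. (cmod (Q v))\<^sup>2 * f2 v) = S" by (simp only: of_real_eq_iff)
      qed
      have "norm (CLINT v|lborel. \<kappa> (\<omega> - v) * Q v) \<le> (LINT v|lborel. (bd \<omega> v + (cmod (Q v))\<^sup>2 * f2 v) / 2)"
      proof (rule Bochner_Integration.integral_norm_bound_integral)
        show "integrable lborel (\<lambda>v. (bd \<omega> v + (cmod (Q v))\<^sup>2 * f2 v) / 2)" using bd_int(1) Q2(1) by simp
        fix v
        define x y where "x = cmod (\<kappa> (\<omega> - v)) / sqrt (f2 v)" and "y = cmod (Q v) * sqrt (f2 v)"
        have f: "f2 v > 0" by (rule pos)
        have "norm (\<kappa> (\<omega> - v) * Q v) = x * y" using f by (simp add: x_def y_def norm_mult)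
        also have "\<dots> \<le> (x\<^sup>2 + y\<^sup>2) / 2" using sum_squares_bound[of x y] by simp
        also have "\<dots> = ((cmod (\<kappa> (\<omega> - v)))\<^sup>2 / f2 v + (cmod (Q v))\<^sup>2 * f2 v) / 2"
          using f by (simp add: x_def y_def power_divide power_mult_distrib)
        also have "\<dots> \<le> (bd \<omega> v + (cmod (Q v))\<^sup>2 * f2 v) / 2"
          by (intro divide_right_mono add_right_mono bd) simp
        finally show "norm (\<kappa> (\<omega> - v) * Q v) \<le> (bd \<omega> v + (cmod (Q v))\<^sup>2 * f2 v) / 2" .
      qed (rule kQ)
      also have "\<dots> = (C3 * (1 + \<bar>\<omega>\<bar>) powr q + S) / 2" using bd_int Q2 by simp
      finally have "S \<le> (C3 * (1 + \<bar>\<omega>\<bar>) powr q + S) / 2"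
        unfolding kQ(2) by simp
      then show ?thesis by (simp add: S_def)
    qed
    have "(\<Sum>k\<in>J. (\<Sum>s\<in>F. b k s)\<^sup>2) = (\<Sum>k\<in>J. (cmod (p k 0))\<^sup>2)"
      by (intro sum.cong refl) (simp add: p_def of_real_sum[symmetric] del: of_real_sum)
    then have part2: "(\<Sum>k\<in>J. (\<Sum>s\<in>F. b k s)\<^sup>2) \<le> C3" using diag[of 0] by simp
    have p2: "integrable lborel (\<lambda>v. (cmod (p k v))\<^sup>2 * f1 v)"
      "(LINT v|lborel. (cmod (p k v))\<^sup>2 * f1 v) = (\<Sum>s\<in>F. \<Sum>t\<in>F. b k s * b k t * K1 (s - t))" for k
    proof -
      have eq: "of_real ((cmod (p k v))\<^sup>2 * f1 v) = p k v * cnj (p k v) * of_real (f1 v)" for v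
        by (simp only: of_real_mult complex_norm_square)
      have "integrable lborel (\<lambda>v. of_real ((cmod (p k v))\<^sup>2 * f1 v) :: complex)" unfolding eq using spec[OF sd1] by blast
      then show "integrable lborel (\<lambda>v. (cmod (p k v))\<^sup>2 * f1 v)" by (simp only: complex_of_real_integrable_eq)
      have "of_real (LINT v|lborel. (cmod (p k v))\<^sup>2 * f1 v) = (CLINT v|lborel. of_real ((cmod (p k v))\<^sup>2 * f1 v))"
        by (rule integral_complex_of_real[symmetric])
      also have "\<dots> = of_real (\<Sum>s\<in>F. \<Sum>t\<in>F. b k s * b k t * K1 (s - t))" unfolding eq using spec[OF sd1] by blast
      finally show "(LINT v|lborel. (cmod (p k v))\<^sup>2 * f1 v) = (\<Sum>s\<in>F. \<Sum>t\<in>F. b k s * b k t * K1 (s - t))"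
        by (simp only: of_real_eq_iff)
    qed
    have "(\<Sum>k\<in>J. \<Sum>s\<in>F. \<Sum>t\<in>F. b k s * b k t * K1 (s - t)) = (LINT v|lborel. (\<Sum>k\<in>J. (cmod (p k v))\<^sup>2 * f1 v))"
      unfolding p2(2)[symmetric] by (intro Bochner_Integration.integral_sum[symmetric] p2)
    also have "\<dots> \<le> (LINT v|lborel. C3 * C1 * (1 + \<bar>v\<bar>) powr (\<alpha>2 - \<alpha>1))"
    proof (rule integral_mono)
      show "integrable lborel (\<lambda>v. \<Sum>k\<in>J. (cmod (p k v))\<^sup>2 * f1 v)" by (intro Bochner_Integration.integrable_sum p2)
      show "integrable lborel (\<lambda>v. C3 * C1 * (1 + \<bar>v\<bar>) powr (\<alpha>2 - \<alpha>1))" by (intro integrable_mult_right Jint)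
      fix v :: real
      have "(\<Sum>k\<in>J. (cmod (p k v))\<^sup>2 * f1 v) = (\<Sum>k\<in>J. (cmod (p k v))\<^sup>2) * f1 v" by (simp add: sum_distrib_right)
      also have "\<dots> \<le> (C3 * (1 + \<bar>v\<bar>) powr q) * (C1 * (1 + \<bar>v\<bar>) powr (- (\<alpha>1 + 1)))"
        using pos(1)[of v] C3 by (intro mult_mono diag f1(4)) (auto intro: less_imp_le)
      also have "\<dots> = C3 * C1 * ((1 + \<bar>v\<bar>) powr q * (1 + \<bar>v\<bar>) powr (- (\<alpha>1 + 1)))" by simp
      also have "(1 + \<bar>v\<bar>) powr q * (1 + \<bar>v\<bar>) powr (- (\<alpha>1 + 1)) = (1 + \<bar>v\<bar>) powr (\<alpha>2 - \<alpha>1)"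
        by (simp add: powr_add[symmetric] q_def)
      finally show "(\<Sum>k\<in>J. (cmod (p k v))\<^sup>2 * f1 v) \<le> C3 * C1 * (1 + \<bar>v\<bar>) powr (\<alpha>2 - \<alpha>1)" .
    qed
    also have "\<dots> = C3 * C1 * J0" by (simp add: J0_def)
    finally show ?thesis using part2 by simp
  qed
  show thesis
  proof (rule that[of "1 + C3 * C1 * J0 + C3"])
    have nn: "C3 * C1 * J0 \<ge> 0" using C3 f1(2) J0 by simp
    then show "1 + C3 * C1 * J0 + C3 > 0" using C3 by simp
    fix F J and b :: "nat \<Rightarrow> real \<Rightarrow> real"
    assume *: "finite F" "F \<subseteq> {0..L}" "finite J"
      "\<And>k l. k \<in> J \<Longrightarrow> l \<in> J \<Longrightarrow> (\<Sum>s\<in>F. \<Sum>t\<in>F. b k s * b l t * K2 (s - t)) = (if k = l then 1 else 0)"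
    show "(\<Sum>k\<in>J. \<Sum>s\<in>F. \<Sum>t\<in>F. b k s * b k t * K1 (s - t)) \<le> 1 + C3 * C1 * J0 + C3 \<and> (\<Sum>k\<in>J. (\<Sum>s\<in>F. b k s)\<^sup>2) \<le> 1 + C3 * C1 * J0 + C3"
      using main[OF *] nn C3 by linarith
  qed
qed

text \<open>A vanishing form would force the trigonometric polynomial of \<open>a\<close> to be 0
  almost everywhere, because \<open>f\<close> is positive, and distinct exponentials are linearly
  independent. Strictness is needed for the division in the Gram-Schmidt process.\<close>

lemma spectral_positive_definite:
  assumes sd: "spectral_density K f" and pos: "\<And>x. f x > 0" and F: "finite F"
    and s0: "s0 \<in> F" "a s0 \<noteq> 0"
  shows "(\<Sum>s\<in>F. \<Sum>t\<in>F. a s * a t * K (s - t)) > 0"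
proof -
  have fi: "integrable lborel f" and K: "\<And>t. (CLINT v|lborel. iexp (v * t) * of_real (f v)) = of_real (K t)"
    using sd unfolding spectral_density_def by auto
  define p where "p v = (\<Sum>s\<in>F. of_real (a s) * iexp (v * s))" for v
  have pm[measurable]: "p \<in> borel_measurable borel" unfolding p_def by measurable
  have i: "integrable lborel (\<lambda>v. iexp (v * t) * of_real (f v))" for t
    by (rule Bochner_Integration.integrable_bound[OF fi])
      (use borel_measurable_integrable[OF fi] in \<open>auto simp: norm_mult\<close>)
  have eq: "of_real ((cmod (p v))\<^sup>2 * f v) = (\<Sum>s\<in>F. \<Sum>t\<in>F. of_real (a s * a t) * (iexp (v * (s - t)) * of_real (f v)))" for v
  proof -
    have e: "iexp (v * (s - t)) = iexp (v * s) * cnj (iexp (v * t))" for s t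
      by (simp add: exp_cnj exp_add[symmetric] algebra_simps)
    have "of_real ((cmod (p v))\<^sup>2) = (\<Sum>s\<in>F. \<Sum>t\<in>F. of_real (a s * a t) * iexp (v * (s - t)))"
      unfolding complex_norm_square p_def cnj_sum sum_product e by (intro sum.cong refl) (simp add: mult_ac)
    then show ?thesis by (simp only: of_real_mult sum_distrib_right mult.assoc)
  qed
  have ii: "integrable lborel (\<lambda>v. of_real (a s * a t) * (iexp (v * (s - t)) * of_real (f v)))" for s t
    by (intro integrable_mult_right i)
  have int: "integrable lborel (\<lambda>v. (cmod (p v))\<^sup>2 * f v)"
  proof -
    have "integrable lborel (\<lambda>v. of_real ((cmod (p v))\<^sup>2 * f v) :: complex)"
      unfolding eq by (intro Bochner_Integration.integrable_sum ii)
    then show ?thesis by (simp only: complex_of_real_integrable_eq)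
  qed
  have val: "(LINT v|lborel. (cmod (p v))\<^sup>2 * f v) = (\<Sum>s\<in>F. \<Sum>t\<in>F. a s * a t * K (s - t))"
  proof -
    have "of_real (LINT v|lborel. (cmod (p v))\<^sup>2 * f v) = (CLINT v|lborel. of_real ((cmod (p v))\<^sup>2 * f v))"
      by (rule integral_complex_of_real[symmetric])
    also have "\<dots> = (\<Sum>s\<in>F. (CLINT v|lborel. \<Sum>t\<in>F. of_real (a s * a t) * (iexp (v * (s - t)) * of_real (f v))))"
      unfolding eq by (intro Bochner_Integration.integral_sum Bochner_Integration.integrable_sum ii)
    also have "\<dots> = (\<Sum>s\<in>F. \<Sum>t\<in>F. (CLINT v|lborel. of_real (a s * a t) * (iexp (v * (s - t)) * of_real (f v))))"
      by (intro sum.cong refl Bochner_Integration.integral_sum ii)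
    also have "\<dots> = (\<Sum>s\<in>F. \<Sum>t\<in>F. of_real (a s * a t) * of_real (K (s - t)))"
      by (intro sum.cong refl) (simp only: integral_mult_right_zero K)
    also have "\<dots> = of_real (\<Sum>s\<in>F. \<Sum>t\<in>F. a s * a t * K (s - t))" by simp
    finally show ?thesis by (simp only: of_real_eq_iff)
  qed
  have nn: "AE v in lborel. 0 \<le> (cmod (p v))\<^sup>2 * f v" using pos less_imp_le by (intro AE_I2 mult_nonneg_nonneg) auto
  show ?thesis
  proof (rule ccontr)
    assume "\<not> ?thesis"
    moreover have "0 \<le> (LINT v|lborel. (cmod (p v))\<^sup>2 * f v)" by (rule Bochner_Integration.integral_nonneg_AE[OF nn])
    ultimately have "(LINT v|lborel. (cmod (p v))\<^sup>2 * f v) = 0" unfolding val by linarith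
    then have "AE v in lborel. (cmod (p v))\<^sup>2 * f v = 0"
      using integral_nonneg_eq_0_iff_AE[OF int nn] by simp
    then have p0: "AE v in lborel. p v = 0"
      by eventually_elim (use pos in \<open>auto simp: less_imp_neq[symmetric]\<close>)
    text \<open>Integrating \<open>p\<close> against \<open>exp (- i v s0)\<close> and a centred normal density of standard deviation
      \<open>n\<close> recovers \<open>a s0\<close> as \<open>n \<rightarrow> \<infinity>\<close>.\<close>
    let ?N = "std_normal_distribution"
    interpret N: real_distribution ?N by (rule real_dist_normal_dist)
    have z: "(\<Sum>t\<in>F. a t * exp (- (real n * (t - s0))\<^sup>2 / 2)) = 0" if n: "n > 0" for n
    proof -
      have "AE y in lborel. p (0 + real n * y) = 0"
        using n p0 by (intro AE_borel_affine) auto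
      then have "AE y in ?N. p (real n * y) = 0" by (subst AE_density) auto
      then have "(CLINT y|?N. p (real n * y) * iexp (- (real n * y * s0))) = (CLINT y|?N. 0)"
        by (intro integral_cong_AE) auto
      moreover have "(CLINT y|?N. p (real n * y) * iexp (- (real n * y * s0)))
        = (CLINT y|?N. (\<Sum>t\<in>F. of_real (a t) * iexp (real n * (t - s0) * y)))"
      proof (intro Bochner_Integration.integral_cong refl)
        fix y
        have "iexp (real n * (t - s0) * y) = iexp (real n * y * t) * iexp (- (real n * y * s0))" for t
          by (simp add: exp_add[symmetric] algebra_simps)
        then show "p (real n * y) * iexp (- (real n * y * s0)) = (\<Sum>t\<in>F. of_real (a t) * iexp (real n * (t - s0) * y))"
          unfolding p_def sum_distrib_right by (simp only: mult.assoc)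
      qed
      moreover have "\<dots> = (\<Sum>t\<in>F. (CLINT y|?N. of_real (a t) * iexp (real n * (t - s0) * y)))"
        by (intro Bochner_Integration.integral_sum integrable_mult_right N.integrable_iexp) auto
      moreover have "\<dots> = (\<Sum>t\<in>F. of_real (a t) * char ?N (real n * (t - s0)))"
        unfolding char_def by (simp only: integral_mult_right_zero)
      ultimately have "(\<Sum>t\<in>F. of_real (a t) * char ?N (real n * (t - s0))) = 0" by simp
      then have "complex_of_real (\<Sum>t\<in>F. a t * exp (- (real n * (t - s0))\<^sup>2 / 2)) = 0"
        unfolding char_std_normal_distribution by simp
      then show ?thesis by (simp only: of_real_eq_0_iff)
    qed
    have "(\<lambda>n. \<Sum>t\<in>F. a t * exp (- (real n * (t - s0))\<^sup>2 / 2)) \<longlonglongrightarrow> (\<Sum>t\<in>F. a t * (if t = s0 then 1 else 0))"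
    proof (intro tendsto_sum tendsto_mult tendsto_const)
      fix t
      show "(\<lambda>n. exp (- (real n * (t - s0))\<^sup>2 / 2)) \<longlonglongrightarrow> (if t = s0 then 1 else 0)"
      proof (cases "t = s0")
        case False
        have "filterlim (\<lambda>n. real n * \<bar>t - s0\<bar>) at_top sequentially"
          using False by (intro filterlim_at_top_mult_tendsto_pos[OF tendsto_const _ filterlim_real_sequentially]) auto
        then have "filterlim (\<lambda>n. (real n * \<bar>t - s0\<bar>)\<^sup>2 * (1 / 2)) at_top sequentially"
          by (intro filterlim_at_top_mult_tendsto_pos[OF tendsto_const]) (auto intro!: filterlim_pow_at_top)
        then have "filterlim (\<lambda>n. - ((real n * \<bar>t - s0\<bar>)\<^sup>2 * (1 / 2))) at_bot sequentially"
          by (simp add: filterlim_uminus_at_bot)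
        then have "(\<lambda>n. exp (- ((real n * \<bar>t - s0\<bar>)\<^sup>2 * (1 / 2)))) \<longlonglongrightarrow> 0"
          by (rule filterlim_compose[OF exp_at_bot])
        then show ?thesis using False by (simp add: power_mult_distrib)
      qed simp
    qed
    moreover have "(\<lambda>n. \<Sum>t\<in>F. a t * exp (- (real n * (t - s0))\<^sup>2 / 2)) \<longlonglongrightarrow> 0"
      by (rule tendsto_eventually, rule eventually_mono[OF eventually_gt_at_top[of 0]], rule z)
    ultimately have "(\<Sum>t\<in>F. a t * (if t = s0 then 1 else 0)) = 0" by (rule LIMSEQ_unique)
    then show False using F s0 by (simp add: if_distrib[of "\<lambda>x. _ * x"] cong: if_cong)
  qed
qed

subsection \<open>Shifts of Gaussian processes\<close>

text \<open>Gram-Schmidt for functionals of \<open>v\<close> under the form \<open>Q\<close>. Since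
  \<open>c\<close> recovers \<open>v\<close> from the orthonormal functionals, the sum of their
  squares at \<open>v\<close> is the squared reproducing kernel norm of \<open>v\<close>, and no
  inverse of \<open>Q\<close> has to be formed.\<close>

lemma gram_schmidt_kernel:
  fixes Q :: "'i \<Rightarrow> 'i \<Rightarrow> real"
  assumes F: "finite F" and sym: "\<And>s t. Q s t = Q t s"
    and pd: "\<And>G a s0. finite G \<Longrightarrow> s0 \<in> G \<Longrightarrow> a s0 \<noteq> 0 \<Longrightarrow> (\<Sum>s\<in>G. \<Sum>t\<in>G. a s * a t * Q s t) > 0"
  shows "\<exists>m (b :: nat \<Rightarrow> 'i \<Rightarrow> real) c.
    (\<forall>k<m. \<forall>l<m. (\<Sum>s\<in>F. \<Sum>t\<in>F. b k s * b l t * Q s t) = (if k = l then 1 else 0)) \<and>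
    (\<forall>v. \<forall>t\<in>F. v t = (\<Sum>k<m. c k t * (\<Sum>s\<in>F. b k s * v s)))"
  using F
proof (induction F rule: finite_induct)
  case empty
  show ?case by (rule exI[of _ 0]) auto
next
  case (insert x F)
  then obtain m and b :: "nat \<Rightarrow> 'i \<Rightarrow> real" and c where
    orth: "\<And>k l. k < m \<Longrightarrow> l < m \<Longrightarrow> (\<Sum>s\<in>F. \<Sum>t\<in>F. b k s * b l t * Q s t) = (if k = l then 1 else 0)"
    and rec: "\<And>v t. t \<in> F \<Longrightarrow> v t = (\<Sum>k<m. c k t * (\<Sum>s\<in>F. b k s * v s))"
    by blast
  define B where "B a a' = (\<Sum>s\<in>insert x F. \<Sum>t\<in>insert x F. a s * a' t * Q s t)" for a a' :: "'i \<Rightarrow> real"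
  have B_sym: "B a a' = B a' a" for a a'
    unfolding B_def by (subst sum.swap) (simp add: sym mult_ac)
  have B_lin: "B a (\<lambda>s. a1 s - (\<Sum>k<m. r k * e k s)) = B a a1 - (\<Sum>k<m. r k * B a (e k))" for a a1 r and e :: "nat \<Rightarrow> 'i \<Rightarrow> real"
  proof -
    have "(\<Sum>k<m. r k * B a (e k)) = (\<Sum>s\<in>insert x F. \<Sum>t\<in>insert x F. (\<Sum>k<m. a s * (r k * e k t) * Q s t))"
      unfolding B_def sum_distrib_left
      by (subst sum.swap, intro sum.cong refl, subst sum.swap, intro sum.cong refl) (simp add: mult_ac)
    moreover have "a s * (a1 t - (\<Sum>k<m. r k * e k t)) * Q s t = a s * a1 t * Q s t - (\<Sum>k<m. a s * (r k * e k t) * Q s t)" for s t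
      by (simp add: right_diff_distrib left_diff_distrib sum_distrib_left sum_distrib_right)
    ultimately show ?thesis
      unfolding B_def by (simp only: sum_subtractf)
  qed
  have B_scale: "B a (\<lambda>s. a' s / d) = B a a' / d" for a a' d
    unfolding B_def sum_divide_distrib by (intro sum.cong refl) simp
  define b0 where "b0 k s = (if s = x then 0 else b k s)" for k s
  have b0F: "b0 k s = b k s" if "s \<in> F" for k s using that insert.hyps by (auto simp: b0_def)
  have sum0: "(\<Sum>s\<in>insert x F. b0 k s * g s) = (\<Sum>s\<in>F. b k s * g s)" for k and g :: "'i \<Rightarrow> real"
  proof -
    have "(\<Sum>s\<in>F. b0 k s * g s) = (\<Sum>s\<in>F. b k s * g s)" by (intro sum.cong refl) (simp add: b0F)
    then show ?thesis using insert.hyps by (simp add: b0_def)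
  qed
  have orth0: "B (b0 k) (b0 l) = (if k = l then 1 else 0)" if "k < m" "l < m" for k l
  proof -
    have "B (b0 k) (b0 l) = (\<Sum>s\<in>insert x F. b0 k s * (\<Sum>t\<in>insert x F. b0 l t * Q s t))"
      unfolding B_def sum_distrib_left by (simp only: mult.assoc)
    also have "\<dots> = (\<Sum>s\<in>F. b k s * (\<Sum>t\<in>F. b l t * Q s t))" unfolding sum0 ..
    also have "\<dots> = (\<Sum>s\<in>F. \<Sum>t\<in>F. b k s * b l t * Q s t)" unfolding sum_distrib_left by (simp only: mult.assoc)
    finally show ?thesis using orth[OF that] by simp
  qed
  \<comment> \<open>The new functional \<open>e\<close> is evaluation at \<open>x\<close> minus its
    projection onto the earlier ones. Its coefficient at \<open>x\<close> is 1, so strict positivity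
    gives it a non-zero length.\<close>
  define \<delta> where "\<delta> s = (if s = x then 1 else 0 :: real)" for s
  define r where "r k = B (b0 k) \<delta>" for k
  define e where "e s = \<delta> s - (\<Sum>k<m. r k * b0 k s)" for s
  define d where "d = B e e"
  have ex: "e x = 1" by (simp add: e_def \<delta>_def b0_def)
  have d: "d > 0" unfolding d_def B_def by (rule pd[where ?s0.0 = x]) (use insert.hyps ex in auto)
  have orth_e: "B (b0 k) e = 0" if "k < m" for k
  proof -
    have "B (b0 k) e = B (b0 k) \<delta> - (\<Sum>l<m. r l * B (b0 k) (b0 l))" unfolding e_def by (rule B_lin)
    also have "(\<Sum>l<m. r l * B (b0 k) (b0 l)) = (\<Sum>l<m. if l = k then r k else 0)"
      using that by (intro sum.cong refl) (auto simp: orth0)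
    also have "\<dots> = r k" using that by simp
    finally show ?thesis by (simp add: r_def)
  qed
  define b' where "b' k = (if k < m then b0 k else (\<lambda>s. e s / sqrt d))" for k
  \<comment> \<open>Solving the definition of \<open>e\<close> for the value at \<open>x\<close>
    gives sqrt d times the normalised new functional plus the projections with coefficients
    \<open>r\<close>; at old points the new functional does not enter.\<close>
  define c' where "c' k t = (if k < m then (if t = x then r k else c k t) else (if t = x then sqrt d else 0))" for k t
  have "B (b' k) (b' l) = (if k = l then 1 else 0)" if "k < Suc m" "l < Suc m" for k l
  proof -
    have "k < m \<or> k = m" "l < m \<or> l = m" using that by auto
    then consider "k < m" "l < m" | "k < m" "l = m" | "k = m" "l < m" | "k = m" "l = m" by blast
    then show ?thesis
    proof cases
      case 2
      then show ?thesis by (simp add: b'_def B_scale orth_e)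
    next
      case 3
      then show ?thesis using B_sym[of "b' k" "b' l"] by (simp add: b'_def B_scale orth_e)
    next
      case 4
      have "B (\<lambda>s. e s / sqrt d) (\<lambda>s. e s / sqrt d) = d / sqrt d / sqrt d"
        unfolding B_scale B_sym[of "\<lambda>s. e s / sqrt d"] by (simp add: B_scale d_def)
      then show ?thesis using 4 d by (simp add: b'_def)
    qed (simp add: b'_def orth0)
  qed
  moreover have "v t = (\<Sum>k<Suc m. c' k t * (\<Sum>s\<in>insert x F. b' k s * v s))" if t: "t \<in> insert x F" for v t
  proof -
    have split: "(\<Sum>k<Suc m. c' k t * (\<Sum>s\<in>insert x F. b' k s * v s))
       = (\<Sum>k<m. (if t = x then r k else c k t) * (\<Sum>s\<in>F. b k s * v s)) + c' m t * (\<Sum>s\<in>insert x F. e s / sqrt d * v s)"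
      by (simp add: c'_def b'_def sum0)
    show ?thesis
    proof (cases "t = x")
      case False
      then show ?thesis unfolding split using rec[of t v] t by (simp add: c'_def)
    next
      case True
      have "(\<Sum>s\<in>insert x F. e s * v s) = (\<Sum>s\<in>insert x F. \<delta> s * v s) - (\<Sum>s\<in>insert x F. \<Sum>k<m. r k * (b0 k s * v s))"
        by (simp only: e_def left_diff_distrib sum_subtractf sum_distrib_right mult.assoc)
      also have "(\<Sum>s\<in>insert x F. \<delta> s * v s) = v x"
        using insert.hyps by (simp add: \<delta>_def if_distrib[of "\<lambda>u. u * _"] cong: if_cong)
      also have "(\<Sum>s\<in>insert x F. \<Sum>k<m. r k * (b0 k s * v s)) = (\<Sum>k<m. r k * (\<Sum>s\<in>F. b k s * v s))"
        by (subst sum.swap) (simp only: sum_distrib_left[symmetric] sum0)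
      finally have "(\<Sum>s\<in>insert x F. e s * v s) = v x - (\<Sum>k<m. r k * (\<Sum>s\<in>F. b k s * v s))" .
      moreover have "sqrt d * (\<Sum>s\<in>insert x F. e s / sqrt d * v s) = (\<Sum>s\<in>insert x F. e s * v s)"
        unfolding sum_distrib_left using d by (intro sum.cong refl) simp
      ultimately show ?thesis unfolding split using True by (simp add: c'_def)
    qed
  qed
  ultimately show ?case unfolding B_def by blast
qed

text \<open>Induction over the generated \<sigma>-algebra: complements of cylinders are cylinders,
  and a countable union is cut off at a finite stage. A single cylinder has to serve both measures,
  so both errors are carried through the induction.\<close>

lemma PiM_cylinder_approx:
  assumes "prob_space P" "prob_space P'" "sets P = sets (PiM I N)" "sets P' = sets (PiM I N)"
    and A: "A \<in> sets (PiM I N)" and \<epsilon>: "\<epsilon> > (0::real)"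
  shows "\<exists>F B. finite F \<and> F \<subseteq> I \<and> B \<in> sets (PiM F N) \<and>
    measure P (sym_diff A (prod_emb I N F B)) < \<epsilon> \<and> measure P' (sym_diff A (prod_emb I N F B)) < \<epsilon>"
proof -
  interpret P: prob_space P by fact
  interpret P': prob_space P' by fact
  have spP: "space P = space (PiM I N)" "space P' = space (PiM I N)"
    using assms by (auto dest: sets_eq_imp_space_eq)
  define cyl where "cyl C \<longleftrightarrow> (\<exists>F B. finite F \<and> F \<subseteq> I \<and> B \<in> sets (PiM F N) \<and> C = prod_emb I N F B)" for C
  have cyl_sets: "C \<in> sets (PiM I N)" if "cyl C" for C
    using that unfolding cyl_def by (auto intro: measurable_prod_emb)
  have cyl_compl: "cyl (space (PiM I N) - C)" if "cyl C" for C
  proof -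
    from that obtain F B where F: "finite F" "F \<subseteq> I" "B \<in> sets (PiM F N)" "C = prod_emb I N F B" unfolding cyl_def by blast
    have "space (PiM I N) - prod_emb I N F B = prod_emb I N F (space (PiM F N) - B)"
      using F(2) by (auto simp: prod_emb_def space_PiM PiE_iff extensional_def restrict_def; blast)
    then show ?thesis unfolding cyl_def using F by (intro exI[of _ F] exI[of _ "space (PiM F N) - B"]) auto
  qed
  have cyl_Un: "cyl (C \<union> C')" if "cyl C" "cyl C'" for C C'
  proof -
    from that(1) obtain F B where F: "finite F" "F \<subseteq> I" "B \<in> sets (PiM F N)" "C = prod_emb I N F B" unfolding cyl_def by blast
    from that(2) obtain F' B' where F': "finite F'" "F' \<subseteq> I" "B' \<in> sets (PiM F' N)" "C' = prod_emb I N F' B'" unfolding cyl_def by blast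
    have "prod_emb I N F B = prod_emb I N (F \<union> F') (prod_emb (F \<union> F') N F B)"
      "prod_emb I N F' B' = prod_emb I N (F \<union> F') (prod_emb (F \<union> F') N F' B')"
      using F F' by (simp_all add: prod_emb_trans)
    then have "C \<union> C' = prod_emb I N (F \<union> F') (prod_emb (F \<union> F') N F B \<union> prod_emb (F \<union> F') N F' B')"
      using F(4) F'(4) by (simp add: prod_emb_Un)
    moreover have "prod_emb (F \<union> F') N F B \<union> prod_emb (F \<union> F') N F' B' \<in> sets (PiM (F \<union> F') N)"
      using F F' by (intro sets.Un measurable_prod_emb) auto
    ultimately show ?thesis unfolding cyl_def using F F'
      by (intro exI[of _ "F \<union> F'"] exI[of _ "prod_emb (F \<union> F') N F B \<union> prod_emb (F \<union> F') N F' B'"]) auto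
  qed
  have cyl_empty: "cyl {}"
    unfolding cyl_def by (intro exI[of _ "{}"]) auto
  have cyl_UN: "cyl (\<Union>i<n. C i)" if "\<And>i. cyl (C i)" for C and n :: nat
    by (induction n) (auto simp: cyl_empty lessThan_Suc intro!: cyl_Un that)
  have "\<forall>\<epsilon>>0. \<exists>C. cyl C \<and> measure P (sym_diff A C) < \<epsilon> \<and> measure P' (sym_diff A C) < \<epsilon>"
    using A unfolding sets_PiM
  proof (induction rule: sigma_sets.induct)
    case (Basic A)
    then obtain J E where "A = prod_emb I N J (\<Pi>\<^sub>E j\<in>J. E j)" "finite J" "J \<subseteq> I" "\<And>i. i \<in> J \<Longrightarrow> E i \<in> sets (N i)"
      by (rule prod_algebraE) blast
    then have "cyl A" unfolding cyl_def by (intro exI[of _ J] exI[of _ "\<Pi>\<^sub>E j\<in>J. E j"]) auto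
    then show ?case by (intro allI impI exI[of _ A]) auto
  next
    case Empty
    then show ?case using cyl_empty by (intro allI impI exI[of _ "{}"]) auto
  next
    case (Compl A)
    show ?case
    proof (intro allI impI)
      fix \<epsilon> :: real assume "\<epsilon> > 0"
      then obtain C where C: "cyl C" "measure P (sym_diff A C) < \<epsilon>" "measure P' (sym_diff A C) < \<epsilon>"
        using Compl.IH by blast
      have "A \<subseteq> space (PiM I N)" "C \<subseteq> space (PiM I N)"
        using sets.sets_into_space[OF cyl_sets[OF C(1)]] sigma_sets_into_sp[OF prod_algebra_sets_into_space Compl.hyps]
        by (auto simp: space_PiM)
      then have "sym_diff ((\<Pi>\<^sub>E i\<in>I. space (N i)) - A) (space (PiM I N) - C) = sym_diff A C" by (auto simp: space_PiM)
      then show "\<exists>C. cyl C \<and> measure P (sym_diff ((\<Pi>\<^sub>E i\<in>I. space (N i)) - A) C) < \<epsilon> \<and> measure P' (sym_diff ((\<Pi>\<^sub>E i\<in>I. space (N i)) - A) C) < \<epsilon>"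
        using C cyl_compl by (intro exI[of _ "space (PiM I N) - C"]) auto
    qed
  next
    case (Union a)
    have aS: "a i \<in> sets (PiM I N)" for i using Union.hyps by (simp add: sets_PiM)
    show ?case
    proof (intro allI impI)
      fix \<epsilon> :: real assume \<epsilon>: "\<epsilon> > 0"
      have lim: "(\<lambda>n. measure R (\<Union>i<n. a i)) \<longlonglongrightarrow> measure R (\<Union>i. a i)" if "prob_space R" "sets R = sets (PiM I N)" for R
      proof -
        interpret R: prob_space R by fact
        have "(\<lambda>n. measure R (\<Union>i<n. a i)) \<longlonglongrightarrow> measure R (\<Union>n. \<Union>i<n. a i)"
          by (rule R.finite_Lim_measure_incseq) (use aS that in \<open>auto simp: incseq_def intro: less_le_trans\<close>)
        also have "(\<Union>n. \<Union>i<n. a i) = (\<Union>i. a i)" by auto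
        finally show ?thesis .
      qed
      have ev: "\<forall>\<^sub>F n in sequentially. measure R (\<Union>i. a i) - \<epsilon> / 2 < measure R (\<Union>i<n. a i)"
        if "prob_space R" "sets R = sets (PiM I N)" for R
        using order_tendstoD(1)[OF lim[OF that], of "measure R (\<Union>i. a i) - \<epsilon> / 2"] \<epsilon> by simp
      obtain n where n: "measure P (\<Union>i. a i) - \<epsilon> / 2 < measure P (\<Union>i<n. a i)"
          "measure P' (\<Union>i. a i) - \<epsilon> / 2 < measure P' (\<Union>i<n. a i)"
        using eventually_conj[OF ev[OF assms(1,3)] ev[OF assms(2,4)]] by (auto simp: eventually_sequentially)
      \<comment> \<open>The n approximations share the error \<epsilon> / 2; the additional 1 covers
        n = 0 and makes the total strictly smaller.\<close>
      define \<eta> where "\<eta> = \<epsilon> / (2 * (real n + 1))"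
      have \<eta>: "\<eta> > 0" using \<epsilon> by (simp add: \<eta>_def)
      have n\<eta>: "real n * \<eta> < \<epsilon> / 2"
      proof -
        have "real n * \<eta> < (real n + 1) * \<eta>" using \<eta> by (intro mult_strict_right_mono) auto
        also have "(real n + 1) * \<eta> = \<epsilon> / 2" by (simp add: \<eta>_def field_simps)
        finally show ?thesis .
      qed
      have "\<forall>i. \<exists>C. cyl C \<and> measure P (sym_diff (a i) C) < \<eta> \<and> measure P' (sym_diff (a i) C) < \<eta>"
        using Union.IH \<eta> by blast
      from choice[OF this] obtain C where C: "\<And>i. cyl (C i)" "\<And>i. measure P (sym_diff (a i) (C i)) < \<eta>"
        "\<And>i. measure P' (sym_diff (a i) (C i)) < \<eta>" by blast
      have bound: "measure R (sym_diff (\<Union>i. a i) (\<Union>i<n. C i)) < \<epsilon>"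
        if R: "prob_space R" "sets R = sets (PiM I N)" and Ra: "measure R (\<Union>i. a i) - \<epsilon> / 2 < measure R (\<Union>i<n. a i)"
          and RC: "\<And>i. measure R (sym_diff (a i) (C i)) < \<eta>" for R
      proof -
        interpret R: prob_space R by fact
        have S: "a i \<in> sets R" "C i \<in> sets R" for i using aS C(1) cyl_sets R(2) by auto
        have "measure R (sym_diff (\<Union>i. a i) (\<Union>i<n. C i))
           \<le> measure R (((\<Union>i. a i) - (\<Union>i<n. a i)) \<union> (\<Union>i<n. sym_diff (a i) (C i)))"
          by (rule R.finite_measure_mono) (use S in auto)
        also have "\<dots> \<le> measure R ((\<Union>i. a i) - (\<Union>i<n. a i)) + measure R (\<Union>i<n. sym_diff (a i) (C i))"
          by (rule measure_Un_le) (use S in auto)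
        also have "measure R ((\<Union>i. a i) - (\<Union>i<n. a i)) = measure R (\<Union>i. a i) - measure R (\<Union>i<n. a i)"
          by (rule R.finite_measure_Diff) (use S in auto)
        also have "measure R (\<Union>i<n. sym_diff (a i) (C i)) \<le> (\<Sum>i<n. measure R (sym_diff (a i) (C i)))"
          by (rule R.finite_measure_subadditive_finite) (use S in auto)
        also have "\<dots> \<le> (\<Sum>i<n. \<eta>)" by (intro sum_mono less_imp_le RC)
        finally have "measure R (sym_diff (\<Union>i. a i) (\<Union>i<n. C i)) \<le> measure R (\<Union>i. a i) - measure R (\<Union>i<n. a i) + real n * \<eta>"
          by simp
        then show ?thesis using Ra n\<eta> by linarith
      qed
      show "\<exists>C. cyl C \<and> measure P (sym_diff (\<Union> (range a)) C) < \<epsilon> \<and> measure P' (sym_diff (\<Union> (range a)) C) < \<epsilon>"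
        using bound[OF assms(1,3) n(1) C(2)] bound[OF assms(2,4) n(2) C(3)] cyl_UN[of C n] C(1)
        by (intro exI[of _ "\<Union>i<n. C i"]) auto
    qed
  qed
  then obtain C where C: "cyl C" "measure P (sym_diff A C) < \<epsilon>" "measure P' (sym_diff A C) < \<epsilon>"
    using \<epsilon> by blast
  from C(1) obtain F B where FB: "finite F" "F \<subseteq> I" "B \<in> sets (PiM F N)" "C = prod_emb I N F B"
    unfolding cyl_def by blast
  show ?thesis
    by (intro exI[of _ F] exI[of _ B] conjI FB(1,2,3)) (use C(2,3) FB(4) in simp_all)
qed

lemma (in prob_space) abs_measure_diff_le:
  assumes "A \<in> events" "C \<in> events"
  shows "\<bar>prob A - prob C\<bar> \<le> prob (sym_diff A C)"
proof -
  have "prob A \<le> prob (C \<union> sym_diff A C)" "prob C \<le> prob (A \<union> sym_diff A C)"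
    using assms by (auto intro!: finite_measure_mono)
  moreover have "prob (C \<union> sym_diff A C) \<le> prob C + prob (sym_diff A C)"
    "prob (A \<union> sym_diff A C) \<le> prob A + prob (sym_diff A C)"
    using assms by (auto intro!: measure_Un_le)
  ultimately show ?thesis by linarith
qed

text \<open>The approximating cylinder is the same under both measures, so its bound passes to
  \<open>A\<close> at the cost of two errors of \<epsilon> / 2.\<close>

lemma PiM_tv_le_if_cylinder_tv_le:
  assumes P: "prob_space P" "sets P = sets (PiM I N)" and P': "prob_space P'" "sets P' = sets (PiM I N)"
    and cyl: "\<And>F B. finite F \<Longrightarrow> F \<subseteq> I \<Longrightarrow> B \<in> sets (PiM F N) \<Longrightarrow>
      \<bar>measure P (prod_emb I N F B) - measure P' (prod_emb I N F B)\<bar> \<le> c"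
    and A: "A \<in> sets (PiM I N)"
  shows "\<bar>measure P A - measure P' A\<bar> \<le> c"
proof (rule field_le_epsilon)
  fix \<epsilon> :: real assume "\<epsilon> > 0"
  then have "\<epsilon> / 2 > 0" by simp
  from PiM_cylinder_approx[OF P(1) P'(1) P(2) P'(2) A this]
  obtain F B where F: "finite F" "F \<subseteq> I" "B \<in> sets (PiM F N)" and
    D: "measure P (sym_diff A (prod_emb I N F B)) < \<epsilon> / 2" "measure P' (sym_diff A (prod_emb I N F B)) < \<epsilon> / 2"
    by blast
  have C: "prod_emb I N F B \<in> sets (PiM I N)" using F by (intro measurable_prod_emb)
  have "\<bar>measure P A - measure P (prod_emb I N F B)\<bar> < \<epsilon> / 2" "\<bar>measure P' A - measure P' (prod_emb I N F B)\<bar> < \<epsilon> / 2"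
    using prob_space.abs_measure_diff_le[OF P(1), of A "prod_emb I N F B"]
      prob_space.abs_measure_diff_le[OF P'(1), of A "prod_emb I N F B"] D A C P(2) P'(2) by force+
  then show "\<bar>measure P A - measure P' A\<bar> \<le> c + \<epsilon>" using cyl[OF F] by linarith
qed

text \<open>Every shift \<open>x\<close> on \<open>F\<close> has the form Cov(W_t, U): the
  coefficient vector of \<open>U\<close> is Q^(-1) x, written through the orthonormal family. The
  variance of this \<open>U\<close> is the squared kernel norm of \<open>x\<close>.\<close>

lemma gaussian_process_shift_tv:
  fixes W :: "real \<Rightarrow> 'a \<Rightarrow> real" and m :: nat
  assumes M: "prob_space M" and F: "finite F"
    and comb: "\<And>b. normal_rv M (\<lambda>w. \<Sum>s\<in>F. b s * W s w)"
    and cov: "\<And>s t. s \<in> F \<Longrightarrow> t \<in> F \<Longrightarrow> covariance M (W s) (W t) = Q s t" and sym: "\<And>s t. Q s t = Q t s"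
    and orth: "\<And>k l. k < m \<Longrightarrow> l < m \<Longrightarrow> (\<Sum>s\<in>F. \<Sum>t\<in>F. b k s * b l t * Q s t) = (if k = l then 1 else 0 :: real)"
    and rec: "\<And>v t. t \<in> F \<Longrightarrow> v t = (\<Sum>k<m. c k t * (\<Sum>s\<in>F. b k s * v s))"
    and A: "A \<in> sets (\<Pi>\<^sub>M i\<in>F. (borel :: real measure))"
  shows "\<bar>measure M {w \<in> space M. (\<lambda>s\<in>F. W s w) \<in> A} - measure M {w \<in> space M. (\<lambda>s\<in>F. W s w + \<beta> * x s) \<in> A}\<bar>
    \<le> \<bar>\<beta>\<bar> * sqrt (\<Sum>k<m. (\<Sum>s\<in>F. b k s * x s)\<^sup>2)"
proof -
  interpret prob_space M by fact
  define y where "y k = (\<Sum>s\<in>F. b k s * x s)" for k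
  define u where "u s = (\<Sum>k<m. y k * b k s)" for s
  define U where "U = (\<lambda>w. \<Sum>s\<in>F. u s * W s w)"
  have Wn: "normal_rv M (W i)" if "i \<in> F" for i
  proof -
    have "(\<Sum>j\<in>F. (if j = i then 1 else 0) * W j w) = W i w" for w
      using F that by (simp add: if_distrib[of "\<lambda>x. x * _"] cong: if_cong)
    then show ?thesis using comb[of "\<lambda>j. if j = i then 1 else 0"] by simp
  qed
  note i1 = normal_rv_moments(1)[OF Wn] and i2 = normal_rv_mult_integrable[OF Wn Wn]
  have Un: "normal_rv M U" unfolding U_def by (rule comb)
  have covU: "covariance M (W t) U = x t" if t: "t \<in> F" for t
  proof -
    \<comment> \<open>The recovery formula, applied to this sum as a function of \<open>t\<close>,
      identifies its values as the recovery coefficients.\<close>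
    have ker: "(\<Sum>s\<in>F. b l s * Q t s) = c l t" if l: "l < m" for l
    proof -
      have "(\<Sum>s\<in>F. b l s * Q t s) = (\<Sum>k<m. c k t * (\<Sum>s'\<in>F. b k s' * (\<Sum>s\<in>F. b l s * Q s' s)))"
        by (rule rec[OF t])
      also have "\<dots> = (\<Sum>k<m. c k t * (\<Sum>s'\<in>F. \<Sum>s\<in>F. b k s' * b l s * Q s' s))"
        by (simp only: sum_distrib_left mult.assoc)
      also have "\<dots> = (\<Sum>k<m. c k t * (if k = l then 1 else 0))"
        using orth l by (intro sum.cong refl) simp
      also have "\<dots> = (\<Sum>k<m. if k = l then c k t else 0)" by (intro sum.cong refl) simp
      also have "\<dots> = c l t" using l by simp
      finally show ?thesis .
    qed
    have "covariance M (W t) U = (\<Sum>s\<in>F. u s * covariance M (W t) (W s))"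
      unfolding U_def using t i1 i2 by (intro covariance_sum_right) auto
    also have "\<dots> = (\<Sum>s\<in>F. \<Sum>k<m. y k * (b k s * Q t s))"
      using t by (intro sum.cong refl) (simp add: cov u_def sum_distrib_right mult.assoc)
    also have "\<dots> = (\<Sum>k<m. y k * (\<Sum>s\<in>F. b k s * Q t s))"
      by (subst sum.swap) (simp only: sum_distrib_left)
    also have "\<dots> = (\<Sum>k<m. c k t * y k)" by (intro sum.cong refl) (simp add: ker)
    also have "\<dots> = x t" using rec[OF t, of x] by (simp add: y_def)
    finally show ?thesis .
  qed
  have "covariance M U U = (\<Sum>s\<in>F. u s * covariance M U (W s))"
    unfolding U_def using i1 i2 normal_rv_moments(1)[OF Un] normal_rv_mult_integrable[OF Un Wn]
    by (intro covariance_sum_right) (auto simp: U_def)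
  also have "\<dots> = (\<Sum>s\<in>F. \<Sum>k<m. y k * (b k s * x s))"
    by (intro sum.cong refl) (simp add: covariance_commute[of M U] covU u_def sum_distrib_right mult.assoc)
  also have "\<dots> = (\<Sum>k<m. (y k)\<^sup>2)"
    by (subst sum.swap) (simp only: sum_distrib_left[symmetric] y_def[symmetric] power2_eq_square)
  finally have UU: "covariance M U U = (\<Sum>k<m. (y k)\<^sup>2)" .
  have "(\<lambda>s\<in>F. W s w + \<beta> * covariance M (W s) U) = (\<lambda>s\<in>F. W s w + \<beta> * x s)" for w
    by (rule restrict_ext) (simp add: covU)
  with gaussian_shift_tv[OF M F comb U_def A, of \<beta>] UU show ?thesis by (simp add: y_def)
qed

text \<open>For a fixed path of \<open>X\<close> the shift of \<open>W\<close> is deterministic and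
  costs |\<beta>| sqrt S. Since sqrt S \<le> (1 + S) / 2, only the mean of \<open>S\<close> matters:
  it is a trace plus \<mu>^2 times the squared norm of the constant function, and \<open>tr\<close>
  bounds both independently of \<open>F\<close>.\<close>

lemma independent_shift_tv:
  fixes X :: "real \<Rightarrow> 'a \<Rightarrow> real" and W :: "real \<Rightarrow> 'b \<Rightarrow> real"
  assumes M: "prob_space M" and N: "prob_space N" and F: "finite F" "F \<subseteq> {0..L}"
    and X: "\<And>s. X s \<in> borel_measurable M" "\<And>s t. integrable M (\<lambda>w. X s w * X t w)"
      "\<And>s t. (LINT w|M. X s w * X t w) = K1 (s - t) + \<mu>\<^sup>2"
    and comb: "\<And>F b. finite F \<Longrightarrow> normal_rv N (\<lambda>w. \<Sum>s\<in>F. b s * W s w)"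
    and cov: "\<And>s t. covariance N (W s) (W t) = K2 (s - t)"
    and pd: "\<And>F a s0. finite F \<Longrightarrow> s0 \<in> F \<Longrightarrow> a s0 \<noteq> 0 \<Longrightarrow> (\<Sum>s\<in>F. \<Sum>t\<in>F. a s * a t * K2 (s - t)) > 0"
    and tr: "\<And>F J (b :: nat \<Rightarrow> real \<Rightarrow> real). finite F \<Longrightarrow> F \<subseteq> {0..L} \<Longrightarrow> finite J \<Longrightarrow>
     (\<And>k l. k \<in> J \<Longrightarrow> l \<in> J \<Longrightarrow> (\<Sum>s\<in>F. \<Sum>t\<in>F. b k s * b l t * K2 (s - t)) = (if k = l then 1 else 0)) \<Longrightarrow>
     (\<Sum>k\<in>J. \<Sum>s\<in>F. \<Sum>t\<in>F. b k s * b k t * K1 (s - t)) \<le> C \<and> (\<Sum>k\<in>J. (\<Sum>s\<in>F. b k s)\<^sup>2) \<le> C"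
    and B[measurable]: "B \<in> sets (\<Pi>\<^sub>M s\<in>F. (borel :: (real \<times> real) measure))"
  shows "\<bar>measure (M \<Otimes>\<^sub>M N) {p \<in> space (M \<Otimes>\<^sub>M N). (\<lambda>s\<in>F. (X s (fst p), W s (snd p))) \<in> B}
      - measure (M \<Otimes>\<^sub>M N) {p \<in> space (M \<Otimes>\<^sub>M N). (\<lambda>s\<in>F. (X s (fst p), W s (snd p) + \<beta> * X s (fst p))) \<in> B}\<bar>
    \<le> \<bar>\<beta>\<bar> * ((1 + C * (1 + \<mu>\<^sup>2)) / 2)"
proof -
  interpret M: prob_space M by fact
  interpret N: prob_space N by fact
  have symK: "K2 (s - t) = K2 (t - s)" for s t by (simp add: cov[symmetric] covariance_commute)
  obtain m :: nat and b c :: "nat \<Rightarrow> real \<Rightarrow> real" where orth: "\<And>k l. k < m \<Longrightarrow> l < m \<Longrightarrow> (\<Sum>s\<in>F. \<Sum>t\<in>F. b k s * b l t * K2 (s - t)) = (if k = l then 1 else 0 :: real)"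
    and rec: "\<And>v t. t \<in> F \<Longrightarrow> v t = (\<Sum>k<m. c k t * (\<Sum>s\<in>F. b k s * v s))"
  proof -
    have "\<exists>m (b :: nat \<Rightarrow> real \<Rightarrow> real) c.
      (\<forall>k<m. \<forall>l<m. (\<Sum>s\<in>F. \<Sum>t\<in>F. b k s * b l t * K2 (s - t)) = (if k = l then 1 else 0)) \<and>
      (\<forall>v. \<forall>t\<in>F. v t = (\<Sum>k<m. c k t * (\<Sum>s\<in>F. b k s * v s)))"
      by (rule gram_schmidt_kernel[OF F(1) symK]) (rule pd; assumption)
    then show thesis using that by blast
  qed
  have [measurable]: "X s \<in> borel_measurable M" "W s \<in> borel_measurable N" for s
    using X comb[of "{s}" "\<lambda>_. 1"] by (auto simp: normal_rv_def)
  define S where "S w = (\<Sum>k<m. (\<Sum>s\<in>F. b k s * X s w)\<^sup>2)" for w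
  have S_eq: "S w = (\<Sum>k<m. \<Sum>s\<in>F. \<Sum>t\<in>F. b k s * b k t * (X s w * X t w))" for w
    unfolding S_def power2_eq_square sum_product by (intro sum.cong refl) (simp add: mult_ac)
  have ii: "integrable M (\<lambda>w. b k s * b k t * (X s w * X t w))" for k s t by (intro integrable_mult_right X)
  have Sint: "integrable M S" unfolding S_eq by (intro Bochner_Integration.integrable_sum ii)
  have "(LINT w|M. S w) = (\<Sum>k<m. (LINT w|M. (\<Sum>s\<in>F. \<Sum>t\<in>F. b k s * b k t * (X s w * X t w))))"
    unfolding S_eq by (intro Bochner_Integration.integral_sum Bochner_Integration.integrable_sum ii)
  also have "\<dots> = (\<Sum>k<m. \<Sum>s\<in>F. (LINT w|M. (\<Sum>t\<in>F. b k s * b k t * (X s w * X t w))))"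
    by (intro sum.cong refl Bochner_Integration.integral_sum Bochner_Integration.integrable_sum ii)
  also have "\<dots> = (\<Sum>k<m. \<Sum>s\<in>F. \<Sum>t\<in>F. (LINT w|M. b k s * b k t * (X s w * X t w)))"
    by (intro sum.cong refl Bochner_Integration.integral_sum ii)
  also have "\<dots> = (\<Sum>k<m. \<Sum>s\<in>F. \<Sum>t\<in>F. b k s * b k t * K1 (s - t) + \<mu>\<^sup>2 * (b k s * b k t))"
    by (intro sum.cong refl) (simp only: integral_mult_right_zero X(3), simp add: algebra_simps)
  also have "\<dots> = (\<Sum>k<m. \<Sum>s\<in>F. \<Sum>t\<in>F. b k s * b k t * K1 (s - t)) + \<mu>\<^sup>2 * (\<Sum>k<m. (\<Sum>s\<in>F. b k s)\<^sup>2)"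
    by (simp add: sum.distrib sum_distrib_left power2_eq_square sum_product mult_ac)
  also have "\<dots> \<le> C + \<mu>\<^sup>2 * C"
    using tr[of F "{..<m}" b] F orth by (intro add_mono mult_left_mono) auto
  finally have ES: "(LINT w|M. S w) \<le> C * (1 + \<mu>\<^sup>2)" by (simp add: algebra_simps)
  let ?B = "\<Pi>\<^sub>M s\<in>F. (borel :: (real \<times> real) measure)"
  let ?R = "\<Pi>\<^sub>M s\<in>F. (borel :: real measure)"
  define G where "G r = {p \<in> space (M \<Otimes>\<^sub>M N). (\<lambda>s\<in>F. (X s (fst p), W s (snd p) + r * X s (fst p))) \<in> B}" for r
  have map: "(\<lambda>p. \<lambda>s\<in>F. (X s (fst p), W s (snd p) + r * X s (fst p))) \<in> measurable (M \<Otimes>\<^sub>M N) ?B" for r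
  proof (rule measurable_restrict)
    fix s
    show "(\<lambda>p. (X s (fst p), W s (snd p) + r * X s (fst p))) \<in> borel_measurable (M \<Otimes>\<^sub>M N)"
      unfolding borel_prod[symmetric] by measurable
  qed
  have GM: "G r \<in> sets (M \<Otimes>\<^sub>M N)" for r
    using measurable_sets_Collect[OF map, of "\<lambda>y. y \<in> B"] B by (simp add: G_def sets.sets_into_space[THEN subsetD] space_PiM cong: conj_cong)
  have slice: "\<bar>measure N (Pair w -` G 0) - measure N (Pair w -` G \<beta>)\<bar> \<le> \<bar>\<beta>\<bar> * ((1 + S w) / 2)" if w: "w \<in> space M" for w
  proof -
    define A where "A = {v \<in> space ?R. (\<lambda>s\<in>F. (X s w, v s)) \<in> B}"
    have mA: "(\<lambda>v. \<lambda>s\<in>F. (X s w, v s)) \<in> measurable ?R ?B"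
    proof (rule measurable_restrict)
      fix s assume "s \<in> F"
      then have [measurable]: "(\<lambda>v. v s) \<in> borel_measurable ?R" by (rule measurable_component_singleton)
      show "(\<lambda>v. (X s w, v s)) \<in> borel_measurable ?R" unfolding borel_prod[symmetric] by measurable
    qed
    have A: "A \<in> sets ?R" unfolding A_def
      using measurable_sets[OF mA B] by (simp add: vimage_def Int_def conj_commute)
    have e: "Pair w -` G r = {w' \<in> space N. (\<lambda>s\<in>F. W s w' + r * X s w) \<in> A}" for r
      using w by (auto simp: G_def A_def space_pair_measure space_PiM cong: restrict_cong)
    have "\<bar>measure N (Pair w -` G 0) - measure N (Pair w -` G \<beta>)\<bar> \<le> \<bar>\<beta>\<bar> * sqrt (S w)"
      unfolding e S_def
      using gaussian_process_shift_tv[OF N F(1) comb[OF F(1)] cov symK orth rec A, of \<beta> "\<lambda>s. X s w"] by simp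
    also have "\<dots> \<le> \<bar>\<beta>\<bar> * ((1 + S w) / 2)"
    proof (rule mult_left_mono)
      have "S w \<ge> 0" unfolding S_def by (intro sum_nonneg) auto
      then show "sqrt (S w) \<le> (1 + S w) / 2" using arith_geo_mean_sqrt[of 1 "S w"] by simp
    qed simp
    finally show ?thesis .
  qed
  note p0 = measure_pair_prob_eq_integral[OF M N GM[of 0]] and p\<beta> = measure_pair_prob_eq_integral[OF M N GM[of \<beta>]]
  have "\<bar>measure (M \<Otimes>\<^sub>M N) (G 0) - measure (M \<Otimes>\<^sub>M N) (G \<beta>)\<bar>
     = \<bar>LINT w|M. measure N (Pair w -` G 0) - measure N (Pair w -` G \<beta>)\<bar>"
    using p0 p\<beta> by simp
  also have "\<dots> \<le> (LINT w|M. \<bar>measure N (Pair w -` G 0) - measure N (Pair w -` G \<beta>)\<bar>)"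
    using integral_norm_bound[of M "\<lambda>w. measure N (Pair w -` G 0) - measure N (Pair w -` G \<beta>)"] by simp
  also have "\<dots> \<le> (LINT w|M. \<bar>\<beta>\<bar> * ((1 + S w) / 2))"
    by (rule integral_mono) (use p0 p\<beta> slice Sint in auto)
  also have "\<dots> = \<bar>\<beta>\<bar> * ((1 + (LINT w|M. S w)) / 2)" using Sint by (simp add: M.prob_space)
  also have "\<dots> \<le> \<bar>\<beta>\<bar> * ((1 + C * (1 + \<mu>\<^sup>2)) / 2)" using ES by (intro mult_left_mono) auto
  finally show ?thesis by (simp add: G_def)
qed

subsection \<open>Independent copies and non-estimability\<close>

text \<open>Levy's theorem identifies the law with that of m + sqrt v times a standard normal
  variable; v = 0 yields the degenerate case. It is used to recognise sums of independent Gaussian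
  variables.\<close>

lemma (in prob_space) normal_rvI_char:
  assumes V[measurable]: "V \<in> borel_measurable M" and v: "v \<ge> 0"
    and ch: "\<And>t. (CLINT w|M. iexp (t * V w)) = iexp (t * m) * of_real (exp (- (t\<^sup>2 * v / 2)))"
  shows "normal_rv M V"
proof -
  let ?N = "std_normal_distribution"
  interpret N: real_distribution ?N by (rule real_dist_normal_dist)
  have rd: "real_distribution (distr M borel V)"
    unfolding real_distribution_def real_distribution_axioms_def by (auto intro!: prob_space_distr)
  have rd': "real_distribution (distr ?N borel (\<lambda>y. m + sqrt v * y))"
    unfolding real_distribution_def real_distribution_axioms_def by (auto intro!: N.prob_space_distr)
  have eq: "distr M borel V = distr ?N borel (\<lambda>y. m + sqrt v * y)"
  proof (rule Levy_uniqueness[OF rd rd'], rule ext)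
    fix t
    have "char (distr ?N borel (\<lambda>y. m + sqrt v * y)) t = (CLINT y|?N. iexp (t * (m + sqrt v * y)))"
      unfolding char_def by (subst integral_distr) auto
    also have "\<dots> = (CLINT y|?N. iexp (t * m) * iexp ((t * sqrt v) * y))"
      by (intro Bochner_Integration.integral_cong refl) (simp add: exp_add[symmetric] algebra_simps)
    also have "\<dots> = iexp (t * m) * char ?N (t * sqrt v)" unfolding char_def by (rule integral_mult_right_zero)
    also have "\<dots> = iexp (t * m) * of_real (exp (- (t\<^sup>2 * v / 2)))"
      unfolding char_std_normal_distribution using v by (simp add: power_mult_distrib)
    also have "\<dots> = char (distr M borel V) t" unfolding char_def ch[symmetric] by (subst integral_distr) simp_all
    finally show "char (distr M borel V) t = char (distr ?N borel (\<lambda>y. m + sqrt v * y)) t" ..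
  qed
  show ?thesis
  proof (cases "v = 0")
    case True
    have "AE x in distr M borel V. x = m" unfolding eq by (subst AE_distr_iff) (auto simp: True)
    then have "AE w in M. V w = m" by (subst (asm) AE_distr_iff) auto
    then show ?thesis unfolding normal_rv_def using V by blast
  next
    case False
    have "distributed ?N lborel (\<lambda>x. x) std_normal_density"
      unfolding distributed_def using distr_id2[of lborel ?N] by simp
    from N.normal_density_affine[OF this, of "sqrt v" m]
    have "distributed ?N lborel (\<lambda>x. m + sqrt v * x) (normal_density m (sqrt v))" using False v by simp
    then have "distr M lborel V = density lborel (normal_density m (sqrt v))"
      using eq by (simp add: distributed_def cong: distr_cong)
    then have "distributed M lborel V (normal_density m (sqrt v))" unfolding distributed_def by simp
    then show ?thesis unfolding normal_rv_def using V False v by (metis less_eq_real_def real_sqrt_gt_0_iff)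
  qed
qed

text \<open>Vanishing cross-covariances meet the condition with constant 0, whatever admissible
  cross exponent the model prescribes.\<close>

lemma condition_A_zero:
  assumes "\<alpha> > 0" "\<And>m::nat. \<alpha> \<noteq> 2 * real m"
  shows "condition_A L 0 \<alpha> (\<lambda>t. 0)"
proof -
  have "real_analytic_on (\<lambda>t. 0) UNIV"
    unfolding real_analytic_on_def by (intro ballI exI[of _ "\<lambda>_. 0"] exI[of _ 1]) auto
  then have "extends_analytically (\<lambda>t. 0) {-L..L}"
    unfolding extends_analytically_def by (intro exI[of _ UNIV] exI[of _ "\<lambda>t. 0"]) auto
  then show ?thesis
    unfolding condition_A_def using assms
    by (intro conjI exI[of _ "\<lambda>t. 0"] exI[of _ "\<lambda>k t. 0"]) (auto simp: even_on_def)
qed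

lemma piecewise_analytic_one:
  assumes "L > 0"
  shows "piecewise_analytic L (\<lambda>s. 1)"
proof -
  have "real_analytic_on (\<lambda>t. 1) UNIV"
    unfolding real_analytic_on_def
  proof (intro ballI exI conjI allI impI)
    fix x y :: real
    show "(\<lambda>n. (if n = 0 then 1 else 0) * (y - x) ^ n) sums 1"
      using sums_single[of 0 "\<lambda>n. (y - x) ^ n"] by (simp add: if_distrib[of "\<lambda>u. u * _"] cong: if_cong)
  qed (rule zero_less_one)
  then have "extends_analytically (\<lambda>t. 1) S" for S
    unfolding extends_analytically_def by (intro exI[of _ UNIV] exI[of _ "\<lambda>t. 1"]) auto
  then show ?thesis
    unfolding piecewise_analytic_def using assms
    by (intro exI[of _ 1] exI[of _ "\<lambda>i. if i = 0 then 0 else L"]) auto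
qed

text \<open>A constant generates only the empty set and the whole space. This serves the
  independence of the field and unit scales.\<close>

lemma (in prob_space) indep_var_const:
  assumes X[measurable]: "X \<in> measurable M S" and c: "c \<in> space T"
  shows "indep_var S X T (\<lambda>_. c)"
  unfolding indep_var_eq
proof (intro conjI)
  show "indep_set (sigma_sets (space M) {X -` A \<inter> space M |A. A \<in> sets S})
     (sigma_sets (space M) {(\<lambda>_. c) -` A \<inter> space M |A. A \<in> sets T})"
    unfolding indep_sets2_eq
  proof (intro conjI ballI)
    show "sigma_sets (space M) {X -` A \<inter> space M |A. A \<in> sets S} \<subseteq> events"
      by (intro sets.sigma_sets_subset) auto
    show "sigma_sets (space M) {(\<lambda>_. c) -` A \<inter> space M |A. A \<in> sets T} \<subseteq> events"
      using c by (intro sets.sigma_sets_subset) auto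
    fix A B assume A: "A \<in> sigma_sets (space M) {X -` A \<inter> space M |A. A \<in> sets S}"
      and B: "B \<in> sigma_sets (space M) {(\<lambda>_. c) -` A \<inter> space M |A. A \<in> sets T}"
    have "A \<subseteq> space M" using A by (rule sigma_sets_into_sp[rotated]) auto
    have "sigma_sets (space M) {(\<lambda>_. c) -` A \<inter> space M |A. A \<in> sets T} \<subseteq> sigma_sets (space M) {}"
      by (rule sigma_sets_mono) (auto simp: sigma_sets_empty_eq)
    then have "B = {} \<or> B = space M" using B by (auto simp: sigma_sets_empty_eq)
    then show "prob (A \<inter> B) = prob A * prob B"
      using \<open>A \<subseteq> space M\<close> by (auto simp: prob_space Int_absorb2)
  qed
qed (use c in auto)

lemma integral_pair_fst:
  fixes g :: "'a \<Rightarrow> 'c :: {banach, second_countable_topology}"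
  assumes M: "prob_space M" and N: "prob_space N" and [measurable]: "g \<in> borel_measurable M"
  shows "(LINT p|(M \<Otimes>\<^sub>M N). g (fst p)) = (LINT w|M. g w)"
proof -
  interpret M: prob_space M by fact
  interpret N: prob_space N by fact
  interpret pair_prob_space M N ..
  have "distr (M \<Otimes>\<^sub>M N) M fst = M" by (rule N.distr_pair_fst)
  then have "(LINT w|M. g w) = (LINT w|distr (M \<Otimes>\<^sub>M N) M fst. g w)" by simp
  also have "\<dots> = (LINT p|(M \<Otimes>\<^sub>M N). g (fst p))" by (rule integral_distr) measurable
  finally show ?thesis ..
qed

lemma integral_pair_snd:
  fixes g :: "'b \<Rightarrow> 'c :: {banach, second_countable_topology}"
  assumes M: "prob_space M" and N: "prob_space N" and [measurable]: "g \<in> borel_measurable N"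
  shows "(LINT p|(M \<Otimes>\<^sub>M N). g (snd p)) = (LINT w|N. g w)"
proof -
  interpret M: prob_space M by fact
  interpret N: prob_space N by fact
  interpret pair_prob_space M N ..
  have "distr (M \<Otimes>\<^sub>M N) N snd = N"
  proof (rule measure_eqI)
    fix A assume "A \<in> sets (distr (M \<Otimes>\<^sub>M N) N snd)"
    then have A: "A \<in> sets N" by simp
    then have "snd -` A \<inter> space (M \<Otimes>\<^sub>M N) = space M \<times> A"
      using sets.sets_into_space by (auto simp: space_pair_measure)
    then show "emeasure (distr (M \<Otimes>\<^sub>M N) N snd) A = emeasure N A"
      using A by (simp add: emeasure_distr N.emeasure_pair_measure_Times M.emeasure_space_1)
  qed simp
  then have "(LINT w|N. g w) = (LINT w|distr (M \<Otimes>\<^sub>M N) N snd. g w)" by simp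
  also have "\<dots> = (LINT p|(M \<Otimes>\<^sub>M N). g (snd p))" by (rule integral_distr) measurable
  finally show ?thesis ..
qed

lemma integral_pair_mult:
  fixes f :: "'a \<Rightarrow> 'c :: {real_normed_field, banach, second_countable_topology}"
  assumes M: "prob_space M" and N: "prob_space N"
    and int: "integrable (M \<Otimes>\<^sub>M N) (\<lambda>p. f (fst p) * g (snd p))"
  shows "(LINT p|(M \<Otimes>\<^sub>M N). f (fst p) * g (snd p)) = (LINT w|M. f w) * (LINT w|N. g w)"
proof -
  interpret M: prob_space M by fact
  interpret N: prob_space N by fact
  interpret pair_prob_space M N ..
  show ?thesis using integral_fst'[OF int] by simp
qed

text \<open>Taking \<open>Z 1\<close> from the first and \<open>Z 2\<close> from the second of two
  independent copies preserves both marginal laws, hence the variances and spectral densities, and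
  makes the cross-covariance 0. The law is moved to path space because members of the model live
  there.\<close>

lemma independent_copy_in_model:
  fixes M :: "'a measure"
  assumes L: "L > 0" and set: "confounding_setting L \<alpha> c K M Z \<sigma>X \<sigma>W" and spec: "spectral_conditions L \<alpha> K"
  defines "B \<equiv> (\<Pi>\<^sub>M s\<in>UNIV. (borel :: ((real \<times> real) \<times> (real \<times> real)) measure))"
    and "\<Psi> \<equiv> (\<lambda>p s. ((Z 1 s (fst p), Z 2 s (snd p)), (1::real, 1::real)))"
    and "Z' \<equiv> (\<lambda>(k::nat) s x. if k = 1 then fst (fst (x s)) else snd (fst (x s)))"
  shows "\<Psi> \<in> measurable (M \<Otimes>\<^sub>M M) B"
    and "in_model L \<alpha> (distr (M \<Otimes>\<^sub>M M) B \<Psi>) Z' (\<lambda>_ _. 1) (\<lambda>_ _. 1)"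
proof -
  have Z: "stationary_gaussian_field M Z K"
    and A: "\<And>k l. k \<in> {1, 2} \<Longrightarrow> l \<in> {1, 2} \<Longrightarrow> condition_A L (c k l) (\<alpha> k l) (K k l)"
    and c: "c 1 1 \<noteq> 0" "c 2 2 \<noteq> 0"
    and var: "\<And>k s. k \<in> {1, 2} \<Longrightarrow> covariance M (Z k s) (Z k s) = 1"
    using set unfolding confounding_setting_def by blast+
  from Z have M: "prob_space M" unfolding stationary_gaussian_field_def by blast
  interpret M: prob_space M by fact
  interpret MM: pair_prob_space M M ..
  from Z have comb: "\<And>S a b. finite S \<Longrightarrow> normal_rv M (\<lambda>w. \<Sum>s\<in>S. a s * Z 1 s w + b s * Z 2 s w)"
    and meas: "\<And>k s. k \<in> {1, 2} \<Longrightarrow> Z k s \<in> borel_measurable M"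
    and mean: "\<And>k. k \<in> {1, 2} \<Longrightarrow> \<exists>\<mu>. \<forall>s. (LINT w|M. Z k s w) = \<mu>"
    and cov: "\<And>k l s t. k \<in> {1, 2} \<Longrightarrow> l \<in> {1, 2} \<Longrightarrow> covariance M (Z k (s + t)) (Z l s) = K k l t"
    unfolding stationary_gaussian_field_def by blast+
  have m1[measurable]: "Z 1 s \<in> borel_measurable M" "Z (Suc 0) s \<in> borel_measurable M" and m2[measurable]: "Z 2 s \<in> borel_measurable M" for s
    using meas[of 1] meas[of 2] by auto
  show \<Psi>[measurable]: "\<Psi> \<in> measurable (M \<Otimes>\<^sub>M M) B"
  proof -
    have "(\<lambda>p. \<lambda>s\<in>UNIV. ((Z 1 s (fst p), Z 2 s (snd p)), (1::real, 1::real))) \<in> measurable (M \<Otimes>\<^sub>M M) B"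
      unfolding B_def
    proof (rule measurable_restrict)
      fix s
      show "(\<lambda>p. ((Z 1 s (fst p), Z 2 s (snd p)), (1::real, 1::real))) \<in> borel_measurable (M \<Otimes>\<^sub>M M)"
        by (intro borel_measurable_Pair) measurable
    qed
    then show ?thesis unfolding \<Psi>_def by (simp only: restrict_UNIV)
  qed
  let ?N = "distr (M \<Otimes>\<^sub>M M) B \<Psi>"
  interpret N: prob_space ?N by (rule MM.P.prob_space_distr) measurable
  have comp: "(\<lambda>x. fst (fst (x s))) \<in> borel_measurable B" "(\<lambda>x. snd (fst (x s))) \<in> borel_measurable B" for s
  proof -
    have proj: "(\<lambda>x. x s) \<in> measurable B borel" unfolding B_def by (rule measurable_component_singleton) simp
    have "(\<lambda>y :: (real \<times> real) \<times> (real \<times> real). fst (fst y)) \<in> borel_measurable borel"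
      "(\<lambda>y :: (real \<times> real) \<times> (real \<times> real). snd (fst y)) \<in> borel_measurable borel"
      by (intro borel_measurable_continuous_onI continuous_intros)+
    from measurable_compose[OF proj this(1)] measurable_compose[OF proj this(2)]
    show "(\<lambda>x. fst (fst (x s))) \<in> borel_measurable B" "(\<lambda>x. snd (fst (x s))) \<in> borel_measurable B" .
  qed
  have Z'm[measurable]: "Z' k s \<in> borel_measurable B" for k s
    using comp by (simp add: Z'_def)
  have Z'\<Psi>: "Z' 1 s (\<Psi> p) = Z 1 s (fst p)" "Z' 2 s (\<Psi> p) = Z 2 s (snd p)" "Z' (Suc 0) s (\<Psi> p) = Z 1 s (fst p)" for s p
    by (simp_all add: Z'_def \<Psi>_def)
  have n1: "normal_rv M (\<lambda>w. \<Sum>s\<in>S. a s * Z 1 s w)" and n2: "normal_rv M (\<lambda>w. \<Sum>s\<in>S. a s * Z 2 s w)" if "finite S" for S a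
    using comb[OF that, of a "\<lambda>_. 0"] comb[OF that, of "\<lambda>_. 0" a] by simp_all
  have int1: "integrable M (Z k s)" if "k \<in> {1, 2}" for k s
    using M.normal_rv_moments(1)[OF n1[of "{s}" "\<lambda>_. 1"]] M.normal_rv_moments(1)[OF n2[of "{s}" "\<lambda>_. 1"]] that by auto
  have gauss: "normal_rv ?N (\<lambda>x. \<Sum>s\<in>S. a s * Z' 1 s x + b s * Z' 2 s x)" if S: "finite S" for S a b
  proof -
    define P where "P w = (\<Sum>s\<in>S. a s * Z 1 s w)" for w
    define Q where "Q w = (\<Sum>s\<in>S. b s * Z 2 s w)" for w
    have Pn: "normal_rv M P" and Qn: "normal_rv M Q" unfolding P_def Q_def using S by (intro n1 n2; simp)+
    have [measurable]: "P \<in> borel_measurable M" "Q \<in> borel_measurable M" using Pn Qn by (simp_all add: normal_rv_def)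
    have sc: "normal_rv M (\<lambda>w. t * P w)" "normal_rv M (\<lambda>w. t * Q w)" for t
      using n1[OF S, of "\<lambda>s. t * a s"] n2[OF S, of "\<lambda>s. t * b s"] by (simp_all add: P_def Q_def sum_distrib_left mult.assoc)
    have ch: "(CLINT w|M. iexp (t * R w)) = iexp (t * M.expectation R) * of_real (exp (- (t\<^sup>2 * M.variance R / 2)))"
      if R: "\<And>t. normal_rv M (\<lambda>w. t * R w)" for R t
    proof -
      have "M.variance (\<lambda>w. t * R w) = t\<^sup>2 * M.variance R"
        by (simp add: right_diff_distrib[symmetric] power_mult_distrib)
      then show ?thesis using M.char_normal_rv[OF R[of t]] by simp
    qed
    show ?thesis
    proof (rule N.normal_rvI_char)
      show "(\<lambda>x. \<Sum>s\<in>S. a s * Z' 1 s x + b s * Z' 2 s x) \<in> borel_measurable ?N" by measurable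
      show "0 \<le> M.variance P + M.variance Q" by simp
      fix t
      have "(CLINT x|?N. iexp (t * (\<Sum>s\<in>S. a s * Z' 1 s x + b s * Z' 2 s x)))
        = (CLINT p|(M \<Otimes>\<^sub>M M). iexp (t * (\<Sum>s\<in>S. a s * Z' 1 s (\<Psi> p) + b s * Z' 2 s (\<Psi> p))))"
        by (rule integral_distr[OF \<Psi>]) measurable
      also have "\<dots> = (CLINT p|(M \<Otimes>\<^sub>M M). iexp (t * P (fst p)) * iexp (t * Q (snd p)))"
        unfolding Z'\<Psi> P_def Q_def by (simp add: sum.distrib exp_add[symmetric] algebra_simps)
      also have "\<dots> = (CLINT w|M. iexp (t * P w)) * (CLINT w|M. iexp (t * Q w))"
        by (rule integral_pair_mult[OF M M]) (rule MM.P.integrable_const_bound[where B = 1], auto simp: norm_mult)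
      also have "\<dots> = iexp (t * (M.expectation P + M.expectation Q)) * of_real (exp (- (t\<^sup>2 * (M.variance P + M.variance Q) / 2)))"
      proof -
        have "iexp (t * (M.expectation P + M.expectation Q)) = iexp (t * M.expectation P) * iexp (t * M.expectation Q)"
          by (simp add: exp_add[symmetric] algebra_simps)
        moreover have "exp (- (t\<^sup>2 * (M.variance P + M.variance Q) / 2)) = exp (- (t\<^sup>2 * M.variance P / 2)) * exp (- (t\<^sup>2 * M.variance Q / 2))"
          by (simp add: exp_add[symmetric] distrib_left add_divide_distrib)
        ultimately show ?thesis unfolding ch[OF sc(1)] ch[OF sc(2)] by simp
      qed
      finally show "(CLINT x|?N. iexp (t * (\<Sum>s\<in>S. a s * Z' 1 s x + b s * Z' 2 s x))) =
        iexp (t * (M.expectation P + M.expectation Q)) * of_real (exp (- (t\<^sup>2 * (M.variance P + M.variance Q) / 2)))" .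
    qed
  qed
  have E1: "(LINT x|?N. f x) = (LINT w|M. g w)"
    if [measurable]: "f \<in> borel_measurable B" "g \<in> borel_measurable M" and fg: "\<And>p. f (\<Psi> p) = g (fst p)" for f g :: "_ \<Rightarrow> real"
  proof -
    have "(LINT x|?N. f x) = (LINT p|(M \<Otimes>\<^sub>M M). f (\<Psi> p))" by (rule integral_distr[OF \<Psi>]) measurable
    then show ?thesis unfolding fg using integral_pair_fst[OF M M that(2)] by simp
  qed
  have E2: "(LINT x|?N. f x) = (LINT w|M. g w)"
    if [measurable]: "f \<in> borel_measurable B" "g \<in> borel_measurable M" and fg: "\<And>p. f (\<Psi> p) = g (snd p)" for f g :: "_ \<Rightarrow> real"
  proof -
    have "(LINT x|?N. f x) = (LINT p|(M \<Otimes>\<^sub>M M). f (\<Psi> p))" by (rule integral_distr[OF \<Psi>]) measurable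
    then show ?thesis unfolding fg using integral_pair_snd[OF M M that(2)] by simp
  qed
  have mean': "(LINT x|?N. Z' k s x) = (LINT w|M. Z k s w)" if "k \<in> {1, 2}" for k s
    using that E1[of "Z' 1 s" "Z 1 s"] E2[of "Z' 2 s" "Z 2 s"] by (auto simp: Z'\<Psi>)
  have cov_same: "covariance ?N (Z' k s) (Z' k t) = covariance M (Z k s) (Z k t)" if k: "k \<in> {1, 2}" for k s t
  proof -
    have "(LINT x|?N. (Z' k s x - (LINT w|M. Z k s w)) * (Z' k t x - (LINT w|M. Z k t w)))
      = (LINT w|M. (Z k s w - (LINT w|M. Z k s w)) * (Z k t w - (LINT w|M. Z k t w)))"
    proof (cases "k = 1")
      case True
      show ?thesis unfolding True by (rule E1) (auto simp: Z'\<Psi>)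
    next
      case False
      then have k2: "k = 2" using k by simp
      show ?thesis unfolding k2 by (rule E2) (auto simp: Z'\<Psi>)
    qed
    then show ?thesis unfolding covariance_def mean'[OF k] .
  qed
  have cov_cross: "covariance ?N (Z' 1 s) (Z' 2 t) = 0" for s t
  proof -
    let ?f = "\<lambda>w. Z 1 s w - (LINT w|M. Z 1 s w)" and ?g = "\<lambda>w. Z 2 t w - (LINT w|M. Z 2 t w)"
    have "covariance ?N (Z' 1 s) (Z' 2 t) = (LINT x|?N. (Z' 1 s x - (LINT w|M. Z 1 s w)) * (Z' 2 t x - (LINT w|M. Z 2 t w)))"
      unfolding covariance_def by (subst mean', simp)+ simp
    also have "\<dots> = (LINT p|(M \<Otimes>\<^sub>M M). ?f (fst p) * ?g (snd p))"
      by (subst integral_distr[OF \<Psi>]) (auto simp: Z'\<Psi>)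
    also have "\<dots> = 0"
    \<comment> \<open>In the non-integrable case the integral is 0 by convention, so both cases give
      the value 0.\<close>
    proof (cases "integrable (M \<Otimes>\<^sub>M M) (\<lambda>p. ?f (fst p) * ?g (snd p))")
      case True
      have "(LINT w|M. ?f w) = 0" using int1[of 1 s] by (simp add: M.prob_space)
      then show ?thesis using integral_pair_mult[OF M M True] by simp
    qed (rule not_integrable_integral_eq)
    finally show ?thesis .
  qed
  define K' where "K' k l t = (if k = l then K k k t else 0)" for k l :: nat and t :: real
  define c' where "c' k l = (if k = l then c k k else 0)" for k l :: nat
  have "stationary_gaussian_field ?N Z' K'"
    unfolding stationary_gaussian_field_def
  proof (intro conjI ballI allI impI)
    show "prob_space ?N" by (rule N.prob_space_axioms)
    show "Z' k s \<in> borel_measurable ?N" for k s by measurable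
    show "normal_rv ?N (\<lambda>x. \<Sum>s\<in>S. a s * Z' 1 s x + b s * Z' 2 s x)" if "finite S" for S a b by (rule gauss[OF that])
    show "\<exists>\<mu>. \<forall>s. (LINT w|?N. Z' k s w) = \<mu>" if "k \<in> {1, 2}" for k
      using mean[OF that] by (simp only: mean'[OF that])
    show "covariance ?N (Z' k (s + t)) (Z' l s) = K' k l t" if kl: "k \<in> {1, 2}" "l \<in> {1, 2}" for k l s t
    proof (cases "k = l")
      case True
      then show ?thesis using cov_same[OF kl(1)] cov[OF kl(1) kl(1)] by (simp add: K'_def)
    next
      case False
      then have "k = 1 \<and> l = 2 \<or> k = 2 \<and> l = 1" using kl by auto
      then have "covariance ?N (Z' k (s + t)) (Z' l s) = 0"
        using cov_cross[of "s + t" s] cov_cross[of s "s + t"] covariance_commute[of ?N "Z' 2 (s + t)" "Z' 1 s"] by auto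
      then show ?thesis using False by (simp add: K'_def)
    qed
  qed
  moreover have "condition_A L (c' k l) (\<alpha> k l) (K' k l)" if kl: "k \<in> {1, 2}" "l \<in> {1, 2}" for k l
  proof (cases "k = l")
    case True
    then have "K' k l = K k l" "c' k l = c k l" by (simp_all add: K'_def c'_def fun_eq_iff)
    then show ?thesis using A[OF kl] by simp
  next
    case False
    then have "K' k l = (\<lambda>t. 0)" "c' k l = 0" by (simp_all add: K'_def c'_def fun_eq_iff)
    then show ?thesis using condition_A_zero[of "\<alpha> k l" L] A[OF kl] unfolding condition_A_def[of L "c k l"] by simp
  qed
  moreover have "covariance ?N (Z' k s) (Z' k s) = 1" if "k \<in> {1, 2}" for k s
    using cov_same[OF that] var[OF that] by simp
  moreover have "scale_processes L ?N Z' (\<lambda>_ _. 1) (\<lambda>_ _. 1)"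
    unfolding scale_processes_def
  proof (intro conjI allI ballI)
    show "AE w in ?N. piecewise_analytic L (\<lambda>s. 1) \<and> piecewise_analytic L (\<lambda>s. 1)"
      using piecewise_analytic_one[OF L] by auto
    have "(\<lambda>x. \<lambda>s\<in>UNIV. (Z' 1 s x, Z' 2 s x)) \<in> measurable ?N (\<Pi>\<^sub>M s\<in>UNIV. (borel :: (real \<times> real) measure))"
    proof (rule measurable_restrict)
      fix s
      show "(\<lambda>x. (Z' 1 s x, Z' 2 s x)) \<in> borel_measurable ?N" by (intro borel_measurable_Pair) measurable
    qed
    then show "N.indep_var (\<Pi>\<^sub>M s\<in>UNIV. (borel :: (real \<times> real) measure)) (\<lambda>w s. (Z' 1 s w, Z' 2 s w))
       (\<Pi>\<^sub>M s\<in>UNIV. (borel :: (real \<times> real) measure)) (\<lambda>w s. (1, 1))"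
      unfolding restrict_UNIV by (intro N.indep_var_const) (simp_all add: space_PiM)
  qed auto
  moreover have "c' 1 1 \<noteq> 0" "c' 2 2 \<noteq> 0" using c by (simp_all add: c'_def)
  ultimately have "confounding_setting L \<alpha> c' K' ?N Z' (\<lambda>_ _. 1) (\<lambda>_ _. 1)"
    unfolding confounding_setting_def by blast
  moreover have "spectral_conditions L \<alpha> K'"
  proof -
    have "K' i i = K i i" for i by (simp add: K'_def fun_eq_iff)
    then show ?thesis using spec unfolding spectral_conditions_def by simp
  qed
  ultimately show "in_model L \<alpha> ?N Z' (\<lambda>_ _. 1) (\<lambda>_ _. 1)" unfolding in_model_def by blast
qed

lemma not_consistently_estimable:
  fixes M :: "'a measure"
  assumes L: "L > 0" and set: "confounding_setting L \<alpha> c K M Z \<sigma>X \<sigma>W" and spec: "spectral_conditions L \<alpha> K"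
    and \<alpha>: "\<alpha> 1 1 > \<alpha> 2 2 + 1"
  shows "\<not> consistently_estimable L \<alpha>"
proof
  assume "consistently_estimable L \<alpha>"
  then obtain T where Tm: "\<And>n. T n \<in> borel_measurable (\<Pi>\<^sub>M s\<in>{0..L}. (borel :: (real \<times> real) measure))"
    and T: "\<And>\<beta> M Z \<sigma>X \<sigma>W. in_model L \<alpha> M Z \<sigma>X \<sigma>W \<Longrightarrow>
       converges_in_prob M (\<lambda>n w. T n (\<lambda>s\<in>{0..L}. (scaled \<sigma>X (Z 1) s w, response \<beta> (scaled \<sigma>X (Z 1)) (scaled \<sigma>W (Z 2)) s w))) \<beta>"
    unfolding consistently_estimable_def Let_def by blast
  have Z: "stationary_gaussian_field M Z K"
    and A: "\<And>k l. k \<in> {1, 2} \<Longrightarrow> l \<in> {1, 2} \<Longrightarrow> condition_A L (c k l) (\<alpha> k l) (K k l)"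
    using set unfolding confounding_setting_def by blast+
  from Z have M: "prob_space M"
    and comb: "\<And>S a b. finite S \<Longrightarrow> normal_rv M (\<lambda>w. \<Sum>s\<in>S. a s * Z 1 s w + b s * Z 2 s w)"
    and meas: "\<And>k s. k \<in> {1, 2} \<Longrightarrow> Z k s \<in> borel_measurable M"
    and cov: "\<And>k l s t. k \<in> {1, 2} \<Longrightarrow> l \<in> {1, 2} \<Longrightarrow> covariance M (Z k (s + t)) (Z l s) = K k l t"
    unfolding stationary_gaussian_field_def by blast+
  interpret M: prob_space M by fact
  interpret MM: pair_prob_space M M ..
  have [measurable]: "Z 1 s \<in> borel_measurable M" "Z (Suc 0) s \<in> borel_measurable M" "Z 2 s \<in> borel_measurable M" for s
    using meas[of 1] meas[of 2] by auto
  obtain f where sd: "\<And>i. i \<in> {1, 2} \<Longrightarrow> spectral_density (K i i) (f i)"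
    and fpos: "\<And>i x. i \<in> {1, 2} \<Longrightarrow> f i x > 0" and fcont: "\<And>i. i \<in> {1, 2} \<Longrightarrow> continuous_on UNIV (f i)"
    and fth: "\<And>i. i \<in> {1, 2} \<Longrightarrow> f i \<in> \<Theta>[at_infinity](\<lambda>x. \<bar>x\<bar> powr (- (\<alpha> i i + 1)))"
    using spec unfolding spectral_conditions_def regular_density_def by blast
  have \<alpha>2: "\<alpha> 2 2 > 0" using A[of 2 2] unfolding condition_A_def by simp
  obtain C where C: "C > 0" and tr: "\<And>F J (b :: nat \<Rightarrow> real \<Rightarrow> real). finite F \<Longrightarrow> F \<subseteq> {0..L} \<Longrightarrow> finite J \<Longrightarrow>
     (\<And>k l. k \<in> J \<Longrightarrow> l \<in> J \<Longrightarrow> (\<Sum>s\<in>F. \<Sum>t\<in>F. b k s * b l t * K 2 2 (s - t)) = (if k = l then 1 else 0)) \<Longrightarrow>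
     (\<Sum>k\<in>J. \<Sum>s\<in>F. \<Sum>t\<in>F. b k s * b k t * K 1 1 (s - t)) \<le> C \<and> (\<Sum>k\<in>J. (\<Sum>s\<in>F. b k s)\<^sup>2) \<le> C"
  proof -
    have i: "1 \<in> {1, 2 :: nat}" "2 \<in> {1, 2 :: nat}" by simp_all
    note stb = spectral_trace_bound[OF L sd[OF i(1)] sd[OF i(2)] fpos[OF i(1)] fpos[OF i(2)] fcont[OF i(1)] fcont[OF i(2)]
            fth[OF i(1)] fth[OF i(2)] \<alpha> \<alpha>2]
    show thesis
      using stb that by blast
  qed
  obtain \<mu> where X2: "\<And>k l s t. k \<in> {1, 2} \<Longrightarrow> l \<in> {1, 2} \<Longrightarrow> integrable M (\<lambda>w. Z k s w * Z l t w)"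
    and EX2: "\<And>k l s t. k \<in> {1, 2} \<Longrightarrow> l \<in> {1, 2} \<Longrightarrow> M.expectation (\<lambda>w. Z k s w * Z l t w) = K k l (s - t) + \<mu> k * \<mu> l"
    by (rule stationary_gaussian_field_raw_moments[OF Z]; rule that; assumption)
  define d where "d = 1 + C * (1 + (\<mu> 1)\<^sup>2)"
  have d: "d > 0" using C by (simp add: d_def add_pos_nonneg)
  \<comment> \<open>This slope turns the bound of \<open>independent_shift_tv\<close> into exactly 1
    / 2.\<close>
  define \<beta> where "\<beta> = 1 / d"
  have \<beta>: "\<beta> > 0" using d by (simp add: \<beta>_def)

  let ?I = "{0..L}"
  let ?S = "\<Pi>\<^sub>M s\<in>?I. (borel :: (real \<times> real) measure)"
  \<comment> \<open>\<open>V r\<close> is the observed path of (X, Y) for slope r, with the field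
    components on separate factors and unit scales.\<close>
  define V where "V r p = (\<lambda>s\<in>?I. (Z 1 s (fst p), Z 2 s (snd p) + r * Z 1 s (fst p)))" for r p
  have V[measurable]: "V r \<in> measurable (M \<Otimes>\<^sub>M M) ?S" for r
    unfolding V_def
  proof (rule measurable_restrict)
    fix s
    show "(\<lambda>p. (Z 1 s (fst p), Z 2 s (snd p) + r * Z 1 s (fst p))) \<in> borel_measurable (M \<Otimes>\<^sub>M M)"
      by (intro borel_measurable_Pair) measurable
  qed
  define D where "D r = distr (M \<Otimes>\<^sub>M M) ?S (V r)" for r
  have D: "prob_space (D r)" "sets (D r) = sets ?S" for r
    unfolding D_def by (auto intro!: MM.P.prob_space_distr)
  have tv: "\<bar>measure (D 0) E - measure (D \<beta>) E\<bar> \<le> 1 / 2" if E: "E \<in> sets ?S" for E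
  proof (rule PiM_tv_le_if_cylinder_tv_le[OF D D _ E])
    fix F B assume F: "finite F" "F \<subseteq> ?I" and B: "B \<in> sets (\<Pi>\<^sub>M s\<in>F. (borel :: (real \<times> real) measure))"
    have e: "measure (D r) (prod_emb ?I (\<lambda>_. borel) F B) = measure (M \<Otimes>\<^sub>M M)
        {p \<in> space (M \<Otimes>\<^sub>M M). (\<lambda>s\<in>F. (Z 1 s (fst p), Z 2 s (snd p) + r * Z 1 s (fst p))) \<in> B}" for r
    proof -
      have "restrict (V r p) F = (\<lambda>s\<in>F. (Z 1 s (fst p), Z 2 s (snd p) + r * Z 1 s (fst p)))" for p
        using F(2) by (auto simp: V_def fun_eq_iff restrict_def)
      then have "V r -` prod_emb ?I (\<lambda>_. borel) F B \<inter> space (M \<Otimes>\<^sub>M M) =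
          {p \<in> space (M \<Otimes>\<^sub>M M). (\<lambda>s\<in>F. (Z 1 s (fst p), Z 2 s (snd p) + r * Z 1 s (fst p))) \<in> B}"
        by (auto simp: prod_emb_def V_def)
      moreover have "prod_emb ?I (\<lambda>_. borel) F B \<in> sets ?S" using F B by (intro measurable_prod_emb) auto
      ultimately show ?thesis unfolding D_def by (simp add: measure_distr)
    qed
    have "\<bar>measure (D 0) (prod_emb ?I (\<lambda>_. borel) F B) - measure (D \<beta>) (prod_emb ?I (\<lambda>_. borel) F B)\<bar>
      \<le> \<bar>\<beta>\<bar> * ((1 + C * (1 + (\<mu> 1)\<^sup>2)) / 2)"
      unfolding e mult_zero_left add_0_right
    proof (rule independent_shift_tv[OF M M F, where ?K1.0 = "K 1 1" and ?K2.0 = "K 2 2"])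
      show "M.expectation (\<lambda>w. Z 1 s w * Z 1 t w) = K 1 1 (s - t) + (\<mu> 1)\<^sup>2" for s t
        using EX2[of 1 1 s t] by (simp add: power2_eq_square)
      show "normal_rv M (\<lambda>w. \<Sum>s\<in>F. b s * Z 2 s w)" if "finite F" for F b
        using comb[OF that, of "\<lambda>_. 0" b] by simp
      show "covariance M (Z 2 s) (Z 2 t) = K 2 2 (s - t)" for s t
        using cov[of 2 2 t "s - t"] by simp
      show "(\<Sum>s\<in>F. \<Sum>t\<in>F. a s * a t * K 2 2 (s - t)) > 0" if "finite F" "s0 \<in> F" "a s0 \<noteq> 0" for F a s0
        by (rule spectral_positive_definite[OF sd[of 2] fpos[of 2] that(1,2), of a]) (use that in auto)
      show "B \<in> sets (\<Pi>\<^sub>M s\<in>F. borel)" by (rule B)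
    qed (use X2 tr in \<open>auto\<close>)
    also have "\<dots> = 1 / 2" unfolding d_def[symmetric] using d by (simp add: \<beta>_def)
    finally show "\<bar>measure (D 0) (prod_emb ?I (\<lambda>_. borel) F B) - measure (D \<beta>) (prod_emb ?I (\<lambda>_. borel) F B)\<bar> \<le> 1 / 2" .
  qed

  \<comment> \<open>Estimability speaks of members on path space. Composing the path map with the
    observation map gives \<open>V r\<close>, so the failure probabilities there are those under
    \<open>D r\<close>.\<close>
  have conv: "(\<lambda>n. measure (D r) {y \<in> space ?S. \<bar>T n y - r\<bar> > \<epsilon>}) \<longlonglongrightarrow> 0" if \<epsilon>: "\<epsilon> > 0" for r \<epsilon>
  proof -
    define B where "B = (\<Pi>\<^sub>M s\<in>(UNIV :: real set). (borel :: ((real \<times> real) \<times> (real \<times> real)) measure))"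
    define \<Psi> where "\<Psi> = (\<lambda>p s. ((Z 1 s (fst p), Z 2 s (snd p)), (1::real, 1::real)))"
    define Z' where "Z' = (\<lambda>(k::nat) s (x :: sample_path). if k = 1 then fst (fst (x s)) else snd (fst (x s)))"
    define N where "N = distr (M \<Otimes>\<^sub>M M) B \<Psi>"
    define Y where "Y x = (\<lambda>s\<in>?I. (scaled (\<lambda>_ _. 1) (Z' 1) s x, response r (scaled (\<lambda>_ _. 1) (Z' 1)) (scaled (\<lambda>_ _. 1) (Z' 2)) s x))"
      for x :: sample_path
    have \<Psi>m: "\<Psi> \<in> measurable (M \<Otimes>\<^sub>M M) B" and model: "in_model L \<alpha> N Z' (\<lambda>_ _. 1) (\<lambda>_ _. 1)"
      unfolding N_def \<Psi>_def B_def Z'_def by (rule independent_copy_in_model[OF L set spec])+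
    have YV: "Y (\<Psi> p) = V r p" for p
      by (simp add: Y_def \<Psi>_def Z'_def scaled_def response_def V_def mult.commute add.commute cong: restrict_cong)
    have Ym: "Y \<in> measurable B ?S"
      unfolding Y_def
    proof (rule measurable_restrict)
      fix s
      have proj: "(\<lambda>x. x s) \<in> measurable B borel" unfolding B_def by (rule measurable_component_singleton) simp
      have "(\<lambda>y :: (real \<times> real) \<times> (real \<times> real). (fst (fst y), fst (fst y) * r + snd (fst y))) \<in> borel_measurable borel"
        by (intro borel_measurable_continuous_onI continuous_intros)
      from measurable_compose[OF proj this]
      show "(\<lambda>x. (scaled (\<lambda>_ _. 1) (Z' 1) s x, response r (scaled (\<lambda>_ _. 1) (Z' 1)) (scaled (\<lambda>_ _. 1) (Z' 2)) s x)) \<in> borel_measurable B"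
        by (simp add: scaled_def response_def Z'_def)
    qed
    have E: "{y \<in> space ?S. \<bar>T n y - r\<bar> > \<epsilon>} \<in> sets ?S" for n using Tm by measurable
    have DN: "D r = distr N ?S Y"
      unfolding D_def N_def by (subst distr_distr[OF Ym \<Psi>m]) (simp only: o_def YV)
    have "measure N {x \<in> space N. \<bar>T n (Y x) - r\<bar> > \<epsilon>} = measure (D r) {y \<in> space ?S. \<bar>T n y - r\<bar> > \<epsilon>}" for n
    proof -
      have Ym': "Y \<in> measurable N ?S" using Ym by (simp add: N_def)
      have "{x \<in> space N. \<bar>T n (Y x) - r\<bar> > \<epsilon>} = Y -` {y \<in> space ?S. \<bar>T n y - r\<bar> > \<epsilon>} \<inter> space N"
        using measurable_space[OF Ym'] by auto
      then show ?thesis unfolding DN by (simp only: measure_distr[OF Ym' E])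
    qed
    moreover have "(\<lambda>n. measure N {x \<in> space N. \<bar>T n (Y x) - r\<bar> > \<epsilon>}) \<longlonglongrightarrow> 0"
      using T[OF model, of r] \<epsilon> unfolding converges_in_prob_def Y_def[symmetric] by blast
    ultimately show ?thesis by simp
  qed
  \<comment> \<open>No number is within \<beta> / 3 of both 0 and \<beta>, so the two failure events
    cover the space. Under slope \<beta> the first has probability below 1 / 4 + 1 / 2 and the
    second below 1 / 4, which cannot add up to 1.\<close>
  define E where "E n = {y \<in> space ?S. \<bar>T n y - 0\<bar> > \<beta> / 3}" for n
  define E' where "E' n = {y \<in> space ?S. \<bar>T n y - \<beta>\<bar> > \<beta> / 3}" for n
  have ES: "E n \<in> sets ?S" "E' n \<in> sets ?S" for n unfolding E_def E'_def using Tm by measurable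
  have "(\<lambda>n. measure (D 0) (E n)) \<longlonglongrightarrow> 0" "(\<lambda>n. measure (D \<beta>) (E' n)) \<longlonglongrightarrow> 0"
    unfolding E_def E'_def using \<beta> by (intro conv; simp)+
  then have "\<forall>\<^sub>F n in sequentially. measure (D 0) (E n) < 1 / 4 \<and> measure (D \<beta>) (E' n) < 1 / 4"
    by (intro eventually_conj order_tendstoD(2)) auto
  then obtain n where n: "measure (D 0) (E n) < 1 / 4" "measure (D \<beta>) (E' n) < 1 / 4"
    by (auto simp: eventually_sequentially)
  interpret D\<beta>: prob_space "D \<beta>" by (rule D)
  have "1 = measure (D \<beta>) (space ?S)" using D\<beta>.prob_space sets_eq_imp_space_eq[OF D(2)[of \<beta>]] by simp
  also have "\<dots> \<le> measure (D \<beta>) (E n \<union> E' n)"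
  proof (rule D\<beta>.finite_measure_mono)
    show "space ?S \<subseteq> E n \<union> E' n"
    proof
      fix y assume "y \<in> space ?S"
      moreover have "\<bar>T n y\<bar> > \<beta> / 3 \<or> \<bar>T n y - \<beta>\<bar> > \<beta> / 3" using \<beta> by linarith
      ultimately show "y \<in> E n \<union> E' n" by (auto simp: E_def E'_def)
    qed
  qed (use ES D in auto)
  also have "\<dots> \<le> measure (D \<beta>) (E n) + measure (D \<beta>) (E' n)" by (rule measure_Un_le) (use ES D in auto)
  finally show False using tv[OF ES(1), of n] n by linarith
qed

theorem corollary8:
  fixes L :: real
    and \<alpha> c :: "nat \<Rightarrow> nat \<Rightarrow> real"
    and K :: "nat \<Rightarrow> nat \<Rightarrow> real \<Rightarrow> real"
    and M :: "'a measure"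
    and Z :: "nat \<Rightarrow> real \<Rightarrow> 'a \<Rightarrow> real"
    and \<sigma>X \<sigma>W :: "real \<Rightarrow> 'a \<Rightarrow> real"
  assumes "L > 0"
    and "confounding_setting L \<alpha> c K M Z \<sigma>X \<sigma>W"
  shows "(\<alpha> 1 1 < Min {\<alpha> 1 2, \<alpha> 2 2 + 1, 2} \<longrightarrow>
      (\<forall>\<beta>. let X = scaled \<sigma>X (Z 1); W = scaled \<sigma>W (Z 2); Y = response \<beta> X W in
         converges_in_prob M (first_difference_ols L X Y) \<beta>)) \<and>
    (\<alpha> 1 1 > \<alpha> 2 2 + 1 \<and> spectral_conditions L \<alpha> K \<longrightarrow> \<not> consistently_estimable L \<alpha>)"
  unfolding Let_def
  using ols_consistent[OF assms] not_consistently_estimable[OF assms] by auto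

end
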